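(* Let $K=K(n)$ be a sequence of positive integers tending to infinity with $n$, let $c_{n,K}>0$ be a sequence of normalizing constants, and let $Z_{n,K}(i)=f_K(Y_K(i))/c_{n,K}$ for $i\in\mathbb{N}$. Assume that there are $\sigma\ge 0$, $\lambda\geq 0$ and a real random variable $Z_0$ such that, as $n\to\infty$, \[\frac{n}{c_{n,K}^2}\longrightarrow\sigma^2,\qquad \frac{n}{K}\longrightarrow\lambda,\qquad Z_{n,K}(0)\overset{\mathcal{D}}{\longrightarrow} Z_0 .\] Then the processes $\left(Z_{n,K}(\lfloor nt\rfloor)\right)_{t\geq 0}$ converge in distribution, as $n\to\infty$, in the space of càdlàg functions $D(\mathbb{R}_+,\mathbb{R})$ endowed with the Skorokhod topology, to $\left(O_{\lambda,\sigma}(t)\right)_{t\geq 0}$, the diffusion process solving \[dO_{\lambda,\sigma}(t)=-2\lambda\, O_{\lambda,\sigma}(t)\,dt+2\sigma\, dW_t,\qquad O_{\lambda,\sigma}(0)\overset{\mathcal{D}}{=} Z_0,\] where $(W_t)_{t\ge 0}$ is a standard Brownian motion starting from $0$ (independent of $O_{\lambda,\sigma}(0)$).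
   Context: For $K\ge 1$, $V_K=\{-1,+1\}^K$ is the vertex set of the $K$-dimensional hypercube, in which two vertices are adjacent iff they differ in exactly one coordinate. $(Y_K(i))_{i\ge 0}$ is the simple random walk on this graph (at each step a uniformly chosen coordinate, independent of the past, changes sign), started from a probability law $\mu_K$ on $V_K$. The function $f_K:V_K\to\mathbb{R}$ is the sum of coordinates, $f_K(v)=\sum_{i=1}^K v^{(i)}$. *)

theory Defs
  imports "HOL-Probability.Probability"
begin

definition simple_random_walk ::
    "'v set \<Rightarrow> ('v \<Rightarrow> 'v \<Rightarrow> bool) \<Rightarrow> 'v pmf \<Rightarrow> 'a measure \<Rightarrow> (nat \<Rightarrow> 'a \<Rightarrow> 'v) \<Rightarrow> bool" where
  "simple_random_walk V adj \<mu> M Y \<longleftrightarrow>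
     prob_space M \<and> set_pmf \<mu> \<subseteq> V \<and>
     (\<forall>i. Y i \<in> M \<rightarrow>\<^sub>M count_space V) \<and>
     (\<forall>v\<in>V. measure M {\<omega> \<in> space M. Y 0 \<omega> = v} = pmf \<mu> v) \<and>
     (\<forall>m. \<forall>v \<in> {..m} \<rightarrow> V. \<forall>w\<in>V.
        measure M {\<omega> \<in> space M. (\<forall>i\<le>m. Y i \<omega> = v i) \<and> Y (Suc m) \<omega> = w} =
        measure M {\<omega> \<in> space M. \<forall>i\<le>m. Y i \<omega> = v i} *
          pmf (pmf_of_set {u \<in> V. adj (v m) u}) w)"

definition hypercube :: "nat \<Rightarrow> (nat \<Rightarrow> int) set" where
  "hypercube k = ({1..k} \<rightarrow>\<^sub>E {-1, 1})"

definition hypercube_adj :: "nat \<Rightarrow> (nat \<Rightarrow> int) \<Rightarrow> (nat \<Rightarrow> int) \<Rightarrow> bool" where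
  "hypercube_adj k v w \<longleftrightarrow> card {i \<in> {1..k}. v i \<noteq> w i} = 1"

definition coord_sum :: "nat \<Rightarrow> (nat \<Rightarrow> int) \<Rightarrow> real" where
  "coord_sum k v = (\<Sum>i=1..k. real_of_int (v i))"

lemma hypercube_neighbours:
  assumes "v \<in> hypercube k"
  shows "{w \<in> hypercube k. hypercube_adj k v w} = (\<lambda>j. v(j := - v j)) ` {1..k}"
proof (intro equalityI subsetI)
  fix w assume "w \<in> {w \<in> hypercube k. hypercube_adj k v w}"
  then have w: "w \<in> {1..k} \<rightarrow>\<^sub>E {-1, 1}" and "card {i \<in> {1..k}. v i \<noteq> w i} = 1"
    by (auto simp: hypercube_def hypercube_adj_def)
  then obtain j where j: "{i \<in> {1..k}. v i \<noteq> w i} = {j}"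
    by (metis card_1_singletonE)
  have v: "v \<in> {1..k} \<rightarrow>\<^sub>E {-1, 1}"
    using assms by (simp add: hypercube_def)
  have "j \<in> {i \<in> {1..k}. v i \<noteq> w i}" unfolding j by simp
  then have jk: "j \<in> {1..k}" "v j \<noteq> w j" by blast+
  have "v j \<in> {-1, 1}" "w j \<in> {-1, 1}"
    using PiE_mem[OF v jk(1)] PiE_mem[OF w jk(1)] by auto
  then have "w j = - v j" using jk(2) by auto
  moreover have "w i = v i" if "i \<noteq> j" for i
  proof (cases "i \<in> {1..k}")
    case True
    have "i \<notin> {i \<in> {1..k}. v i \<noteq> w i}" unfolding j using that by simp
    then show ?thesis using True by simp
  next
    case False
    then show ?thesis using PiE_arb[OF v False] PiE_arb[OF w False] by simp
  qed
  ultimately have "w = v(j := - v j)" by (intro ext) (simp only: fun_upd_apply split: if_split, blast)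
  then show "w \<in> (\<lambda>j. v(j := - v j)) ` {1..k}" using jk(1) by blast
next
  fix w assume "w \<in> (\<lambda>j. v(j := - v j)) ` {1..k}"
  then obtain j where j: "j \<in> {1..k}" and w: "w = v(j := - v j)" by blast
  have v: "v \<in> {1..k} \<rightarrow>\<^sub>E {-1, 1}"
    using assms by (simp add: hypercube_def)
  have vj: "v j \<in> {-1, 1}" using PiE_mem[OF v j] .
  have "w \<in> {1..k} \<rightarrow>\<^sub>E {-1, 1}"
  proof (rule PiE_I)
    show "w i \<in> {-1, 1}" if "i \<in> {1..k}" for i
      using vj PiE_mem[OF v that] by (auto simp: w)
    show "w i = undefined" if "i \<notin> {1..k}" for i
      using PiE_arb[OF v that] that j by (auto simp: w)
  qed
  moreover have "{i \<in> {1..k}. v i \<noteq> w i} = {j}"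
    using j vj by (auto simp: w)
  ultimately show "w \<in> {w \<in> hypercube k. hypercube_adj k v w}"
    by (simp add: hypercube_def hypercube_adj_def)
qed

lemma hypercube_step:
  assumes v: "v \<in> hypercube k" and k: "k \<ge> 1"
  shows "pmf_of_set {w \<in> hypercube k. hypercube_adj k v w} =
         map_pmf (\<lambda>j. v(j := - v j)) (pmf_of_set {1..k})"
proof -
  have "inj_on (\<lambda>j. v(j := - v j)) {1..k}"
  proof (rule inj_onI)
    fix i j assume i: "i \<in> {1..k}" and eq: "v(i := - v i) = v(j := - v j)"
    have "v i \<in> {-1, 1}" using v i unfolding hypercube_def by (rule PiE_mem)
    then have "v i \<noteq> - v i" by auto
    then show "i = j" using fun_cong[OF eq, of i] by (auto split: if_splits)
  qed
  then show ?thesis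
    using k by (simp add: hypercube_neighbours[OF v] map_pmf_of_set_inj)
qed

definition cadlag_paths :: "(real \<Rightarrow> real) set" where
  "cadlag_paths = {x \<in> extensional {0..}.
     (\<forall>t\<ge>0. (x \<longlongrightarrow> x t) (at_right t)) \<and>
     (\<forall>t>0. \<exists>l. (x \<longlongrightarrow> l) (at_left t))}"

definition time_changes :: "(real \<Rightarrow> real) set" where
  "time_changes = {l. l 0 = 0 \<and> continuous_on {0..} l \<and> strict_mono_on {0..} l \<and>
     filterlim l at_top at_top}"

definition skorokhod_conv :: "(nat \<Rightarrow> real \<Rightarrow> real) \<Rightarrow> (real \<Rightarrow> real) \<Rightarrow> bool" where
  "skorokhod_conv X x \<longleftrightarrow>
     (\<exists>l. (\<forall>n. l n \<in> time_changes) \<and> uniform_limit {0..} l (\<lambda>t. t) sequentially \<and>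
        (\<forall>N. uniform_limit {0..N} (\<lambda>n t. X n (l n t)) x sequentially))"

text \<open>
  The Skorokhod (J1) topology on \<open>D(\<real>\<^sub>+, \<real>)\<close> is the metrizable topology whose convergent sequences
  are those of \<^const>\<open>skorokhod_conv\<close> (Jacod and Shiryaev, Limit Theorems for Stochastic Processes,
  VI.1.14). A metrizable topology is sequential, so its open sets are exactly the sequentially
  open ones.
\<close>

definition skorokhod_open :: "(real \<Rightarrow> real) set \<Rightarrow> bool" where
  "skorokhod_open U \<longleftrightarrow> U \<subseteq> cadlag_paths \<and>
     (\<forall>X x. (\<forall>n. X n \<in> cadlag_paths) \<and> x \<in> U \<and> skorokhod_conv X x \<longrightarrow>
        (\<forall>\<^sub>F n in sequentially. X n \<in> U))"

definition skorokhod_topology :: "(real \<Rightarrow> real) topology" where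
  "skorokhod_topology = topology skorokhod_open"

lemma istopology_skorokhod_open: "istopology skorokhod_open"
  unfolding istopology_def
proof (intro conjI allI impI)
  fix S T assume S: "skorokhod_open S" and T: "skorokhod_open T"
  show "skorokhod_open (S \<inter> T)"
    unfolding skorokhod_open_def
  proof (intro conjI allI impI)
    show "S \<inter> T \<subseteq> cadlag_paths" using S by (auto simp: skorokhod_open_def)
    fix X x
    assume "(\<forall>n. X n \<in> cadlag_paths) \<and> x \<in> S \<inter> T \<and> skorokhod_conv X x"
    then have "\<forall>\<^sub>F n in sequentially. X n \<in> S" "\<forall>\<^sub>F n in sequentially. X n \<in> T"
      using S T unfolding skorokhod_open_def by blast+
    then show "\<forall>\<^sub>F n in sequentially. X n \<in> S \<inter> T"
      by eventually_elim simp
  qed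
next
  fix \<K> assume K: "\<forall>S\<in>\<K>. skorokhod_open S"
  show "skorokhod_open (\<Union>\<K>)"
    unfolding skorokhod_open_def
  proof (intro conjI allI impI)
    show "\<Union>\<K> \<subseteq> cadlag_paths" using K by (auto simp: skorokhod_open_def)
    fix X x
    assume X: "(\<forall>n. X n \<in> cadlag_paths) \<and> x \<in> \<Union>\<K> \<and> skorokhod_conv X x"
    then obtain S where S: "S \<in> \<K>" "x \<in> S" by blast
    then have "\<forall>\<^sub>F n in sequentially. X n \<in> S"
      using K X unfolding skorokhod_open_def by blast
    then show "\<forall>\<^sub>F n in sequentially. X n \<in> \<Union>\<K>"
      by eventually_elim (use S in blast)
  qed
qed

lemma openin_skorokhod_topology: "openin skorokhod_topology U \<longleftrightarrow> skorokhod_open U"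
  by (simp add: skorokhod_topology_def istopology_skorokhod_open topology_inverse')

lemma topspace_skorokhod_topology: "topspace skorokhod_topology = cadlag_paths"
proof
  show "topspace skorokhod_topology \<subseteq> cadlag_paths"
    by (auto simp: topspace_def openin_skorokhod_topology skorokhod_open_def)
  have "skorokhod_open cadlag_paths"
    by (auto simp: skorokhod_open_def)
  then show "cadlag_paths \<subseteq> topspace skorokhod_topology"
    by (auto simp: topspace_def openin_skorokhod_topology)
qed

definition borel_of_topology :: "'b topology \<Rightarrow> 'b measure" where
  "borel_of_topology T = sigma (topspace T) {U. openin T U}"

definition converges_in_distribution ::
    "'b topology \<Rightarrow> (nat \<Rightarrow> 'a measure) \<Rightarrow> (nat \<Rightarrow> 'a \<Rightarrow> 'b) \<Rightarrow> 'c measure \<Rightarrow> ('c \<Rightarrow> 'b) \<Rightarrow> bool" where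
  "converges_in_distribution T M X N Y \<longleftrightarrow>
     (\<forall>n. X n \<in> M n \<rightarrow>\<^sub>M borel_of_topology T) \<and> Y \<in> N \<rightarrow>\<^sub>M borel_of_topology T \<and>
     (\<forall>F :: 'b \<Rightarrow> real. continuous_map T euclideanreal F \<and> bounded (F ` topspace T) \<longrightarrow>
        (\<lambda>n. \<integral>\<omega>. F (X n \<omega>) \<partial>M n) \<longlonglongrightarrow> (\<integral>\<omega>. F (Y \<omega>) \<partial>N))"

definition sample_path :: "(real \<Rightarrow> 'a \<Rightarrow> real) \<Rightarrow> 'a \<Rightarrow> real \<Rightarrow> real" where
  "sample_path X \<omega> = (\<lambda>t\<in>{0..}. X t \<omega>)"

text \<open>\<open>prob_space.indep_var\<close> forces both variables to have the same range type.\<close>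

definition indep_random_variables ::
    "'a measure \<Rightarrow> 'b measure \<Rightarrow> ('a \<Rightarrow> 'b) \<Rightarrow> 'c measure \<Rightarrow> ('a \<Rightarrow> 'c) \<Rightarrow> bool" where
  "indep_random_variables P S X T Y \<longleftrightarrow>
     X \<in> P \<rightarrow>\<^sub>M S \<and> Y \<in> P \<rightarrow>\<^sub>M T \<and>
     prob_space.indep_set P (sets (vimage_algebra (space P) X S)) (sets (vimage_algebra (space P) Y T))"

definition brownian_motion :: "'a measure \<Rightarrow> (real \<Rightarrow> 'a \<Rightarrow> real) \<Rightarrow> bool" where
  "brownian_motion P W \<longleftrightarrow>
     prob_space P \<and>
     (\<forall>t\<ge>0. W t \<in> borel_measurable P) \<and>
     (AE \<omega> in P. W 0 \<omega> = 0) \<and>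
     (AE \<omega> in P. continuous_on {0..} (\<lambda>t. W t \<omega>)) \<and>
     (\<forall>s t. 0 \<le> s \<and> s < t \<longrightarrow>
        distributed P lborel (\<lambda>\<omega>. W t \<omega> - W s \<omega>) (normal_density 0 (sqrt (t - s)))) \<and>
     (\<forall>\<tau> :: nat \<Rightarrow> real. 0 \<le> \<tau> 0 \<and> mono \<tau> \<longrightarrow>
        prob_space.indep_vars P (\<lambda>_. borel) (\<lambda>i \<omega>. W (\<tau> (Suc i)) \<omega> - W (\<tau> i) \<omega>) UNIV)"

text \<open>
  The equation \<open>dX\<^sub>t = - a X\<^sub>t dt + b dW\<^sub>t\<close> in integrated form; the stochastic integral of the constant
  \<open>b\<close> over \<open>[0, t]\<close> is \<open>b W\<^sub>t\<close>, as \<open>W\<^sub>0 = 0\<close>.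
\<close>

definition solves_linear_sde ::
    "'a measure \<Rightarrow> (real \<Rightarrow> 'a \<Rightarrow> real) \<Rightarrow> real \<Rightarrow> real \<Rightarrow> (real \<Rightarrow> 'a \<Rightarrow> real) \<Rightarrow> bool" where
  "solves_linear_sde P W a b X \<longleftrightarrow>
     (\<forall>t\<ge>0. X t \<in> borel_measurable P) \<and>
     (\<forall>\<omega>\<in>space P. continuous_on {0..} (\<lambda>t. X t \<omega>)) \<and>
     (AE \<omega> in P. \<forall>t\<ge>0. X t \<omega> = X 0 \<omega> + integral {0..t} (\<lambda>s. - a * X s \<omega>) + b * W t \<omega>)"

end

theory Submission
  imports Defs "HOL-Real_Asymp.Real_Asymp"
begin

text \<open>
  Let \<open>S\<close> be the sum of coordinates along the walk. The differences \<open>\<xi> i = S (i + 1) - (1 - 2 / K) S i\<close> are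
  bounded martingale differences with conditional variance \<open>4 - 4 (S i / K)\<^sup>2\<close>, so the rescaled path is the
  Euler scheme of the limit equation driven by the martingale \<open>w\<close> of the partial sums of \<open>\<xi> / c\<close>. The Volterra
  map \<open>x \<mapsto> x + 2 \<lambda> \<integral> x\<close> has an inverse that is Lipschitz for the uniform norm on bounded intervals; it sends
  the limit process to \<open>O 0 + 2 \<sigma> W\<close> and the rescaled path to \<open>Z 0 + w\<close> up to a vanishing error. It therefore
  suffices to show that \<open>Z 0 + w\<close> converges to \<open>O 0 + 2 \<sigma> W\<close>. The increments of \<open>w\<close> over a fixed grid are replaced
  by Gaussian ones, one after the other, by Lindeberg's method, and the oscillation between grid points is
  controlled by a fourth moment bound. As the limit is continuous, a Skorokhod continuous functional \<open>F\<close> is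
  continuous there for locally uniform convergence; the expectations of \<open>F\<close> converge because \<open>F\<close> and \<open>- F\<close> are
  suprema, at continuous paths, of functionals that are Lipschitz for locally uniform convergence.
\<close>

section \<open>Martingale differences of the hypercube walk\<close>

text \<open>Two features of the data shape the estimates. The conditional variance falls short of 4,
  and the initial laws are merely tight after scaling, so the second moment of S need not be of
  order c^2. On the rare event of a large start the trivial bound by K is used; since n / K
  converges while K tends to infinity, the shortfall vanishes in the limit. The grid has m^2 cells
  per unit of time up to time m, hence m^3 cells in all: with fourth moments the probability that
  the martingale oscillates in some cell is of order m^3 * m^-4, whereas second moments would only
  give m^3 * m^-2. Removing the drift by the Volterra map before any comparison leaves increments
  that can be replaced by Gaussian ones given everything earlier, starting from the last. The walks
  for different n live on unrelated probability spaces, so the comparison with the limit is made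
  between expectations of Lipschitz functionals, without a coupling and without tightness in path
  space.\<close>

lemma finite_hypercube: "finite (hypercube k)"
  unfolding hypercube_def by (intro finite_PiE) auto

lemma coord_sum_flip:
  assumes "j \<in> {1..k}"
  shows "coord_sum k (v(j := - v j)) = coord_sum k v - 2 * real_of_int (v j)"
proof -
  have "coord_sum k (v(j := - v j)) = (\<Sum>i\<in>{1..k} - {j}. real_of_int (v i)) - real_of_int (v j)"
    unfolding coord_sum_def by (subst sum.remove[OF _ assms]) (auto intro!: sum.cong)
  moreover have "coord_sum k v = (\<Sum>i\<in>{1..k} - {j}. real_of_int (v i)) + real_of_int (v j)"
    unfolding coord_sum_def by (subst sum.remove[OF _ assms]) auto
  ultimately show ?thesis by simp
qed

lemma hypercube_coord_sq:
  assumes "v \<in> hypercube k" "j \<in> {1..k}"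
  shows "(real_of_int (v j))\<^sup>2 = 1"
proof -
  have "v j \<in> {-1, 1}" using assms unfolding hypercube_def by (rule PiE_mem)
  then show ?thesis by auto
qed

lemma abs_coord_sum_le:
  assumes "v \<in> hypercube k"
  shows "\<bar>coord_sum k v\<bar> \<le> real k"
proof -
  have "\<bar>coord_sum k v\<bar> \<le> (\<Sum>i=1..k. \<bar>real_of_int (v i)\<bar>)"
    unfolding coord_sum_def by (rule sum_abs)
  also have "\<dots> \<le> (\<Sum>i=1..k. 1)"
    using hypercube_coord_sq[OF assms] by (intro sum_mono) (simp add: abs_square_le_1[symmetric])
  finally show ?thesis by simp
qed

locale hypercube_walk = prob_space M for M :: "'a measure" +
  fixes k :: nat and \<mu> :: "(nat \<Rightarrow> int) pmf" and Y :: "nat \<Rightarrow> 'a \<Rightarrow> nat \<Rightarrow> int"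
  assumes k_pos: "k \<ge> 1"
    and walk: "simple_random_walk (hypercube k) (hypercube_adj k) \<mu> M Y"
begin

abbreviation "V \<equiv> hypercube k"

definition S :: "nat \<Rightarrow> 'a \<Rightarrow> real" where
  "S i \<omega> = coord_sum k (Y i \<omega>)"

text \<open>Since \<open>E[S (Suc i) | Y 0, \<dots>, Y i] = (1 - 2 / k) * S i\<close>, these are martingale differences.\<close>

definition \<xi> :: "nat \<Rightarrow> 'a \<Rightarrow> real" where
  "\<xi> i \<omega> = S (Suc i) \<omega> - (1 - 2 / real k) * S i \<omega>"

text \<open>Measurability with respect to the past is encoded as being determined by
  \<open>Y 0\<close>, ..., \<open>Y i\<close>. The state space is finite, so such a function takes
  finitely many values, and real ones are measurable and integrable for free; no filtration or
  conditional expectation is introduced. The value type is arbitrary, so that vectors of earlier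
  increments are covered.\<close>

definition past :: "nat \<Rightarrow> ('a \<Rightarrow> 'b) \<Rightarrow> bool" where
  "past i h \<longleftrightarrow> (\<forall>\<omega>\<in>space M. \<forall>\<omega>'\<in>space M. (\<forall>j\<le>i. Y j \<omega> = Y j \<omega>') \<longrightarrow> h \<omega> = h \<omega>')"

definition cyl :: "nat \<Rightarrow> (nat \<Rightarrow> nat \<Rightarrow> int) \<Rightarrow> 'a set" where
  "cyl i p = {\<omega> \<in> space M. \<forall>j\<le>i. Y j \<omega> = p j}"

lemma Y_measurable: "Y i \<in> M \<rightarrow>\<^sub>M count_space V"
  using walk by (simp add: simple_random_walk_def)

lemma Y_in_V: "\<omega> \<in> space M \<Longrightarrow> Y i \<omega> \<in> V"
  using measurable_space[OF Y_measurable] by simp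

lemma Y_eq_event: "{\<omega> \<in> space M. Y i \<omega> = v} \<in> events"
proof (cases "v \<in> V")
  case True
  then have "Y i -` {v} \<inter> space M \<in> events"
    by (intro measurable_sets[OF Y_measurable]) auto
  also have "Y i -` {v} \<inter> space M = {\<omega> \<in> space M. Y i \<omega> = v}" by auto
  finally show ?thesis .
next
  case False
  then have "{\<omega> \<in> space M. Y i \<omega> = v} = {}" using Y_in_V by auto
  then show ?thesis by (simp only: sets.empty_sets)
qed

lemma cyl_event: "cyl i p \<in> events"
proof -
  have "cyl i p = (\<Inter>j\<in>{..i}. {\<omega> \<in> space M. Y j \<omega> = p j})" by (auto simp: cyl_def)
  also have "\<dots> \<in> events" by (intro sets.finite_INT) (auto simp: Y_eq_event)
  finally show ?thesis .
qed

section \<open>Functions of the past and the one-step formula\<close>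

lemma past_mono: "past i h \<Longrightarrow> i \<le> j \<Longrightarrow> past j h"
  unfolding past_def by (meson order_trans)

lemma past_const: "past i (\<lambda>_. a)"
  by (simp add: past_def)

lemma past_compose: "past i f \<Longrightarrow> past i (\<lambda>\<omega>. H (f \<omega>))"
  unfolding past_def by (intro ballI impI arg_cong[where f = H]) blast

lemma past_compose2: "past i f \<Longrightarrow> past i g \<Longrightarrow> past i (\<lambda>\<omega>. H (f \<omega>) (g \<omega>))"
  unfolding past_def by (intro ballI impI arg_cong2[where f = H]) blast+

lemma past_fun: "(\<And>j. past i (\<lambda>\<omega>. f \<omega> j)) \<Longrightarrow> past i f"
  unfolding past_def by (intro ballI impI ext) blast

lemma past_Y: "j \<le> i \<Longrightarrow> past i (Y j)"
  by (simp add: past_def)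

lemma past_S: "j \<le> i \<Longrightarrow> past i (S j)"
  unfolding S_def by (rule past_compose[where H = "coord_sum k"]) (rule past_Y)

lemma past_\<xi>: "j < i \<Longrightarrow> past i (\<xi> j)"
  unfolding \<xi>_def by (rule past_compose2[where H = "\<lambda>x y. x - (1 - 2 / real k) * y"]) (auto intro: past_S)

lemma past_sum: "(\<And>j. j \<in> A \<Longrightarrow> past i (f j)) \<Longrightarrow> past i (\<lambda>\<omega>. \<Sum>j\<in>A. f j \<omega> :: real)"
  unfolding past_def by (intro ballI impI sum.cong refl) blast

text \<open>There are finitely many trajectories up to time \<open>i\<close>, and the cylinders over
  them partition the space, so \<open>h\<close> is a simple function over this partition.\<close>

lemma past_expand:
  assumes h: "past i h"
  shows "\<exists>hp :: (nat \<Rightarrow> nat \<Rightarrow> int) \<Rightarrow> real. \<forall>\<omega>\<in>space M.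
    h \<omega> = (\<Sum>p\<in>{..i} \<rightarrow>\<^sub>E V. hp p * indicator (cyl i p) \<omega>)"
proof (intro exI ballI)
  \<comment> \<open>An empty cylinder receives an arbitrary value, which its zero indicator
    cancels.\<close>
  define hp where "hp p = h (SOME \<omega>. \<omega> \<in> cyl i p)" for p
  have hp: "h \<omega> = hp p" if "\<omega> \<in> cyl i p" for \<omega> p
  proof -
    have "(SOME \<omega>. \<omega> \<in> cyl i p) \<in> cyl i p" using that by (rule someI)
    then show ?thesis using that h unfolding past_def hp_def cyl_def by auto
  qed
  fix \<omega> assume w: "\<omega> \<in> space M"
  define q where "q = restrict (\<lambda>j. Y j \<omega>) {..i}"
  have q: "q \<in> {..i} \<rightarrow>\<^sub>E V" using Y_in_V[OF w] by (auto simp: q_def)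
  have other: "\<omega> \<notin> cyl i p" if "p \<in> {..i} \<rightarrow>\<^sub>E V" "p \<noteq> q" for p
  proof
    assume "\<omega> \<in> cyl i p"
    then have "p j = q j" if "j \<in> {..i}" for j using that by (auto simp: cyl_def q_def)
    then have "p = q" using that(1) q by (metis PiE_ext)
    then show False using that by simp
  qed
  have fin: "finite ({..i} \<rightarrow>\<^sub>E V)" by (intro finite_PiE finite_hypercube) auto
  have "(\<Sum>p\<in>{..i} \<rightarrow>\<^sub>E V. hp p * indicator (cyl i p) \<omega>) = (\<Sum>p\<in>{q}. hp p * indicator (cyl i p) \<omega>)"
    using q fin other by (intro sum.mono_neutral_right) auto
  also have "\<dots> = h \<omega>"
    using w hp[of \<omega> q] by (simp add: cyl_def q_def)
  finally show "h \<omega> = (\<Sum>p\<in>{..i} \<rightarrow>\<^sub>E V. hp p * indicator (cyl i p) \<omega>)" by simp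
qed

lemma past_measurable:
  assumes "past i (h :: 'a \<Rightarrow> real)"
  shows "h \<in> borel_measurable M"
proof -
  obtain hp where "\<forall>\<omega>\<in>space M. h \<omega> = (\<Sum>p\<in>{..i} \<rightarrow>\<^sub>E V. hp p * indicator (cyl i p) \<omega>)"
    using past_expand[OF assms] by blast
  moreover have "(\<lambda>\<omega>. \<Sum>p\<in>{..i} \<rightarrow>\<^sub>E V. hp p * indicator (cyl i p) \<omega>) \<in> borel_measurable M"
    by (intro borel_measurable_sum borel_measurable_times borel_measurable_indicator cyl_event borel_measurable_const)
  ultimately show ?thesis by (simp cong: measurable_cong)
qed

lemma past_integrable:
  assumes "past i (h :: 'a \<Rightarrow> real)"
  shows "integrable M h"
proof -
  obtain hp where "\<forall>\<omega>\<in>space M. h \<omega> = (\<Sum>p\<in>{..i} \<rightarrow>\<^sub>E V. hp p * indicator (cyl i p) \<omega>)"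
    using past_expand[OF assms] by blast
  moreover have "integrable M (\<lambda>\<omega>. \<Sum>p\<in>{..i} \<rightarrow>\<^sub>E V. hp p * indicator (cyl i p) \<omega>)"
    by (intro Bochner_Integration.integrable_sum integrable_mult_right integrable_real_indicator cyl_event)
      (simp add: less_top[symmetric])
  ultimately show ?thesis by (simp cong: Bochner_Integration.integrable_cong)
qed

text \<open>The Markov property in tested form, in place of conditioning on the past. The cylinder
  expansion of \<open>h\<close> reduces it to the transition probabilities of each trajectory, and a
  uniform neighbour is a uniformly chosen flip, so the one-step average of \<open>\<phi>\<close> is
  a mean over \<open>k\<close> flips.\<close>

lemma expectation_step:
  fixes h :: "'a \<Rightarrow> real" and \<phi> :: "(nat \<Rightarrow> int) \<Rightarrow> (nat \<Rightarrow> int) \<Rightarrow> real"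
  assumes h: "past i h"
  shows "expectation (\<lambda>\<omega>. h \<omega> * \<phi> (Y i \<omega>) (Y (Suc i) \<omega>)) =
    expectation (\<lambda>\<omega>. h \<omega> * ((\<Sum>j=1..k. \<phi> (Y i \<omega>) ((Y i \<omega>)(j := - Y i \<omega> j))) / real k))"
proof -
  define T where "T = ({..i} \<rightarrow>\<^sub>E V)"
  define N where "N v = pmf_of_set {u \<in> V. hypercube_adj k v u}" for v
  define avg where "avg v = (\<Sum>j=1..k. \<phi> v (v(j := - v j))) / real k" for v
  have avg: "(\<Sum>u\<in>V. \<phi> v u * pmf (N v) u) = avg v" if v: "v \<in> V" for v
  proof -
    have ne: "{u \<in> V. hypercube_adj k v u} \<noteq> {}"
      unfolding hypercube_neighbours[OF v] using k_pos by auto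
    have "(\<Sum>u\<in>V. \<phi> v u * pmf (N v) u) = measure_pmf.expectation (N v) (\<phi> v)"
      using finite_hypercube[of k] ne unfolding N_def
      by (subst integral_measure_pmf_real[where A = V]) (auto simp: set_pmf_of_set)
    also have "\<dots> = avg v"
      unfolding N_def hypercube_step[OF v k_pos] using k_pos
      by (simp add: integral_pmf_of_set avg_def)
    finally show ?thesis .
  qed
  have fin: "finite T" unfolding T_def by (intro finite_PiE finite_hypercube) auto
  obtain hp where "\<forall>\<omega>\<in>space M. h \<omega> = (\<Sum>p\<in>{..i} \<rightarrow>\<^sub>E V. hp p * indicator (cyl i p) \<omega>)"
    using past_expand[OF h] by blast
  note hp = this[rule_format, folded T_def]
  have Suc_ev: "{\<omega> \<in> cyl i p. Y (Suc i) \<omega> = u} \<in> events" for p u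
  proof -
    have "{\<omega> \<in> cyl i p. Y (Suc i) \<omega> = u} = cyl i p \<inter> {\<omega> \<in> space M. Y (Suc i) \<omega> = u}"
      by (auto simp: cyl_def)
    then show ?thesis using cyl_event Y_eq_event by auto
  qed
  have trans: "prob {\<omega> \<in> cyl i p. Y (Suc i) \<omega> = u} = prob (cyl i p) * pmf (N (p i)) u"
    if "p \<in> T" "u \<in> V" for p u
  proof -
    have "p \<in> {..i} \<rightarrow> V" using that by (auto simp: T_def)
    then have "measure M {\<omega> \<in> space M. (\<forall>j\<le>i. Y j \<omega> = p j) \<and> Y (Suc i) \<omega> = u} =
        measure M {\<omega> \<in> space M. \<forall>j\<le>i. Y j \<omega> = p j} * pmf (N (p i)) u"
      using walk that unfolding simple_random_walk_def N_def by blast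
    then show ?thesis by (simp add: cyl_def conj_assoc)
  qed
  have pw1: "h \<omega> * \<phi> (Y i \<omega>) (Y (Suc i) \<omega>) =
      (\<Sum>p\<in>T. \<Sum>u\<in>V. hp p * \<phi> (p i) u * indicator {\<omega> \<in> cyl i p. Y (Suc i) \<omega> = u} \<omega>)"
    if w: "\<omega> \<in> space M" for \<omega>
  proof -
    have "(\<Sum>u\<in>V. hp p * \<phi> (p i) u * indicator {\<omega> \<in> cyl i p. Y (Suc i) \<omega> = u} \<omega>) =
        hp p * indicator (cyl i p) \<omega> * \<phi> (Y i \<omega>) (Y (Suc i) \<omega>)" for p
    proof -
      have "(\<Sum>u\<in>V. hp p * \<phi> (p i) u * indicator {\<omega> \<in> cyl i p. Y (Suc i) \<omega> = u} \<omega>) =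
          (\<Sum>u\<in>V. if u = Y (Suc i) \<omega> then hp p * indicator (cyl i p) \<omega> * \<phi> (Y i \<omega>) u else 0)"
        by (intro sum.cong) (auto simp: indicator_def cyl_def)
      then show ?thesis using Y_in_V[OF w] finite_hypercube[of k] by (simp add: sum.delta)
    qed
    then show ?thesis by (simp add: hp[OF w] sum_distrib_right)
  qed
  have pw2: "h \<omega> * avg (Y i \<omega>) = (\<Sum>p\<in>T. hp p * avg (p i) * indicator (cyl i p) \<omega>)"
    if w: "\<omega> \<in> space M" for \<omega>
    unfolding hp[OF w] sum_distrib_right by (intro sum.cong) (auto simp: indicator_def cyl_def)
  have "expectation (\<lambda>\<omega>. h \<omega> * \<phi> (Y i \<omega>) (Y (Suc i) \<omega>)) =
      (\<Sum>p\<in>T. \<Sum>u\<in>V. hp p * \<phi> (p i) u * prob {\<omega> \<in> cyl i p. Y (Suc i) \<omega> = u})"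
    using Suc_ev by (simp add: pw1 less_top[symmetric] cong: Bochner_Integration.integral_cong)
  also have "\<dots> = (\<Sum>p\<in>T. hp p * prob (cyl i p) * (\<Sum>u\<in>V. \<phi> (p i) u * pmf (N (p i)) u))"
    unfolding sum_distrib_left by (intro sum.cong refl) (simp add: trans)
  also have "\<dots> = (\<Sum>p\<in>T. hp p * avg (p i) * prob (cyl i p))"
    by (intro sum.cong refl, subst avg) (auto simp: T_def)
  also have "\<dots> = expectation (\<lambda>\<omega>. h \<omega> * avg (Y i \<omega>))"
    using cyl_event by (simp add: pw2 less_top[symmetric] cong: Bochner_Integration.integral_cong)
  finally show ?thesis by (simp add: avg_def)
qed

section \<open>Moments of the martingale differences\<close>

lemma abs_S_le: "\<omega> \<in> space M \<Longrightarrow> \<bar>S i \<omega>\<bar> \<le> real k"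
  unfolding S_def by (intro abs_coord_sum_le Y_in_V)

text \<open>Flipping coordinate \<open>j\<close> changes the sum by \<open>- 2 * v j\<close>, and
  averaging over \<open>j\<close> gives the drift \<open>- 2 * S / k\<close>, which the definition
  of \<open>\<xi>\<close> compensates.\<close>

lemma expectation_\<xi>:
  assumes "past i h"
  shows "expectation (\<lambda>\<omega>. h \<omega> * \<xi> i \<omega>) = 0"
proof -
  have "expectation (\<lambda>\<omega>. h \<omega> * \<xi> i \<omega>) =
    expectation (\<lambda>\<omega>. h \<omega> * ((\<Sum>j=1..k. coord_sum k ((Y i \<omega>)(j := - Y i \<omega> j)) - (1 - 2 / real k) * coord_sum k (Y i \<omega>)) / real k))"
    unfolding \<xi>_def S_def
    by (rule expectation_step[OF assms, of "\<lambda>v w. coord_sum k w - (1 - 2 / real k) * coord_sum k v"])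
  also have "\<dots> = expectation (\<lambda>\<omega>. 0)"
  proof (intro Bochner_Integration.integral_cong refl)
    fix \<omega> assume w: "\<omega> \<in> space M"
    have "(\<Sum>j=1..k. coord_sum k ((Y i \<omega>)(j := - Y i \<omega> j)) - (1 - 2 / real k) * coord_sum k (Y i \<omega>)) =
      (\<Sum>j=1..k. 2 / real k * coord_sum k (Y i \<omega>) - 2 * real_of_int (Y i \<omega> j))"
      by (intro sum.cong refl) (simp add: coord_sum_flip algebra_simps)
    also have "\<dots> = 0"
      using k_pos by (simp add: sum_subtractf coord_sum_def sum_distrib_left[symmetric])
    finally show "h \<omega> * ((\<Sum>j=1..k. coord_sum k ((Y i \<omega>)(j := - Y i \<omega> j)) - (1 - 2 / real k) * coord_sum k (Y i \<omega>)) / real k) = 0"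
      by simp
  qed
  finally show ?thesis by simp
qed

text \<open>On a flip of coordinate \<open>j\<close> the difference equals
  \<open>2 * s / k - 2 * v j\<close>. The coordinates have square 1 and sum \<open>s\<close>, so its
  mean square is \<open>4 - 4 * s\<^sup>2 / k\<^sup>2\<close>.\<close>

lemma expectation_\<xi>_sq:
  assumes "past i h"
  shows "expectation (\<lambda>\<omega>. h \<omega> * (\<xi> i \<omega>)\<^sup>2) = expectation (\<lambda>\<omega>. h \<omega> * (4 - 4 * (S i \<omega>)\<^sup>2 / (real k)\<^sup>2))"
proof -
  have "expectation (\<lambda>\<omega>. h \<omega> * (\<xi> i \<omega>)\<^sup>2) =
    expectation (\<lambda>\<omega>. h \<omega> * ((\<Sum>j=1..k. (coord_sum k ((Y i \<omega>)(j := - Y i \<omega> j)) - (1 - 2 / real k) * coord_sum k (Y i \<omega>))\<^sup>2) / real k))"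
    unfolding \<xi>_def S_def
    by (rule expectation_step[OF assms, of "\<lambda>v w. (coord_sum k w - (1 - 2 / real k) * coord_sum k v)\<^sup>2"])
  also have "\<dots> = expectation (\<lambda>\<omega>. h \<omega> * (4 - 4 * (S i \<omega>)\<^sup>2 / (real k)\<^sup>2))"
  proof (intro Bochner_Integration.integral_cong refl)
    fix \<omega> assume w: "\<omega> \<in> space M"
    define s where "s = coord_sum k (Y i \<omega>)"
    have "(\<Sum>j=1..k. (coord_sum k ((Y i \<omega>)(j := - Y i \<omega> j)) - (1 - 2 / real k) * s)\<^sup>2) =
      (\<Sum>j=1..k. 4 * s\<^sup>2 / (real k)\<^sup>2 + 4 - (8 * s / real k) * real_of_int (Y i \<omega> j))"
    proof (intro sum.cong refl)
      fix j assume j: "j \<in> {1..k}"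
      have "(coord_sum k ((Y i \<omega>)(j := - Y i \<omega> j)) - (1 - 2 / real k) * s) = 2 * s / real k - 2 * real_of_int (Y i \<omega> j)"
        using j by (simp add: coord_sum_flip s_def algebra_simps)
      then have "(coord_sum k ((Y i \<omega>)(j := - Y i \<omega> j)) - (1 - 2 / real k) * s)\<^sup>2 =
         4 * s\<^sup>2 / (real k)\<^sup>2 + 4 * (real_of_int (Y i \<omega> j))\<^sup>2 - (8 * s / real k) * real_of_int (Y i \<omega> j)"
        by (simp only:) (simp add: power2_eq_square algebra_simps)
      then show "(coord_sum k ((Y i \<omega>)(j := - Y i \<omega> j)) - (1 - 2 / real k) * s)\<^sup>2 =
         4 * s\<^sup>2 / (real k)\<^sup>2 + 4 - (8 * s / real k) * real_of_int (Y i \<omega> j)"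
        using hypercube_coord_sq[OF Y_in_V[OF w] j] by simp
    qed
    also have "\<dots> = real k * (4 * s\<^sup>2 / (real k)\<^sup>2 + 4) - 8 * s / real k * s"
      by (simp only: sum_subtractf sum_constant sum_distrib_left[symmetric] s_def coord_sum_def) simp
    also have "\<dots> = real k * (4 - 4 * s\<^sup>2 / (real k)\<^sup>2)"
      using k_pos by (simp add: field_simps power2_eq_square)
    finally show "h \<omega> * ((\<Sum>j=1..k. (coord_sum k ((Y i \<omega>)(j := - Y i \<omega> j)) - (1 - 2 / real k) * coord_sum k (Y i \<omega>))\<^sup>2) / real k)
        = h \<omega> * (4 - 4 * (S i \<omega>)\<^sup>2 / (real k)\<^sup>2)"
      using k_pos by (simp add: s_def S_def)
  qed
  finally show ?thesis .
qed

text \<open>Only almost sure: the walk is specified through probabilities, so jumps to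
  non-neighbours may occur on a null set. The one-step formula is applied to the indicator of a
  violation; on a flip, \<open>2 * s / k\<close> and \<open>2 * v j\<close> contribute at most 2
  each.\<close>

lemma AE_abs_\<xi>_le: "AE \<omega> in M. \<bar>\<xi> i \<omega>\<bar> \<le> 4"
proof -
  let ?\<phi> = "\<lambda>v w. if \<bar>coord_sum k w - (1 - 2 / real k) * coord_sum k v\<bar> \<le> 4 then 0 else 1 :: real"
  have p: "past (Suc i) (\<lambda>\<omega>. ?\<phi> (Y i \<omega>) (Y (Suc i) \<omega>))"
    by (rule past_compose2[where H = ?\<phi>]) (auto intro: past_Y)
  have "expectation (\<lambda>\<omega>. 1 * ?\<phi> (Y i \<omega>) (Y (Suc i) \<omega>)) =
      expectation (\<lambda>\<omega>. 1 * ((\<Sum>j=1..k. ?\<phi> (Y i \<omega>) ((Y i \<omega>)(j := - Y i \<omega> j))) / real k))"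
    by (rule expectation_step[OF past_const])
  also have "\<dots> = expectation (\<lambda>\<omega>. 0)"
  proof (intro Bochner_Integration.integral_cong refl)
    fix \<omega> assume w: "\<omega> \<in> space M"
    have "?\<phi> (Y i \<omega>) ((Y i \<omega>)(j := - Y i \<omega> j)) = 0" if j: "j \<in> {1..k}" for j
    proof -
      have "\<bar>real_of_int (Y i \<omega> j)\<bar> \<le> 1"
        using hypercube_coord_sq[OF Y_in_V[OF w] j] by (simp add: abs_square_le_1[symmetric])
      moreover have "\<bar>2 * coord_sum k (Y i \<omega>) / real k\<bar> \<le> 2"
        using abs_coord_sum_le[OF Y_in_V[OF w, of i]] k_pos by (simp add: abs_mult field_simps)
      ultimately have "\<bar>2 * coord_sum k (Y i \<omega>) / real k - 2 * real_of_int (Y i \<omega> j)\<bar> \<le> 4" by linarith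
      then show ?thesis using j by (simp add: coord_sum_flip algebra_simps)
    qed
    then show "1 * ((\<Sum>j=1..k. ?\<phi> (Y i \<omega>) ((Y i \<omega>)(j := - Y i \<omega> j))) / real k) = 0" by simp
  qed
  finally have "expectation (\<lambda>\<omega>. ?\<phi> (Y i \<omega>) (Y (Suc i) \<omega>)) = 0" by simp
  then have "AE \<omega> in M. ?\<phi> (Y i \<omega>) (Y (Suc i) \<omega>) = 0"
    by (subst (asm) integral_nonneg_eq_0_iff_AE) (use past_integrable[OF p] in auto)
  then show ?thesis by eventually_elim (auto simp: \<xi>_def S_def split: if_splits)
qed

text \<open>In \<open>S (Suc i) = a * S i + \<xi> i\<close> with \<open>a = 1 - 2 / k\<close> the
  cross term has mean zero, \<open>\<bar>a\<bar> \<le> 1\<close>, and the new variance is at most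
  4.\<close>

lemma expectation_S_sq_le: "expectation (\<lambda>\<omega>. (S i \<omega>)\<^sup>2) \<le> expectation (\<lambda>\<omega>. (S 0 \<omega>)\<^sup>2) + 4 * real i"
proof (induction i)
  case 0 then show ?case by simp
next
  case (Suc i)
  define a where "a = 1 - 2 / real k"
  have "\<bar>a\<bar> \<le> 1" using k_pos by (auto simp: a_def field_simps abs_le_iff)
  then have a2: "a\<^sup>2 \<le> 1" by (simp add: abs_square_le_1)
  have S: "(S (Suc i) \<omega>)\<^sup>2 = a\<^sup>2 * (S i \<omega>)\<^sup>2 + ((2 * a * S i \<omega>) * \<xi> i \<omega> + 1 * (\<xi> i \<omega>)\<^sup>2)" for \<omega>
  proof -
    have "S (Suc i) \<omega> = a * S i \<omega> + \<xi> i \<omega>" by (simp add: \<xi>_def a_def)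
    then show ?thesis by (simp add: power2_eq_square algebra_simps)
  qed
  have int: "integrable M (\<lambda>\<omega>. H (S i \<omega>) (\<xi> i \<omega>))" for H :: "real \<Rightarrow> real \<Rightarrow> real"
    by (rule past_integrable[of "Suc i"]) (rule past_compose2[where H = H], auto intro: past_S past_\<xi>)
  have pS: "past i (\<lambda>\<omega>. f (S i \<omega>) :: real)" for f by (rule past_compose[where H = f]) (simp add: past_S)
  have "expectation (\<lambda>\<omega>. (S (Suc i) \<omega>)\<^sup>2) = expectation (\<lambda>\<omega>. a\<^sup>2 * (S i \<omega>)\<^sup>2) +
     (expectation (\<lambda>\<omega>. (2 * a * S i \<omega>) * \<xi> i \<omega>) + expectation (\<lambda>\<omega>. 1 * (\<xi> i \<omega>)\<^sup>2))"
    unfolding S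
    by (subst Bochner_Integration.integral_add, rule int[of "\<lambda>s x. a\<^sup>2 * s\<^sup>2"],
        rule int[of "\<lambda>s x. 2 * a * s * x + 1 * x\<^sup>2"],
        subst Bochner_Integration.integral_add, rule int[of "\<lambda>s x. 2 * a * s * x"],
        rule int[of "\<lambda>s x. 1 * x\<^sup>2"]) simp
  also have "expectation (\<lambda>\<omega>. (2 * a * S i \<omega>) * \<xi> i \<omega>) = 0"
    by (rule expectation_\<xi>[OF pS])
  also have "expectation (\<lambda>\<omega>. 1 * (\<xi> i \<omega>)\<^sup>2) = expectation (\<lambda>\<omega>. 1 * (4 - 4 * (S i \<omega>)\<^sup>2 / (real k)\<^sup>2))"
    by (rule expectation_\<xi>_sq[OF past_const])
  also have "\<dots> \<le> expectation (\<lambda>\<omega>. 4)"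
    by (intro integral_mono past_integrable[OF pS[of "\<lambda>s. 1 * (4 - 4 * s\<^sup>2 / (real k)\<^sup>2)"]]) auto
  also have "expectation (\<lambda>\<omega>. a\<^sup>2 * (S i \<omega>)\<^sup>2) \<le> expectation (\<lambda>\<omega>. (S i \<omega>)\<^sup>2)"
    using a2 by (intro integral_mono past_integrable[OF pS[of "\<lambda>s. a\<^sup>2 * s\<^sup>2"]] past_integrable[OF pS[of "\<lambda>s. s\<^sup>2"]])
      (auto intro: mult_left_le_one_le)
  finally show ?case using Suc prob_space by simp
qed

end

section \<open>Gaussian averages and smoothing\<close>

text \<open>The heat semigroup, parametrized by the standard deviation \<open>s\<close> instead of
  time: \<open>s = 0\<close> is the identity, and composition adds squares.\<close>

definition gauss_avg :: "real \<Rightarrow> (real \<Rightarrow> real) \<Rightarrow> real \<Rightarrow> real" where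
  "gauss_avg s \<phi> x = (\<integral>y. \<phi> (x + s * y) \<partial>std_normal_distribution)"

definition bounded_lipschitz :: "real \<Rightarrow> real \<Rightarrow> (real \<Rightarrow> real) \<Rightarrow> bool" where
  "bounded_lipschitz B L \<phi> \<longleftrightarrow> (\<forall>x. \<bar>\<phi> x\<bar> \<le> B) \<and> (\<forall>x y. \<bar>\<phi> x - \<phi> y\<bar> \<le> L * \<bar>x - y\<bar>)"

text \<open>A second-order Taylor expansion with remainder uniform in \<open>x\<close>;
  \<open>b\<close> stands for half the second derivative. In this form it passes through a Gaussian
  average by integrating the inequality, with no differentiation under the integral.\<close>

definition expands :: "real \<Rightarrow> (real \<Rightarrow> real) \<Rightarrow> bool" where
  "expands C \<phi> \<longleftrightarrow> (\<exists>a b. \<forall>x. \<bar>b x\<bar> \<le> C \<and> (\<forall>h. \<bar>\<phi> (x + h) - \<phi> x - a x * h - b x * h\<^sup>2\<bar> \<le> C * \<bar>h\<bar> ^ 3))"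

lemma bounded_lipschitz_continuous:
  assumes "bounded_lipschitz B L \<phi>"
  shows "continuous_on UNIV \<phi>"
proof -
  have "(\<phi> \<longlongrightarrow> \<phi> x) (at x)" for x
  proof (rule LIM_zero_cancel, rule tendsto_rabs_zero_cancel, rule tendsto_sandwich)
    show "\<forall>\<^sub>F y in at x. 0 \<le> \<bar>\<phi> y - \<phi> x\<bar>" by simp
    show "\<forall>\<^sub>F y in at x. \<bar>\<phi> y - \<phi> x\<bar> \<le> L * \<bar>y - x\<bar>"
      using assms by (simp add: bounded_lipschitz_def)
    show "((\<lambda>y. L * \<bar>y - x\<bar>) \<longlongrightarrow> 0) (at x)"
      by (auto intro!: tendsto_eq_intros)
  qed simp
  then show ?thesis by (simp add: continuous_on_eq_continuous_at isCont_def)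
qed

lemma bounded_lipschitz_measurable [measurable_dest]:
  "bounded_lipschitz B L \<phi> \<Longrightarrow> \<phi> \<in> borel_measurable borel"
  using bounded_lipschitz_continuous by (rule borel_measurable_continuous_onI)

lemma std_normal_prob: "prob_space std_normal_distribution"
  using real_dist_normal_dist by (rule real_distribution.axioms)

lemma integrable_std_normal_bounded:
  fixes f :: "real \<Rightarrow> real"
  assumes "f \<in> borel_measurable borel" "\<And>x. \<bar>f x\<bar> \<le> B"
  shows "integrable std_normal_distribution f"
  by (rule finite_measure.integrable_const_bound[where B = B])
    (use assms std_normal_prob in \<open>auto simp: prob_space_def\<close>)

lemma gauss_avg_integrable:
  assumes "bounded_lipschitz B L \<phi>"
  shows "integrable std_normal_distribution (\<lambda>y. \<phi> (x + s * y))"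
  using assms bounded_lipschitz_measurable[OF assms]
  by (intro integrable_std_normal_bounded[where B = B]) (auto simp: bounded_lipschitz_def)

lemma std_normal_abs_integrable: "integrable std_normal_distribution (\<lambda>y. \<bar>y\<bar> ^ k)"
  using integrable_abs[OF integrable_std_normal_distribution_moment[of k]] by (simp add: power_abs)

lemma abs_gauss_integral_le:
  fixes f g :: "real \<Rightarrow> real"
  assumes "integrable std_normal_distribution f" "integrable std_normal_distribution g"
    "\<And>y. \<bar>f y\<bar> \<le> g y"
  shows "\<bar>\<integral>y. f y \<partial>std_normal_distribution\<bar> \<le> (\<integral>y. g y \<partial>std_normal_distribution)"
proof -
  have "\<bar>\<integral>y. f y \<partial>std_normal_distribution\<bar> \<le> (\<integral>y. \<bar>f y\<bar> \<partial>std_normal_distribution)"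
    by (rule integral_abs_bound)
  also have "\<dots> \<le> (\<integral>y. g y \<partial>std_normal_distribution)"
    by (rule integral_mono) (use assms in auto)
  finally show ?thesis .
qed

lemma measure_std_normal_UNIV [simp]: "measure std_normal_distribution UNIV = 1"
proof -
  interpret prob_space std_normal_distribution by (rule std_normal_prob)
  show ?thesis using prob_space by simp
qed

lemma std_normal_integral_const: "(\<integral>y. c \<partial>std_normal_distribution) = (c :: real)"
proof -
  interpret prob_space std_normal_distribution by (rule std_normal_prob)
  show ?thesis using prob_space by simp
qed

lemma gauss_avg_bounded_lipschitz:
  assumes \<phi>: "bounded_lipschitz B L \<phi>"
  shows "bounded_lipschitz B L (gauss_avg s \<phi>)"
  unfolding bounded_lipschitz_def
proof (intro conjI allI)
  fix x
  have c: "integrable std_normal_distribution (\<lambda>_. c :: real)" for c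
    by (intro integrable_std_normal_bounded[where B = "\<bar>c\<bar>"]) auto
  show "\<bar>gauss_avg s \<phi> x\<bar> \<le> B"
    using abs_gauss_integral_le[OF gauss_avg_integrable[OF \<phi>] c, of x s B] \<phi>
    by (simp add: gauss_avg_def std_normal_integral_const bounded_lipschitz_def)
  fix y
  have "\<bar>\<integral>z. (\<phi> (x + s * z) - \<phi> (y + s * z)) \<partial>std_normal_distribution\<bar> \<le> (\<integral>z. L * \<bar>x - y\<bar> \<partial>std_normal_distribution)"
  proof (intro abs_gauss_integral_le c Bochner_Integration.integrable_diff gauss_avg_integrable[OF \<phi>])
    fix z show "\<bar>\<phi> (x + s * z) - \<phi> (y + s * z)\<bar> \<le> L * \<bar>x - y\<bar>"
      using \<phi> unfolding bounded_lipschitz_def by (metis add_diff_cancel_right)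
  qed
  then show "\<bar>gauss_avg s \<phi> x - gauss_avg s \<phi> y\<bar> \<le> L * \<bar>x - y\<bar>"
    using gauss_avg_integrable[OF \<phi>] by (simp add: gauss_avg_def std_normal_integral_const)
qed

lemma gauss_avg_0: "gauss_avg 0 \<phi> = \<phi>"
  by (simp add: gauss_avg_def std_normal_integral_const fun_eq_iff)

lemma gauss_avg_scale_diff:
  assumes \<phi>: "bounded_lipschitz B L \<phi>" and "L \<ge> 0"
  shows "\<bar>gauss_avg s \<phi> x - gauss_avg t \<phi> x\<bar> \<le> L * \<bar>s - t\<bar>"
proof -
  \<comment> \<open>The exponent is written \<open>2 * 0 + 1\<close> to match the formula for odd
    absolute moments; the first of them is \<open>sqrt (2 / pi)\<close>, at most 1.\<close>
  have "\<bar>\<integral>z. (\<phi> (x + s * z) - \<phi> (x + t * z)) \<partial>std_normal_distribution\<bar> \<le>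
    (\<integral>z. L * \<bar>s - t\<bar> * \<bar>z\<bar> ^ (2 * 0 + 1) \<partial>std_normal_distribution)"
  proof (intro abs_gauss_integral_le Bochner_Integration.integrable_diff gauss_avg_integrable[OF \<phi>] integrable_mult_right std_normal_abs_integrable)
    fix z
    have "\<bar>\<phi> (x + s * z) - \<phi> (x + t * z)\<bar> \<le> L * \<bar>(x + s * z) - (x + t * z)\<bar>"
      using \<phi> unfolding bounded_lipschitz_def by blast
    also have "\<bar>(x + s * z) - (x + t * z)\<bar> = \<bar>s - t\<bar> * \<bar>z\<bar>"
      by (simp add: abs_mult[symmetric] algebra_simps)
    finally show "\<bar>\<phi> (x + s * z) - \<phi> (x + t * z)\<bar> \<le> L * \<bar>s - t\<bar> * \<bar>z\<bar> ^ (2 * 0 + 1)" by (simp add: mult.assoc)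
  qed
  also have "\<dots> = L * \<bar>s - t\<bar> * sqrt (2 / pi)"
    by (subst integral_mult_right_zero, subst std_normal_distribution_odd_moments_abs) simp
  also have "\<dots> \<le> L * \<bar>s - t\<bar> * 1"
    using pi_ge_two assms by (intro mult_left_mono) (auto simp: field_simps)
  finally show ?thesis
    using gauss_avg_integrable[OF \<phi>] by (simp add: gauss_avg_def)
qed

lemma gauss_avg_conv_density:
  assumes \<phi>: "bounded_lipschitz B L \<phi>" and s: "s > 0"
  shows "gauss_avg s \<phi> x = (\<integral>z. \<phi> (x + z) \<partial>density lborel (normal_density 0 s))"
proof -
  interpret prob_space std_normal_distribution by (rule std_normal_prob)
  have [measurable]: "\<phi> \<in> borel_measurable borel" by (rule bounded_lipschitz_measurable[OF \<phi>])
  have "distributed std_normal_distribution lborel (\<lambda>x. x) (normal_density 0 1)"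
    unfolding distributed_def by (auto simp: distr_id2)
  from normal_density_affine[OF this, of s 0] s
  have "distributed std_normal_distribution lborel (\<lambda>x. s * x) (normal_density 0 s)" by simp
  then have d: "distr std_normal_distribution lborel (\<lambda>x. s * x) = density lborel (normal_density 0 s)"
    by (simp add: distributed_def)
  show ?thesis
    unfolding d[symmetric] by (subst integral_distr) (auto simp: gauss_avg_def)
qed

text \<open>Variances of independent centred normals add. A zero standard deviation is split off
  because the normal density requires a positive one.\<close>

lemma gauss_avg_semigroup:
  assumes \<phi>: "bounded_lipschitz B L \<phi>" and "s \<ge> 0" "t \<ge> 0"
  shows "gauss_avg s (gauss_avg t \<phi>) x = gauss_avg (sqrt (s\<^sup>2 + t\<^sup>2)) \<phi> x"
proof (cases "s = 0 \<or> t = 0")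
  case True
  then show ?thesis using assms(2,3) by (auto simp: gauss_avg_0)
next
  case False
  with assms have s: "s > 0" and t: "t > 0" by auto
  have [measurable]: "\<phi> \<in> borel_measurable borel" by (rule bounded_lipschitz_measurable[OF \<phi>])
  let ?N = "\<lambda>s. density lborel (normal_density 0 s)"
  interpret Ns: prob_space "?N s" using s by (rule prob_space_normal_density)
  interpret Nt: prob_space "?N t" using t by (rule prob_space_normal_density)
  interpret pair_prob_space "?N s" "?N t" ..
  have conv: "?N s \<star> ?N t = ?N (sqrt (s\<^sup>2 + t\<^sup>2))"
  proof -
    have "?N s \<star> ?N t = density lborel (\<lambda>x. \<integral>\<^sup>+y. ennreal (normal_density 0 s (x - y)) * ennreal (normal_density 0 t y) \<partial>lborel)"
      by (rule convolution_density) (use Ns.finite_measure_axioms Nt.finite_measure_axioms in auto)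
    also have "(\<lambda>x. \<integral>\<^sup>+y. ennreal (normal_density 0 s (x - y)) * ennreal (normal_density 0 t y) \<partial>lborel) = normal_density 0 (sqrt (s\<^sup>2 + t\<^sup>2))"
      using conv_normal_density_zero_mean[OF s t] by (simp add: ennreal_mult'[symmetric])
    finally show ?thesis .
  qed
  have "gauss_avg (sqrt (s\<^sup>2 + t\<^sup>2)) \<phi> x = (\<integral>z. \<phi> (x + z) \<partial>(?N s \<star> ?N t))"
    unfolding conv by (rule gauss_avg_conv_density[OF \<phi>]) (use s t in \<open>auto intro: add_pos_pos\<close>)
  also have "\<dots> = (\<integral>p. \<phi> (x + (fst p + snd p)) \<partial>(?N s \<Otimes>\<^sub>M ?N t))"
    unfolding convolution_def by (subst integral_distr) (auto simp: split_beta)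
  also have "\<dots> = (\<integral>y. (\<integral>z. \<phi> (x + (y + z)) \<partial>?N t) \<partial>?N s)"
  proof (subst integral_fst'[symmetric])
    show "integrable (?N s \<Otimes>\<^sub>M ?N t) (\<lambda>p. \<phi> (x + (fst p + snd p)))"
      by (rule integrable_const_bound[where B = B]) (use \<phi> in \<open>auto simp: bounded_lipschitz_def\<close>)
  qed simp
  also have "\<dots> = gauss_avg s (gauss_avg t \<phi>) x"
    unfolding gauss_avg_conv_density[OF gauss_avg_bounded_lipschitz[OF \<phi>] s] gauss_avg_conv_density[OF \<phi> t]
    by (simp add: add.assoc)
  finally show ?thesis by simp
qed

text \<open>The first two moments of the standard normal law are 0 and 1, so \<open>a\<close> drops
  out and \<open>b\<close> keeps the factor \<open>s\<^sup>2\<close>. The factor 2 bounds the third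
  absolute moment \<open>2 * sqrt (2 / pi)\<close>.\<close>

lemma gauss_avg_expansion:
  assumes \<phi>: "bounded_lipschitz B L \<phi>" and b: "\<And>h. \<bar>\<phi> (x + h) - \<phi> x - a * h - b * h\<^sup>2\<bar> \<le> C * \<bar>h\<bar> ^ 3"
    and s: "s \<ge> 0" and C: "C \<ge> 0"
  shows "\<bar>gauss_avg s \<phi> x - \<phi> x - b * s\<^sup>2\<bar> \<le> 2 * C * s ^ 3"
proof -
  let ?E = "\<lambda>f. (\<integral>y. f y \<partial>std_normal_distribution) :: real"
  note i = gauss_avg_integrable[OF \<phi>] integrable_std_normal_distribution_moment[of 1, simplified]
    integrable_std_normal_distribution_moment[of 2] integrable_std_normal_bounded[where f = "\<lambda>_. \<phi> x" and B = "\<bar>\<phi> x\<bar>"]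
  have m: "?E (\<lambda>y. y) = 0" "?E (\<lambda>y. y\<^sup>2) = 1"
    using integral_std_normal_distribution_moment_odd[of 1] std_normal_distribution_even_moments(1)[of 1]
    by (simp_all add: fact_numeral)
  have eq: "gauss_avg s \<phi> x - \<phi> x - b * s\<^sup>2 = ?E (\<lambda>y. \<phi> (x + s * y) - \<phi> x - a * s * y - b * s\<^sup>2 * y\<^sup>2)"
    using i by (simp add: gauss_avg_def m std_normal_integral_const)
  have "\<bar>gauss_avg s \<phi> x - \<phi> x - b * s\<^sup>2\<bar> \<le> ?E (\<lambda>y. C * s ^ 3 * \<bar>y\<bar> ^ (2 * 1 + 1))"
    unfolding eq
  proof (rule abs_gauss_integral_le)
    show "integrable std_normal_distribution (\<lambda>y. \<phi> (x + s * y) - \<phi> x - a * s * y - b * s\<^sup>2 * y\<^sup>2)"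
      using i by auto
    show "integrable std_normal_distribution (\<lambda>y. C * s ^ 3 * \<bar>y\<bar> ^ (2 * 1 + 1))"
      by (intro integrable_mult_right std_normal_abs_integrable)
    fix y show "\<bar>\<phi> (x + s * y) - \<phi> x - a * s * y - b * s\<^sup>2 * y\<^sup>2\<bar> \<le> C * s ^ 3 * \<bar>y\<bar> ^ (2 * 1 + 1)"
      using b[of "s * y"] s by (simp add: abs_mult power_mult_distrib mult.assoc)
  qed
  also have "\<dots> = C * s ^ 3 * (sqrt (2 / pi) * 2)"
    unfolding integral_mult_right_zero std_normal_distribution_odd_moments_abs by simp
  also have "\<dots> \<le> C * s ^ 3 * (1 * 2)"
  proof (intro mult_left_mono mult_right_mono)
    show "sqrt (2 / pi) \<le> 1" using pi_ge_two by (simp add: real_sqrt_le_1_iff)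
    show "0 \<le> C * s ^ 3" using s C by simp
  qed simp
  finally show ?thesis by simp
qed

section \<open>Smoothing of Lipschitz functions\<close>

lemma lipschitz_derivative:
  fixes f f' :: "real \<Rightarrow> real"
  assumes "\<And>x. (f has_real_derivative f' x) (at x)" "\<And>x. \<bar>f' x\<bar> \<le> L"
  shows "\<bar>f x - f y\<bar> \<le> L * \<bar>x - y\<bar>"
proof -
  have "norm (f y - f x) \<le> L * norm (y - x)"
    by (rule field_differentiable_bound[of UNIV f f']) (use assms in \<open>auto simp: has_field_derivative_at_within\<close>)
  then show ?thesis by (simp add: abs_minus_commute)
qed

lemma real_antiderivative:
  fixes f :: "real \<Rightarrow> real"
  assumes "continuous_on UNIV f"
  shows "\<exists>F. \<forall>x. (F has_real_derivative f x) (at x)"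
  using einterval_antiderivative[of "-\<infinity>" \<infinity> f] assms
  by (auto simp: continuous_on_eq_continuous_at has_real_derivative_iff_has_vector_derivative)

text \<open>Averaging \<open>\<phi>\<close> twice over a window of length \<open>\<epsilon>\<close> produces second differences of the second
  antiderivative, whose derivatives are second differences of \<open>\<phi>\<close>.\<close>

lemma smoothing:
  assumes \<phi>: "bounded_lipschitz B L \<phi>" and \<epsilon>: "\<epsilon> > 0"
  obtains \<psi> where "bounded_lipschitz B L \<psi>" "\<And>x. \<bar>\<psi> x - \<phi> x\<bar> \<le> 2 * L * \<epsilon>"
    "\<And>t. expands (L / \<epsilon> + 2 * L / \<epsilon>\<^sup>2) (gauss_avg t \<psi>)"
proof -
  obtain \<Phi>1 where \<Phi>1: "\<And>x. (\<Phi>1 has_real_derivative \<phi> x) (at x)"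
    using real_antiderivative[OF bounded_lipschitz_continuous[OF \<phi>]] by blast
  then have "continuous_on UNIV \<Phi>1"
    by (meson DERIV_isCont continuous_at_imp_continuous_on)
  then obtain \<Phi>2 where \<Phi>2: "\<And>x. (\<Phi>2 has_real_derivative \<Phi>1 x) (at x)"
    using real_antiderivative by blast
  have lip: "\<bar>\<phi> x - \<phi> y\<bar> \<le> L * \<bar>x - y\<bar>" and bd: "\<bar>\<phi> x\<bar> \<le> B" for x y
    using \<phi> by (auto simp: bounded_lipschitz_def)
  have L: "L \<ge> 0" using lip[of 1 0] by simp
  \<comment> \<open>\<open>\<Delta>\<close> commutes with differentiation, so the derivatives of
    \<open>\<Delta> \<Phi>2\<close> are \<open>\<Delta> \<Phi>1\<close> and
    \<open>\<Delta> \<phi>\<close>.\<close>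
  define \<Delta> where "\<Delta> f x = (f (x + 2 * \<epsilon>) - 2 * f (x + \<epsilon>) + f x) / \<epsilon>\<^sup>2" for f :: "real \<Rightarrow> real" and x
  have \<Delta>_deriv: "(\<Delta> f has_real_derivative \<Delta> f' x) (at x)"
    if "\<And>x. (f has_real_derivative f' x) (at x)" for f f' x
  proof -
    have sh: "((\<lambda>x. f (x + e)) has_real_derivative f' (x + e)) (at x)" for e
      using that[of "x + e"] by (simp add: DERIV_shift)
    show ?thesis
      unfolding \<Delta>_def using sh[of "2 * \<epsilon>"] sh[of \<epsilon>] that[of x]
      by (intro DERIV_cdivide DERIV_add DERIV_diff DERIV_cmult)
  qed
  define \<psi> where "\<psi> = \<Delta> \<Phi>2"
  define a where "a = \<Delta> \<Phi>1"
  define b where "b x = \<Delta> \<phi> x / 2" for x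
  have \<psi>': "(\<psi> has_real_derivative a x) (at x)" for x
    unfolding \<psi>_def a_def by (rule \<Delta>_deriv[OF \<Phi>2])
  have a': "(a has_real_derivative 2 * b x) (at x)" for x
    unfolding a_def b_def using \<Delta>_deriv[OF \<Phi>1] by simp
  \<comment> \<open>Two mean value steps turn the second difference of \<open>\<Phi>2\<close> into
    one value of \<open>\<phi>\<close> at distance at most \<open>2 * \<epsilon>\<close> from
    \<open>x\<close>; this yields both the bound \<open>B\<close> and the closeness to
    \<open>\<phi>\<close>.\<close>
  have mv: "\<exists>z\<in>{x..x + 2 * \<epsilon>}. \<psi> x = \<phi> z" for x
  proof -
    have sh: "((\<lambda>y. \<Phi>2 (y + \<epsilon>) - \<Phi>2 y) has_real_derivative \<Phi>1 (y + \<epsilon>) - \<Phi>1 y) (at y)" for y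
      using \<Phi>2[of "y + \<epsilon>"] \<Phi>2[of y] by (auto intro!: derivative_eq_intros simp: DERIV_shift)
    from MVT2[of x "x + \<epsilon>", OF _ sh] \<epsilon> obtain y where y: "x < y" "y < x + \<epsilon>"
      and e1: "\<Phi>2 (x + \<epsilon> + \<epsilon>) - \<Phi>2 (x + \<epsilon>) - (\<Phi>2 (x + \<epsilon>) - \<Phi>2 x) = \<epsilon> * (\<Phi>1 (y + \<epsilon>) - \<Phi>1 y)"
      by auto
    from MVT2[of y "y + \<epsilon>", OF _ \<Phi>1] \<epsilon> obtain z where z: "y < z" "z < y + \<epsilon>"
      and e2: "\<Phi>1 (y + \<epsilon>) - \<Phi>1 y = \<epsilon> * \<phi> z" by auto
    have "\<psi> x = \<phi> z"
      using e1 e2 \<epsilon> by (simp add: \<psi>_def \<Delta>_def power2_eq_square field_simps)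
    then show ?thesis using y z \<epsilon> by (intro bexI[of _ z]) auto
  qed
  have a_bd: "\<bar>a x\<bar> \<le> L" for x
  proof -
    have sh: "((\<lambda>y. \<Phi>1 (y + \<epsilon>) - \<Phi>1 y) has_real_derivative \<phi> (y + \<epsilon>) - \<phi> y) (at y)" for y
      using \<Phi>1[of "y + \<epsilon>"] \<Phi>1[of y] by (auto intro!: derivative_eq_intros simp: DERIV_shift)
    have "\<bar>(\<Phi>1 (x + \<epsilon> + \<epsilon>) - \<Phi>1 (x + \<epsilon>)) - (\<Phi>1 (x + \<epsilon>) - \<Phi>1 x)\<bar> \<le> (L * \<epsilon>) * \<bar>(x + \<epsilon>) - x\<bar>"
      by (rule lipschitz_derivative[OF sh]) (use lip[of "y + \<epsilon>" y for y] \<epsilon> in auto)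
    then show ?thesis using \<epsilon> by (simp add: a_def \<Delta>_def power2_eq_square field_simps)
  qed
  have b_bd: "\<bar>b x\<bar> \<le> L / \<epsilon>" for x
  proof -
    have "\<bar>\<phi> (x + 2 * \<epsilon>) - 2 * \<phi> (x + \<epsilon>) + \<phi> x\<bar> \<le> 2 * L * \<epsilon>"
      using lip[of "x + 2 * \<epsilon>" "x + \<epsilon>"] lip[of "x + \<epsilon>" x] \<epsilon> by simp
    then show ?thesis using \<epsilon> by (simp add: b_def \<Delta>_def power2_eq_square field_simps)
  qed
  have b_lip: "\<bar>b x - b y\<bar> \<le> 2 * L / \<epsilon>\<^sup>2 * \<bar>x - y\<bar>" for x y
  proof -
    let ?D = "(\<phi> (x + 2 * \<epsilon>) - 2 * \<phi> (x + \<epsilon>) + \<phi> x) - (\<phi> (y + 2 * \<epsilon>) - 2 * \<phi> (y + \<epsilon>) + \<phi> y)"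
    have D: "\<bar>?D\<bar> \<le> 4 * L * \<bar>x - y\<bar>"
      using lip[of "x + 2 * \<epsilon>" "y + 2 * \<epsilon>"] lip[of "x + \<epsilon>" "y + \<epsilon>"] lip[of x y] by simp
    have "b x - b y = ?D / (2 * \<epsilon>\<^sup>2)"
      by (simp add: b_def \<Delta>_def diff_divide_distrib)
    then have "\<bar>b x - b y\<bar> = \<bar>?D\<bar> / \<bar>2 * \<epsilon>\<^sup>2\<bar>" by (simp only: abs_divide)
    also have "\<dots> \<le> 4 * L * \<bar>x - y\<bar> / \<bar>2 * \<epsilon>\<^sup>2\<bar>" using D by (rule divide_right_mono) simp
    finally show ?thesis by simp
  qed
  have taylor: "\<bar>\<psi> (x + h) - \<psi> x - a x * h - b x * h\<^sup>2\<bar> \<le> 2 * L / \<epsilon>\<^sup>2 * \<bar>h\<bar> ^ 3" for x h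
  proof (cases "h = 0")
    case False
    define d where "d n = (if n = 0 then \<psi> else if n = 1 then a else (\<lambda>x. 2 * b x))" for n :: nat
    have "\<exists>t. (if x + h < x then x + h < t \<and> t < x else x < t \<and> t < x + h) \<and>
        \<psi> (x + h) = (\<Sum>m<2. (d m x / fact m) * (x + h - x)^m) + (d 2 t / fact 2) * (x + h - x)^2"
    proof (rule Taylor[of 2 d \<psi> "min x (x + h)" "max x (x + h)"])
      show "\<forall>m t. m < 2 \<and> min x (x + h) \<le> t \<and> t \<le> max x (x + h) \<longrightarrow> DERIV (d m) t :> d (Suc m) t"
      proof (intro allI impI)
        fix m :: nat and t assume "m < 2 \<and> min x (x + h) \<le> t \<and> t \<le> max x (x + h)"
        then have "m = 0 \<or> m = 1" by auto
        then show "DERIV (d m) t :> d (Suc m) t" using \<psi>' a' by (auto simp: d_def)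
      qed
    qed (use False in \<open>auto simp: d_def\<close>)
    then obtain t where t': "if x + h < x then x + h < t \<and> t < x else x < t \<and> t < x + h"
      and "\<psi> (x + h) = (\<Sum>m<2. (d m x / fact m) * (x + h - x)^m) + (d 2 t / fact 2) * (x + h - x)^2"
      by blast
    then have e: "\<psi> (x + h) = \<psi> x + a x * h + b t * h\<^sup>2"
      by (simp add: d_def lessThan_Suc numeral_2_eq_2)
    have t: "\<bar>t - x\<bar> \<le> \<bar>h\<bar>" using t' by (auto split: if_splits)
    have "\<psi> (x + h) - \<psi> x - a x * h - b x * h\<^sup>2 = (b t - b x) * h\<^sup>2"
      unfolding e by (simp add: algebra_simps)
    then have "\<bar>\<psi> (x + h) - \<psi> x - a x * h - b x * h\<^sup>2\<bar> = \<bar>b t - b x\<bar> * h\<^sup>2"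
      by (simp add: abs_mult)
    also have "\<dots> \<le> (2 * L / \<epsilon>\<^sup>2 * \<bar>h\<bar>) * h\<^sup>2"
      using t L by (intro mult_right_mono order_trans[OF b_lip] mult_left_mono) auto
    finally show ?thesis by (simp add: numeral_3_eq_3 power2_eq_square mult.assoc)
  qed simp
  have bl: "bounded_lipschitz B L \<psi>"
    unfolding bounded_lipschitz_def using lipschitz_derivative[OF \<psi>' a_bd] mv bd by metis
  have close: "\<bar>\<psi> x - \<phi> x\<bar> \<le> 2 * L * \<epsilon>" for x
  proof -
    obtain z where z: "z \<in> {x..x + 2 * \<epsilon>}" "\<psi> x = \<phi> z" using mv by blast
    have "\<bar>\<phi> z - \<phi> x\<bar> \<le> L * \<bar>z - x\<bar>" by (rule lip)
    also have "\<dots> \<le> L * (2 * \<epsilon>)" using z L by (intro mult_left_mono) auto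
    finally show ?thesis by (simp add: z(2))
  qed
  have ca: "a \<in> borel_measurable borel"
    by (rule borel_measurable_continuous_onI) (meson a' DERIV_isCont continuous_at_imp_continuous_on)
  have cb: "b \<in> borel_measurable borel"
  proof -
    have [measurable]: "\<phi> \<in> borel_measurable borel" by (rule bounded_lipschitz_measurable[OF \<phi>])
    show ?thesis unfolding b_def \<Delta>_def by measurable
  qed
  \<comment> \<open>The coefficients are the Gaussian averages of \<open>a\<close> and
    \<open>b\<close>. The constant adds the bound on \<open>b\<close> to the constant of the cubic
    remainder, so that one number serves both clauses.\<close>
  have "expands (L / \<epsilon> + 2 * L / \<epsilon>\<^sup>2) (gauss_avg t \<psi>)" for t
    unfolding expands_def
  proof (intro exI allI conjI)
    fix x
    have ib: "integrable std_normal_distribution (\<lambda>y. b (x + t * y))" for x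
      using b_bd cb by (intro integrable_std_normal_bounded[where B = "L / \<epsilon>"]) auto
    have ia: "integrable std_normal_distribution (\<lambda>y. a (x + t * y))" for x
      using a_bd ca by (intro integrable_std_normal_bounded[where B = "L"]) auto
    have ic: "integrable std_normal_distribution (\<lambda>_. c :: real)" for c
      by (intro integrable_std_normal_bounded[where B = "\<bar>c\<bar>"]) auto
    have "\<bar>gauss_avg t b x\<bar> \<le> L / \<epsilon>"
      using abs_gauss_integral_le[OF ib ic b_bd, of x] by (simp add: gauss_avg_def std_normal_integral_const)
    also have "\<dots> \<le> L / \<epsilon> + 2 * L / \<epsilon>\<^sup>2" using L by simp
    finally show "\<bar>gauss_avg t b x\<bar> \<le> L / \<epsilon> + 2 * L / \<epsilon>\<^sup>2" .
    fix h
    have eq: "gauss_avg t \<psi> (x + h) - gauss_avg t \<psi> x - gauss_avg t a x * h - gauss_avg t b x * h\<^sup>2 =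
       (\<integral>y. \<psi> ((x + t * y) + h) - \<psi> (x + t * y) - a (x + t * y) * h - b (x + t * y) * h\<^sup>2 \<partial>std_normal_distribution)"
      using gauss_avg_integrable[OF bl, of "x + h" t] gauss_avg_integrable[OF bl, of x t] ia ib
      by (simp add: gauss_avg_def algebra_simps)
    have "\<bar>gauss_avg t \<psi> (x + h) - gauss_avg t \<psi> x - gauss_avg t a x * h - gauss_avg t b x * h\<^sup>2\<bar>
       \<le> (\<integral>y. 2 * L / \<epsilon>\<^sup>2 * \<bar>h\<bar> ^ 3 \<partial>std_normal_distribution)"
      unfolding eq
      using gauss_avg_integrable[OF bl, of "x + h" t] gauss_avg_integrable[OF bl, of x t] ia ib
      by (intro abs_gauss_integral_le ic taylor) (simp add: algebra_simps)
    also have "\<dots> = 2 * L / \<epsilon>\<^sup>2 * \<bar>h\<bar> ^ 3" by (rule std_normal_integral_const)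
    also have "\<dots> \<le> (L / \<epsilon> + 2 * L / \<epsilon>\<^sup>2) * \<bar>h\<bar> ^ 3" using L \<epsilon> by (intro mult_right_mono) auto
    finally show "\<bar>gauss_avg t \<psi> (x + h) - gauss_avg t \<psi> x - gauss_avg t a x * h - gauss_avg t b x * h\<^sup>2\<bar>
       \<le> (L / \<epsilon> + 2 * L / \<epsilon>\<^sup>2) * \<bar>h\<bar> ^ 3" .
  qed
  with bl close show thesis by (rule that)
qed

section \<open>Maximal inequality and Lindeberg replacement\<close>

context hypercube_walk
begin

section \<open>Fourth moments and the maximal inequality\<close>

definition mart :: "real \<Rightarrow> nat \<Rightarrow> 'a \<Rightarrow> real" where
  "mart c i \<omega> = (\<Sum>j<i. \<xi> j \<omega>) / c"

lemma past_mart: "i \<le> j \<Longrightarrow> past j (mart c i)"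
  unfolding mart_def by (rule past_compose[where H = "\<lambda>x. x / c"]) (intro past_sum past_\<xi>, simp)

lemma mart_Suc: "mart c (Suc i) \<omega> = mart c i \<omega> + \<xi> i \<omega> / c"
  by (simp add: mart_def add_divide_distrib)

text \<open>The increment is almost surely bounded by \<open>u\<close>, and terms linear in it have
  mean zero. The multiplier \<open>\<theta>\<close> is known at time \<open>i\<close>; it later
  serves as the switch that stops the martingale.\<close>

lemma moment_step:
  fixes G \<theta> :: "'a \<Rightarrow> real"
  assumes G: "past i G" and \<theta>: "past i \<theta>" "\<And>\<omega>. \<bar>\<theta> \<omega>\<bar> \<le> 1" and c: "c > 0"
  defines "u \<equiv> 4 / c"
  shows "expectation (\<lambda>\<omega>. (G \<omega> + \<theta> \<omega> * \<xi> i \<omega> / c)\<^sup>2) \<le> expectation (\<lambda>\<omega>. (G \<omega>)\<^sup>2) + u\<^sup>2" (is ?th1)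
    and "expectation (\<lambda>\<omega>. (G \<omega> + \<theta> \<omega> * \<xi> i \<omega> / c) ^ 4) \<le>
      expectation (\<lambda>\<omega>. (G \<omega>) ^ 4) + 8 * u\<^sup>2 * expectation (\<lambda>\<omega>. (G \<omega>)\<^sup>2) + 3 * u ^ 4" (is ?th2)
proof -
  have u: "u > 0" using c by (simp add: u_def)
  define x where "x \<omega> = \<theta> \<omega> * \<xi> i \<omega> / c" for \<omega>
  have x: "AE \<omega> in M. (x \<omega>)\<^sup>2 \<le> u\<^sup>2"
    using AE_abs_\<xi>_le[of i]
  proof eventually_elim
    case (elim \<omega>)
    have "\<bar>\<theta> \<omega>\<bar> * \<bar>\<xi> i \<omega>\<bar> \<le> 1 * 4" using \<theta>(2)[of \<omega>] elim by (intro mult_mono) auto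
    then have "\<bar>x \<omega>\<bar> \<le> u" using c by (simp add: x_def u_def abs_mult divide_right_mono)
    then show ?case using u by (simp add: abs_le_square_iff[symmetric])
  qed
  have pG: "past i (\<lambda>\<omega>. H (G \<omega>) (\<theta> \<omega>) :: real)" for H
    by (rule past_compose2[OF G \<theta>(1), where H = H])
  have int: "integrable M (\<lambda>\<omega>. H (G \<omega>) (\<theta> \<omega>) (\<xi> i \<omega>))" for H :: "real \<Rightarrow> real \<Rightarrow> real \<Rightarrow> real"
  proof (rule past_integrable[of "Suc i"])
    have p: "past (Suc i) (\<lambda>\<omega>. (G \<omega>, \<theta> \<omega>))"
      by (rule past_mono[of i]) (use past_compose2[OF G \<theta>(1), where H = Pair] in auto)
    show "past (Suc i) (\<lambda>\<omega>. H (G \<omega>) (\<theta> \<omega>) (\<xi> i \<omega>))"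
      using past_compose2[OF p past_\<xi>[of i "Suc i"], where H = "\<lambda>p. H (fst p) (snd p)"] by simp
  qed
  have z1: "expectation (\<lambda>\<omega>. (2 * G \<omega> * \<theta> \<omega> / c) * \<xi> i \<omega>) = 0"
    by (rule expectation_\<xi>) (rule pG[of "\<lambda>g t. 2 * g * t / c"])
  have z2: "expectation (\<lambda>\<omega>. (4 * G \<omega> ^ 3 * \<theta> \<omega> / c) * \<xi> i \<omega>) = 0"
    by (rule expectation_\<xi>) (rule pG[of "\<lambda>g t. 4 * g ^ 3 * t / c"])
  have "expectation (\<lambda>\<omega>. (G \<omega> + \<theta> \<omega> * \<xi> i \<omega> / c)\<^sup>2) \<le>
      expectation (\<lambda>\<omega>. (G \<omega>)\<^sup>2 + (2 * G \<omega> * \<theta> \<omega> / c) * \<xi> i \<omega> + u\<^sup>2)"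
  proof (rule integral_mono_AE)
    show "AE \<omega> in M. (G \<omega> + \<theta> \<omega> * \<xi> i \<omega> / c)\<^sup>2 \<le> (G \<omega>)\<^sup>2 + (2 * G \<omega> * \<theta> \<omega> / c) * \<xi> i \<omega> + u\<^sup>2"
      using x
    proof eventually_elim
      case (elim \<omega>)
      have "(G \<omega> + x \<omega>)\<^sup>2 = (G \<omega>)\<^sup>2 + 2 * G \<omega> * x \<omega> + (x \<omega>)\<^sup>2" by (simp add: power2_sum)
      also have "\<dots> \<le> (G \<omega>)\<^sup>2 + 2 * G \<omega> * x \<omega> + u\<^sup>2" using elim by simp
      finally show ?case by (simp add: x_def)
    qed
  qed (rule int[of "\<lambda>g t e. (g + t * e / c)\<^sup>2"], rule int[of "\<lambda>g t e. g\<^sup>2 + 2 * g * t / c * e + u\<^sup>2"])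
  also have "\<dots> = expectation (\<lambda>\<omega>. (G \<omega>)\<^sup>2) + u\<^sup>2"
    using z1 int[of "\<lambda>g t e. g\<^sup>2"] int[of "\<lambda>g t e. 2 * g * t / c * e"] prob_space by simp
  finally show ?th1 .
  have "expectation (\<lambda>\<omega>. (G \<omega> + \<theta> \<omega> * \<xi> i \<omega> / c) ^ 4) \<le>
      expectation (\<lambda>\<omega>. (G \<omega>) ^ 4 + (4 * G \<omega> ^ 3 * \<theta> \<omega> / c) * \<xi> i \<omega> + 8 * u\<^sup>2 * (G \<omega>)\<^sup>2 + 3 * u ^ 4)"
  proof (rule integral_mono_AE)
    show "AE \<omega> in M. (G \<omega> + \<theta> \<omega> * \<xi> i \<omega> / c) ^ 4 \<le>
      (G \<omega>) ^ 4 + (4 * G \<omega> ^ 3 * \<theta> \<omega> / c) * \<xi> i \<omega> + 8 * u\<^sup>2 * (G \<omega>)\<^sup>2 + 3 * u ^ 4"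
      using x
    proof eventually_elim
      case (elim \<omega>)
      define g y where "g = G \<omega>" and "y = x \<omega>"
      have y: "y\<^sup>2 \<le> u\<^sup>2" using elim by (simp add: y_def)
      \<comment> \<open>The cubic term \<open>4 * g * y ^ 3\<close> of the fourth power is
        \<open>2 * (2 * g * y) * y\<^sup>2\<close>. Splitting it raises the coefficient of
        \<open>g\<^sup>2 * y\<^sup>2\<close> from 6 to 8 and that of \<open>y ^ 4\<close> from 1 to
        3.\<close>
      have "2 * g * y \<le> g\<^sup>2 + y\<^sup>2" using sum_squares_bound[of g y] by simp
      then have "2 * (2 * g * y) * y\<^sup>2 \<le> 2 * (g\<^sup>2 + y\<^sup>2) * y\<^sup>2" by (intro mult_right_mono mult_left_mono) auto
      then have "(g + y) ^ 4 \<le> g ^ 4 + 4 * g ^ 3 * y + 8 * g\<^sup>2 * y\<^sup>2 + 3 * (y\<^sup>2)\<^sup>2"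
        by (simp add: power2_eq_square numeral_eq_Suc algebra_simps)
      also have "8 * g\<^sup>2 * y\<^sup>2 \<le> 8 * g\<^sup>2 * u\<^sup>2" using y by (intro mult_left_mono) auto
      also have "(y\<^sup>2)\<^sup>2 \<le> (u\<^sup>2)\<^sup>2" using y by (rule power_mono) simp
      finally show ?case by (simp add: g_def y_def x_def algebra_simps)
    qed
  qed (rule int[of "\<lambda>g t e. (g + t * e / c) ^ 4"], rule int[of "\<lambda>g t e. g ^ 4 + 4 * g ^ 3 * t / c * e + 8 * u\<^sup>2 * g\<^sup>2 + 3 * u ^ 4"])
  also have "\<dots> = expectation (\<lambda>\<omega>. (G \<omega>) ^ 4) + 8 * u\<^sup>2 * expectation (\<lambda>\<omega>. (G \<omega>)\<^sup>2) + 3 * u ^ 4"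
    using z2 int[of "\<lambda>g t e. g\<^sup>2"] int[of "\<lambda>g t e. g ^ 4"] int[of "\<lambda>g t e. 4 * g ^ 3 * t / c * e"] prob_space by simp
  finally show ?th2 .
qed

text \<open>Freezing the increments once they exceed \<open>\<delta>\<close> turns the moment bound into a maximal inequality,
  because the frozen process remembers any earlier excursion.\<close>

fun stopped :: "real \<Rightarrow> real \<Rightarrow> nat \<Rightarrow> nat \<Rightarrow> 'a \<Rightarrow> real" where
  "stopped c \<delta> i 0 \<omega> = 0"
| "stopped c \<delta> i (Suc j) \<omega> = stopped c \<delta> i j \<omega> + (if \<bar>stopped c \<delta> i j \<omega>\<bar> \<ge> \<delta> then 0 else 1) * \<xi> (i + j) \<omega> / c"

lemma past_stopped: "past (i + j) (stopped c \<delta> i j)"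
proof (induction j)
  case 0 show ?case by (simp add: past_def)
next
  case (Suc j)
  have p: "past (i + Suc j) (stopped c \<delta> i j)" by (rule past_mono[OF Suc]) simp
  have eq: "stopped c \<delta> i (Suc j) = (\<lambda>\<omega>. (\<lambda>g e. g + (if \<bar>g\<bar> \<ge> \<delta> then 0 else 1) * e / c) (stopped c \<delta> i j \<omega>) (\<xi> (i + j) \<omega>))"
    by (rule ext) simp
  show ?case unfolding eq by (rule past_compose2[OF p past_\<xi>]) simp
qed

text \<open>The constant 4 closes the recursion for the fourth moment: a step adds
  \<open>8 * j + 3\<close> units of \<open>u ^ 4\<close>, and
  \<open>4 * (j + 1)\<^sup>2 - 4 * j\<^sup>2 = 8 * j + 4\<close>.\<close>

lemma stopped_moments:
  assumes "c > 0"
  shows "expectation (\<lambda>\<omega>. (stopped c \<delta> i j \<omega>)\<^sup>2) \<le> (4 / c)\<^sup>2 * real j \<and>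
    expectation (\<lambda>\<omega>. (stopped c \<delta> i j \<omega>) ^ 4) \<le> 4 * (4 / c) ^ 4 * (real j)\<^sup>2"
proof (induction j)
  case 0 show ?case by simp
next
  case (Suc j)
  define u where "u = 4 / c"
  have u_pos: "u > 0" using assms by (simp add: u_def)
  have p: "past (i + j) (\<lambda>\<omega>. if \<bar>stopped c \<delta> i j \<omega>\<bar> \<ge> \<delta> then 0 else 1 :: real)"
    by (rule past_compose[OF past_stopped])
  have st: "expectation (\<lambda>\<omega>. (stopped c \<delta> i (Suc j) \<omega>)\<^sup>2) \<le> expectation (\<lambda>\<omega>. (stopped c \<delta> i j \<omega>)\<^sup>2) + u\<^sup>2"
    "expectation (\<lambda>\<omega>. (stopped c \<delta> i (Suc j) \<omega>) ^ 4) \<le>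
      expectation (\<lambda>\<omega>. (stopped c \<delta> i j \<omega>) ^ 4) + 8 * u\<^sup>2 * expectation (\<lambda>\<omega>. (stopped c \<delta> i j \<omega>)\<^sup>2) + 3 * u ^ 4"
    using moment_step[OF past_stopped[of i j c \<delta>] p _ assms, folded u_def] by simp_all
  have m2: "expectation (\<lambda>\<omega>. (stopped c \<delta> i j \<omega>)\<^sup>2) \<le> u\<^sup>2 * real j"
    and m4: "expectation (\<lambda>\<omega>. (stopped c \<delta> i j \<omega>) ^ 4) \<le> 4 * u ^ 4 * (real j)\<^sup>2"
    using Suc by (simp_all add: u_def)
  have "expectation (\<lambda>\<omega>. (stopped c \<delta> i (Suc j) \<omega>)\<^sup>2) \<le> u\<^sup>2 * real j + u\<^sup>2"
    using st(1) m2 by linarith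
  also have "\<dots> = u\<^sup>2 * real (Suc j)" by (simp add: algebra_simps)
  finally have "expectation (\<lambda>\<omega>. (stopped c \<delta> i (Suc j) \<omega>)\<^sup>2) \<le> u\<^sup>2 * real (Suc j)" .
  moreover have "expectation (\<lambda>\<omega>. (stopped c \<delta> i (Suc j) \<omega>) ^ 4) \<le> 4 * u ^ 4 * (real (Suc j))\<^sup>2"
  proof -
    have "8 * u\<^sup>2 * expectation (\<lambda>\<omega>. (stopped c \<delta> i j \<omega>)\<^sup>2) \<le> 8 * u\<^sup>2 * (u\<^sup>2 * real j)"
      using m2 by (rule mult_left_mono) simp
    then have "expectation (\<lambda>\<omega>. (stopped c \<delta> i (Suc j) \<omega>) ^ 4) \<le> 4 * u ^ 4 * (real j)\<^sup>2 + 8 * u\<^sup>2 * (u\<^sup>2 * real j) + 3 * u ^ 4"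
      using st(2) m4 by linarith
    also have "\<dots> \<le> 4 * u ^ 4 * (real (Suc j))\<^sup>2"
      using u_pos by (simp add: power2_eq_square numeral_eq_Suc algebra_simps)
    finally show ?thesis .
  qed
  ultimately show ?case by (simp add: u_def)
qed

lemma stopped_eq:
  "(\<forall>l\<le>j. \<bar>mart c (i + l) \<omega> - mart c i \<omega>\<bar> < \<delta>) \<and> stopped c \<delta> i j \<omega> = mart c (i + j) \<omega> - mart c i \<omega>
    \<or> \<bar>stopped c \<delta> i j \<omega>\<bar> \<ge> \<delta>"
proof (induction j)
  case (Suc j)
  then show ?case
    by (auto simp: mart_Suc le_Suc_eq)
qed auto

lemma max_mart_bound:
  fixes i j :: nat
  assumes c: "c > 0" and \<delta>: "\<delta> > 0"
  defines "A \<equiv> {\<omega> \<in> space M. \<exists>l\<le>j. \<bar>mart c (i + l) \<omega> - mart c i \<omega>\<bar> \<ge> \<delta>}"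
  shows "A \<in> events" "prob A \<le> 1024 * (real j / c\<^sup>2)\<^sup>2 / \<delta> ^ 4"
proof -
  have [measurable]: "mart c l \<in> borel_measurable M" for l by (rule past_measurable[OF past_mart[OF order_refl]])
  show A: "A \<in> events" unfolding A_def by measurable
  have i: "integrable M (\<lambda>\<omega>. (stopped c \<delta> i j \<omega>) ^ 4)"
    by (rule past_integrable) (rule past_compose[OF past_stopped])
  have "\<delta> ^ 4 * prob A = expectation (\<lambda>\<omega>. \<delta> ^ 4 * indicator A \<omega>)"
    using A by simp
  also have "\<dots> \<le> expectation (\<lambda>\<omega>. (stopped c \<delta> i j \<omega>) ^ 4)"
  proof (rule integral_mono)
    fix \<omega> assume "\<omega> \<in> space M"
    show "\<delta> ^ 4 * indicator A \<omega> \<le> (stopped c \<delta> i j \<omega>) ^ 4"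
    proof (cases "\<omega> \<in> A")
      case True
      then have "\<bar>stopped c \<delta> i j \<omega>\<bar> \<ge> \<delta>" using stopped_eq[of j c i \<omega> \<delta>] by (auto simp: A_def)
      then have "\<delta> ^ 4 \<le> \<bar>stopped c \<delta> i j \<omega>\<bar> ^ 4" using \<delta> by (intro power_mono) auto
      then show ?thesis using True by (simp add: power_even_abs)
    qed simp
  qed (use A i in \<open>auto simp: less_top[symmetric]\<close>)
  also have "\<dots> \<le> 4 * (4 / c) ^ 4 * (real j)\<^sup>2" using stopped_moments[OF c] by blast
  also have "\<dots> = 1024 * (real j / c\<^sup>2)\<^sup>2" by (simp add: power_divide power_mult[symmetric])
  finally show "prob A \<le> 1024 * (real j / c\<^sup>2)\<^sup>2 / \<delta> ^ 4"
    using \<delta> by (subst pos_le_divide_eq) (simp_all add: mult.commute)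
qed

text \<open>One increment is exchanged for a Gaussian of standard deviation \<open>2 / c\<close>.
  The two Taylor expansions agree to second order except for the variance deficit
  \<open>4 * (S i)\<^sup>2 / k\<^sup>2\<close>, which gives the second error term; the first
  collects the cubic remainders, 80 = 64 + 16. \<open>X\<close> carries whatever else the test
  function reads from the past.\<close>

lemma lindeberg_step:
  fixes \<Psi> :: "'v \<Rightarrow> real \<Rightarrow> real"
  assumes X: "past i X" and x: "past i x" and c: "c > 0" and C: "C \<ge> 0"
    and bl: "\<And>v. bounded_lipschitz B L (\<Psi> v)" and ex: "\<And>v. expands C (\<Psi> v)"
  shows "\<bar>expectation (\<lambda>\<omega>. \<Psi> (X \<omega>) (x \<omega> + \<xi> i \<omega> / c)) - expectation (\<lambda>\<omega>. gauss_avg (2 / c) (\<Psi> (X \<omega>)) (x \<omega>))\<bar>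
    \<le> C * (80 / c ^ 3 + 4 * expectation (\<lambda>\<omega>. (S i \<omega>)\<^sup>2) / ((real k)\<^sup>2 * c\<^sup>2))"
proof -
  obtain a b where ab: "\<And>v y. \<bar>b v y\<bar> \<le> C"
    "\<And>v y h. \<bar>\<Psi> v (y + h) - \<Psi> v y - a v y * h - b v y * h\<^sup>2\<bar> \<le> C * \<bar>h\<bar> ^ 3"
    using ex unfolding expands_def by metis
  have pXx: "past i (\<lambda>\<omega>. H (X \<omega>) (x \<omega>) :: real)" for H
    by (rule past_compose2[OF X x, where H = H])
  have int: "integrable M (\<lambda>\<omega>. H (X \<omega>) (x \<omega>) (\<xi> i \<omega>) (S i \<omega>))" for H :: "'v \<Rightarrow> real \<Rightarrow> real \<Rightarrow> real \<Rightarrow> real"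
  proof (rule past_integrable[of "Suc i"])
    have p: "past (Suc i) (\<lambda>\<omega>. (X \<omega>, x \<omega>))" "past (Suc i) (\<lambda>\<omega>. (\<xi> i \<omega>, S i \<omega>))"
      by (rule past_mono[of i], use past_compose2[OF X x, where H = Pair] in auto)
        (rule past_compose2[where H = Pair], auto intro: past_\<xi> past_S)
    show "past (Suc i) (\<lambda>\<omega>. H (X \<omega>) (x \<omega>) (\<xi> i \<omega>) (S i \<omega>))"
      using past_compose2[OF p, where H = "\<lambda>p q. H (fst p) (snd p) (fst q) (snd q)"] by simp
  qed
  let ?a = "\<lambda>\<omega>. a (X \<omega>) (x \<omega>)" and ?b = "\<lambda>\<omega>. b (X \<omega>) (x \<omega>)"
  \<comment> \<open>The difference with its first and second order terms removed: the Gaussian side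
    contributes its variance 4, the walk side the actual square of \<open>\<xi> i\<close>.\<close>
  let ?r = "\<lambda>\<omega>. \<Psi> (X \<omega>) (x \<omega> + \<xi> i \<omega> / c) - gauss_avg (2 / c) (\<Psi> (X \<omega>)) (x \<omega>)
    - (?a \<omega> / c) * \<xi> i \<omega> - (?b \<omega> / c\<^sup>2) * (\<xi> i \<omega>)\<^sup>2 + (?b \<omega> / c\<^sup>2) * 4"
  have z1: "expectation (\<lambda>\<omega>. (?a \<omega> / c) * \<xi> i \<omega>) = 0"
    by (rule expectation_\<xi>) (rule pXx[of "\<lambda>v y. a v y / c"])
  have z2: "expectation (\<lambda>\<omega>. (?b \<omega> / c\<^sup>2) * (\<xi> i \<omega>)\<^sup>2) = expectation (\<lambda>\<omega>. (?b \<omega> / c\<^sup>2) * (4 - 4 * (S i \<omega>)\<^sup>2 / (real k)\<^sup>2))"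
    by (rule expectation_\<xi>_sq) (rule pXx[of "\<lambda>v y. b v y / c\<^sup>2"])
  note ii = int[of "\<lambda>v y e s. \<Psi> v (y + e / c)"] int[of "\<lambda>v y e s. gauss_avg (2 / c) (\<Psi> v) y"]
    int[of "\<lambda>v y e s. a v y / c * e"] int[of "\<lambda>v y e s. b v y / c\<^sup>2 * e\<^sup>2"] int[of "\<lambda>v y e s. b v y / c\<^sup>2 * 4"]
    int[of "\<lambda>v y e s. b v y / c\<^sup>2 * (4 - 4 * s\<^sup>2 / (real k)\<^sup>2)"] int[of "\<lambda>v y e s. b v y / c\<^sup>2 * (4 * s\<^sup>2 / (real k)\<^sup>2)"]
  have "expectation ?r = expectation (\<lambda>\<omega>. \<Psi> (X \<omega>) (x \<omega> + \<xi> i \<omega> / c)) - expectation (\<lambda>\<omega>. gauss_avg (2 / c) (\<Psi> (X \<omega>)) (x \<omega>))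
     - expectation (\<lambda>\<omega>. (?a \<omega> / c) * \<xi> i \<omega>) - expectation (\<lambda>\<omega>. (?b \<omega> / c\<^sup>2) * (\<xi> i \<omega>)\<^sup>2) + expectation (\<lambda>\<omega>. (?b \<omega> / c\<^sup>2) * 4)"
    using ii by simp
  \<comment> \<open>The conditional second moment enters here: the part with 4 cancels against the
    Gaussian term, and the deficit remains.\<close>
  also have "expectation (\<lambda>\<omega>. (?b \<omega> / c\<^sup>2) * (\<xi> i \<omega>)\<^sup>2) = expectation (\<lambda>\<omega>. (?b \<omega> / c\<^sup>2) * 4) - expectation (\<lambda>\<omega>. (?b \<omega> / c\<^sup>2) * (4 * (S i \<omega>)\<^sup>2 / (real k)\<^sup>2))"
    unfolding z2 using ii by (subst Bochner_Integration.integral_diff[symmetric]) (auto simp: algebra_simps)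
  finally have key: "expectation (\<lambda>\<omega>. \<Psi> (X \<omega>) (x \<omega> + \<xi> i \<omega> / c)) - expectation (\<lambda>\<omega>. gauss_avg (2 / c) (\<Psi> (X \<omega>)) (x \<omega>))
     = expectation ?r - expectation (\<lambda>\<omega>. (?b \<omega> / c\<^sup>2) * (4 * (S i \<omega>)\<^sup>2 / (real k)\<^sup>2))"
    using z1 by simp
  have "\<bar>expectation ?r\<bar> \<le> expectation (\<lambda>\<omega>. \<bar>?r \<omega>\<bar>)" by (rule integral_abs_bound)
  also have "\<dots> \<le> expectation (\<lambda>\<omega>. C * 80 / c ^ 3)"
  proof (rule integral_mono_AE)
    show "integrable M (\<lambda>\<omega>. \<bar>?r \<omega>\<bar>)" using ii by auto
    show "AE \<omega> in M. \<bar>?r \<omega>\<bar> \<le> C * 80 / c ^ 3"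
      using AE_abs_\<xi>_le[of i]
    proof eventually_elim
      case (elim \<omega>)
      let ?P = "\<Psi> (X \<omega>)"
      have "\<bar>?P (x \<omega> + \<xi> i \<omega> / c) - ?P (x \<omega>) - ?a \<omega> * (\<xi> i \<omega> / c) - ?b \<omega> * (\<xi> i \<omega> / c)\<^sup>2\<bar> \<le> C * \<bar>\<xi> i \<omega> / c\<bar> ^ 3"
        by (rule ab(2))
      also have "\<dots> \<le> C * (4 / c) ^ 3"
        using C c elim by (intro mult_left_mono power_mono) (auto simp: divide_right_mono)
      finally have 1: "\<bar>?P (x \<omega> + \<xi> i \<omega> / c) - ?P (x \<omega>) - ?a \<omega> * (\<xi> i \<omega> / c) - ?b \<omega> * (\<xi> i \<omega> / c)\<^sup>2\<bar> \<le> C * 64 / c ^ 3"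
        by (simp add: power_divide)
      have "\<bar>gauss_avg (2 / c) ?P (x \<omega>) - ?P (x \<omega>) - ?b \<omega> * (2 / c)\<^sup>2\<bar> \<le> 2 * C * (2 / c) ^ 3"
        by (rule gauss_avg_expansion[OF bl ab(2)]) (use c C in auto)
      then have 2: "\<bar>gauss_avg (2 / c) ?P (x \<omega>) - ?P (x \<omega>) - ?b \<omega> * (2 / c)\<^sup>2\<bar> \<le> C * 16 / c ^ 3"
        by (simp add: power_divide mult.commute)
      have "?r \<omega> = (?P (x \<omega> + \<xi> i \<omega> / c) - ?P (x \<omega>) - ?a \<omega> * (\<xi> i \<omega> / c) - ?b \<omega> * (\<xi> i \<omega> / c)\<^sup>2) -
          (gauss_avg (2 / c) ?P (x \<omega>) - ?P (x \<omega>) - ?b \<omega> * (2 / c)\<^sup>2)"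
        by (simp add: power_divide)
      then have "\<bar>?r \<omega>\<bar> \<le> C * 64 / c ^ 3 + C * 16 / c ^ 3" using 1 2 by linarith
      also have "\<dots> = C * 80 / c ^ 3" by (simp add: add_divide_distrib[symmetric])
      finally show ?case .
    qed
  qed auto
  also have "\<dots> = C * 80 / c ^ 3" using prob_space by simp
  finally have b1: "\<bar>expectation ?r\<bar> \<le> C * 80 / c ^ 3" .
  have "\<bar>expectation (\<lambda>\<omega>. (?b \<omega> / c\<^sup>2) * (4 * (S i \<omega>)\<^sup>2 / (real k)\<^sup>2))\<bar> \<le> expectation (\<lambda>\<omega>. \<bar>(?b \<omega> / c\<^sup>2) * (4 * (S i \<omega>)\<^sup>2 / (real k)\<^sup>2)\<bar>)"
    by (rule integral_abs_bound)
  also have "\<dots> \<le> expectation (\<lambda>\<omega>. (C / c\<^sup>2) * (4 * (S i \<omega>)\<^sup>2 / (real k)\<^sup>2))"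
  proof (rule integral_mono)
    show "integrable M (\<lambda>\<omega>. \<bar>(?b \<omega> / c\<^sup>2) * (4 * (S i \<omega>)\<^sup>2 / (real k)\<^sup>2)\<bar>)"
      by (rule int[of "\<lambda>v y e s. \<bar>b v y / c\<^sup>2 * (4 * s\<^sup>2 / (real k)\<^sup>2)\<bar>"])
    show "integrable M (\<lambda>\<omega>. (C / c\<^sup>2) * (4 * (S i \<omega>)\<^sup>2 / (real k)\<^sup>2))"
      by (rule int[of "\<lambda>v y e s. (C / c\<^sup>2) * (4 * s\<^sup>2 / (real k)\<^sup>2)"])
    fix \<omega>
    have "\<bar>?b \<omega>\<bar> / c\<^sup>2 * (4 * (S i \<omega>)\<^sup>2 / (real k)\<^sup>2) \<le> C / c\<^sup>2 * (4 * (S i \<omega>)\<^sup>2 / (real k)\<^sup>2)"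
      using ab(1) by (intro mult_right_mono divide_right_mono) auto
    then show "\<bar>(?b \<omega> / c\<^sup>2) * (4 * (S i \<omega>)\<^sup>2 / (real k)\<^sup>2)\<bar> \<le> (C / c\<^sup>2) * (4 * (S i \<omega>)\<^sup>2 / (real k)\<^sup>2)"
      by (simp add: abs_mult)
  qed
  also have "\<dots> = C * (4 * expectation (\<lambda>\<omega>. (S i \<omega>)\<^sup>2) / ((real k)\<^sup>2 * c\<^sup>2))"
    by simp
  finally have b2: "\<bar>expectation (\<lambda>\<omega>. (?b \<omega> / c\<^sup>2) * (4 * (S i \<omega>)\<^sup>2 / (real k)\<^sup>2))\<bar>
    \<le> C * (4 * expectation (\<lambda>\<omega>. (S i \<omega>)\<^sup>2) / ((real k)\<^sup>2 * c\<^sup>2))" .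
  have "C * (80 / c ^ 3 + 4 * expectation (\<lambda>\<omega>. (S i \<omega>)\<^sup>2) / ((real k)\<^sup>2 * c\<^sup>2)) =
    C * 80 / c ^ 3 + C * (4 * expectation (\<lambda>\<omega>. (S i \<omega>)\<^sup>2) / ((real k)\<^sup>2 * c\<^sup>2))"
    by (simp add: distrib_left)
  then show ?thesis unfolding key using b1 b2 by linarith
qed

text \<open>Lindeberg's telescoping. The hybrid \<open>U j\<close> uses the first \<open>j\<close>
  true increments and a single Gaussian for the other \<open>l - j\<close>, merged by the semigroup
  property; hence the expansions are assumed for all Gaussian averages of
  \<open>\<Psi> v\<close>.\<close>

lemma lindeberg_block:
  fixes \<Psi> :: "'v \<Rightarrow> real \<Rightarrow> real"
  assumes X: "past i X" and c: "c > 0" and C: "C \<ge> 0"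
    and bl: "\<And>v. bounded_lipschitz B L (\<Psi> v)" and ex: "\<And>v t. expands C (gauss_avg t (\<Psi> v))"
    and s: "\<And>j. j < i + l \<Longrightarrow> expectation (\<lambda>\<omega>. (S j \<omega>)\<^sup>2) \<le> s"
  shows "\<bar>expectation (\<lambda>\<omega>. \<Psi> (X \<omega>) (mart c (i + l) \<omega> - mart c i \<omega>)) -
      expectation (\<lambda>\<omega>. gauss_avg (2 / c * sqrt (real l)) (\<Psi> (X \<omega>)) 0)\<bar>
    \<le> real l * (C * (80 / c ^ 3 + 4 * s / ((real k)\<^sup>2 * c\<^sup>2)))"
proof -
  define e where "e = C * (80 / c ^ 3 + 4 * s / ((real k)\<^sup>2 * c\<^sup>2))"
  define U where "U j = expectation (\<lambda>\<omega>. gauss_avg (2 / c * sqrt (real (l - j))) (\<Psi> (X \<omega>)) (mart c (i + j) \<omega> - mart c i \<omega>))" for j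
  have step: "\<bar>U (Suc j) - U j\<bar> \<le> e" if j: "j < l" for j
  proof -
    define \<Psi>' where "\<Psi>' v = gauss_avg (2 / c * sqrt (real (l - Suc j))) (\<Psi> v)" for v
    have 1: "gauss_avg (2 / c) (\<Psi>' v) y = gauss_avg (2 / c * sqrt (real (l - j))) (\<Psi> v) y" for v y
    proof -
      have "sqrt ((2 / c)\<^sup>2 + (2 / c * sqrt (real (l - Suc j)))\<^sup>2) = sqrt ((2 / c)\<^sup>2 * real (l - j))"
      proof -
        have "real (l - j) = 1 + real (l - Suc j)" using j by simp
        then show ?thesis
          by (simp only: power_mult_distrib real_sqrt_pow2[OF of_nat_0_le_iff] distrib_left mult_1_right)
      qed
      also have "\<dots> = 2 / c * sqrt (real (l - j))" using c by (simp add: real_sqrt_mult)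
      finally show ?thesis
        unfolding \<Psi>'_def by (subst gauss_avg_semigroup[OF bl]) (use c in auto)
    qed
    have "\<bar>expectation (\<lambda>\<omega>. \<Psi>' (X \<omega>) ((mart c (i + j) \<omega> - mart c i \<omega>) + \<xi> (i + j) \<omega> / c)) -
        expectation (\<lambda>\<omega>. gauss_avg (2 / c) (\<Psi>' (X \<omega>)) (mart c (i + j) \<omega> - mart c i \<omega>))\<bar>
        \<le> C * (80 / c ^ 3 + 4 * expectation (\<lambda>\<omega>. (S (i + j) \<omega>)\<^sup>2) / ((real k)\<^sup>2 * c\<^sup>2))"
    proof (rule lindeberg_step)
      show "past (i + j) X" by (rule past_mono[OF X]) simp
      show "past (i + j) (\<lambda>\<omega>. mart c (i + j) \<omega> - mart c i \<omega>)"
        by (rule past_compose2[where H = "\<lambda>x y. x - y"]) (auto intro: past_mart)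
      show "bounded_lipschitz B L (\<Psi>' v)" for v unfolding \<Psi>'_def by (rule gauss_avg_bounded_lipschitz[OF bl])
      show "expands C (\<Psi>' v)" for v unfolding \<Psi>'_def by (rule ex)
    qed (use c C in auto)
    also have "\<dots> \<le> e"
      unfolding e_def using s[of "i + j"] j C c
      by (intro mult_left_mono add_left_mono divide_right_mono) auto
    finally have "\<bar>expectation (\<lambda>\<omega>. \<Psi>' (X \<omega>) ((mart c (i + j) \<omega> - mart c i \<omega>) + \<xi> (i + j) \<omega> / c)) - U j\<bar> \<le> e"
      by (simp only: U_def 1)
    moreover have "U (Suc j) = expectation (\<lambda>\<omega>. \<Psi>' (X \<omega>) ((mart c (i + j) \<omega> - mart c i \<omega>) + \<xi> (i + j) \<omega> / c))"
      by (simp add: U_def mart_Suc \<Psi>'_def algebra_simps)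
    ultimately show ?thesis by simp
  qed
  have "\<bar>U j - U 0\<bar> \<le> real j * e" if "j \<le> l" for j
    using that
  proof (induction j)
    case (Suc j)
    then have "\<bar>U j - U 0\<bar> \<le> real j * e" by simp
    with step[of j] Suc(2) show ?case by (simp add: algebra_simps)
  qed simp
  from this[of l] show ?thesis by (simp add: U_def e_def gauss_avg_0)
qed

text \<open>Smoothing at scale \<open>\<epsilon>\<close> supplies the expansions for a merely
  Lipschitz test function, at the price of \<open>2 * L * \<epsilon>\<close> on the walk side and
  the same on the Gaussian side.\<close>

lemma block_clt:
  fixes H :: "'v \<Rightarrow> real \<Rightarrow> real"
  assumes X: "past i X" and c: "c > 0" and \<epsilon>: "\<epsilon> > 0"
    and bl: "\<And>v. bounded_lipschitz B L (H v)"
    and s: "\<And>j. j < i + l \<Longrightarrow> expectation (\<lambda>\<omega>. (S j \<omega>)\<^sup>2) \<le> s"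
  shows "\<bar>expectation (\<lambda>\<omega>. H (X \<omega>) (mart c (i + l) \<omega> - mart c i \<omega>)) -
      expectation (\<lambda>\<omega>. gauss_avg (2 / c * sqrt (real l)) (H (X \<omega>)) 0)\<bar>
    \<le> 4 * L * \<epsilon> + real l * ((L / \<epsilon> + 2 * L / \<epsilon>\<^sup>2) * (80 / c ^ 3 + 4 * s / ((real k)\<^sup>2 * c\<^sup>2)))"
proof -
  have L: "L \<ge> 0"
  proof -
    have "\<bar>H v 1 - H v 0\<bar> \<le> L * \<bar>1 - 0\<bar>" for v using bl unfolding bounded_lipschitz_def by blast
    from this[of undefined] show ?thesis by simp
  qed
  have "\<exists>\<psi>. bounded_lipschitz B L \<psi> \<and> (\<forall>x. \<bar>\<psi> x - H v x\<bar> \<le> 2 * L * \<epsilon>) \<and> (\<forall>t. expands (L / \<epsilon> + 2 * L / \<epsilon>\<^sup>2) (gauss_avg t \<psi>))" for v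
    using smoothing[OF bl \<epsilon>] by metis
  then obtain \<Psi> where \<Psi>: "\<And>v. bounded_lipschitz B L (\<Psi> v)" "\<And>v x. \<bar>\<Psi> v x - H v x\<bar> \<le> 2 * L * \<epsilon>"
    "\<And>v t. expands (L / \<epsilon> + 2 * L / \<epsilon>\<^sup>2) (gauss_avg t (\<Psi> v))" by metis
  let ?d = "\<lambda>\<omega>. mart c (i + l) \<omega> - mart c i \<omega>" and ?t = "2 / c * sqrt (real l)"
  have p: "past (i + l) (\<lambda>\<omega>. (X \<omega>, ?d \<omega>))"
  proof (rule past_compose2[where H = Pair])
    show "past (i + l) X" by (rule past_mono[OF X]) simp
    show "past (i + l) ?d" by (rule past_compose2[where H = "\<lambda>x y. x - y"]) (auto intro: past_mart)
  qed
  have int: "integrable M (\<lambda>\<omega>. F (X \<omega>) (?d \<omega>))" for F :: "'v \<Rightarrow> real \<Rightarrow> real"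
    by (rule past_integrable) (use past_compose[OF p, where H = "\<lambda>p. F (fst p) (snd p)"] in simp)
  have diff: "\<bar>expectation (\<lambda>\<omega>. F (X \<omega>) (?d \<omega>)) - expectation (\<lambda>\<omega>. G (X \<omega>) (?d \<omega>))\<bar> \<le> r"
    if "\<And>v x. \<bar>F v x - G v x\<bar> \<le> r" for F G :: "'v \<Rightarrow> real \<Rightarrow> real" and r
  proof -
    have "\<bar>expectation (\<lambda>\<omega>. F (X \<omega>) (?d \<omega>)) - expectation (\<lambda>\<omega>. G (X \<omega>) (?d \<omega>))\<bar> =
        \<bar>expectation (\<lambda>\<omega>. F (X \<omega>) (?d \<omega>) - G (X \<omega>) (?d \<omega>))\<bar>" using int[of F] int[of G] by simp
    also have "\<dots> \<le> expectation (\<lambda>\<omega>. \<bar>F (X \<omega>) (?d \<omega>) - G (X \<omega>) (?d \<omega>)\<bar>)" by (rule integral_abs_bound)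
    also have "\<dots> \<le> expectation (\<lambda>\<omega>. r)"
      using int[of "\<lambda>v x. \<bar>F v x - G v x\<bar>"] that by (intro integral_mono) auto
    finally show ?thesis using prob_space by simp
  qed
  have "\<bar>gauss_avg ?t (\<Psi> v) 0 - gauss_avg ?t (H v) 0\<bar> \<le> 2 * L * \<epsilon>" for v
  proof -
    have "\<bar>\<integral>y. \<Psi> v (0 + ?t * y) - H v (0 + ?t * y) \<partial>std_normal_distribution\<bar> \<le> (\<integral>y. 2 * L * \<epsilon> \<partial>std_normal_distribution)"
    proof (rule abs_gauss_integral_le)
      show "integrable std_normal_distribution (\<lambda>y. \<Psi> v (0 + ?t * y) - H v (0 + ?t * y))"
        by (intro Bochner_Integration.integrable_diff gauss_avg_integrable[OF \<Psi>(1)] gauss_avg_integrable[OF bl])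
      show "integrable std_normal_distribution (\<lambda>y. 2 * L * \<epsilon>)"
        by (rule integrable_std_normal_bounded[where B = "\<bar>2 * L * \<epsilon>\<bar>"]) auto
      show "\<bar>\<Psi> v (0 + ?t * y) - H v (0 + ?t * y)\<bar> \<le> 2 * L * \<epsilon>" for y by (rule \<Psi>(2))
    qed
    then show ?thesis
      using gauss_avg_integrable[OF \<Psi>(1), of v 0 ?t] gauss_avg_integrable[OF bl, of v 0 ?t]
      by (simp add: gauss_avg_def)
  qed
  then have d2: "\<bar>expectation (\<lambda>\<omega>. gauss_avg ?t (\<Psi> (X \<omega>)) 0) - expectation (\<lambda>\<omega>. gauss_avg ?t (H (X \<omega>)) 0)\<bar> \<le> 2 * L * \<epsilon>"
    by (rule diff[of "\<lambda>v x. gauss_avg ?t (\<Psi> v) 0" "\<lambda>v x. gauss_avg ?t (H v) 0"])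
  have d1: "\<bar>expectation (\<lambda>\<omega>. \<Psi> (X \<omega>) (?d \<omega>)) - expectation (\<lambda>\<omega>. H (X \<omega>) (?d \<omega>))\<bar> \<le> 2 * L * \<epsilon>"
    by (rule diff[OF \<Psi>(2)])
  have "\<bar>expectation (\<lambda>\<omega>. \<Psi> (X \<omega>) (?d \<omega>)) - expectation (\<lambda>\<omega>. gauss_avg ?t (\<Psi> (X \<omega>)) 0)\<bar>
    \<le> real l * ((L / \<epsilon> + 2 * L / \<epsilon>\<^sup>2) * (80 / c ^ 3 + 4 * s / ((real k)\<^sup>2 * c\<^sup>2)))"
    by (rule lindeberg_block[OF X c _ \<Psi>(1,3) s]) (use L \<epsilon> in auto)
  with d1 d2 show ?thesis by linarith
qed

end

section \<open>Skorokhod topology and measurability of paths\<close>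

text \<open>The identity serves as time change. Every convergence of paths fed into the topology
  below is of this kind.\<close>

lemma skorokhod_conv_locally_uniform:
  assumes "\<And>N. uniform_limit {0..N} X x sequentially"
  shows "skorokhod_conv X x"
proof -
  have "(\<lambda>t. t) \<in> time_changes"
    by (auto simp: time_changes_def strict_mono_on_def filterlim_ident)
  moreover have "uniform_limit {0..} (\<lambda>(n::nat) (t::real). t) (\<lambda>t. t) sequentially"
    by (simp add: uniform_limit_iff)
  ultimately show ?thesis
    unfolding skorokhod_conv_def using assms by (intro exI[of _ "\<lambda>n t. t"]) auto
qed

lemma continuous_map_skorokhod_tendsto:
  assumes F: "continuous_map skorokhod_topology euclideanreal F"
    and X: "\<And>n. X n \<in> cadlag_paths" and x: "x \<in> cadlag_paths"
    and conv: "\<And>N. uniform_limit {0..N} X x sequentially"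
  shows "(\<lambda>n. F (X n)) \<longlonglongrightarrow> F x"
proof (rule topological_tendstoI)
  fix S assume S: "open S" "F x \<in> S"
  have "openin skorokhod_topology {y \<in> topspace skorokhod_topology. F y \<in> S}"
    using F S by (intro openin_continuous_map_preimage) auto
  then have "skorokhod_open {y \<in> cadlag_paths. F y \<in> S}"
    by (simp add: openin_skorokhod_topology topspace_skorokhod_topology)
  then have "\<forall>\<^sub>F n in sequentially. X n \<in> {y \<in> cadlag_paths. F y \<in> S}"
    using X x S skorokhod_conv_locally_uniform[OF conv] unfolding skorokhod_open_def by blast
  then show "\<forall>\<^sub>F n in sequentially. F (X n) \<in> S" by eventually_elim simp
qed

lemma step_path_cadlag:
  fixes z :: "nat \<Rightarrow> real"
  shows "(\<lambda>t\<in>{0..}. z (nat \<lfloor>real n * t\<rfloor>)) \<in> cadlag_paths" (is "?x \<in> _")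
  unfolding cadlag_paths_def
proof (safe)
  show "?x \<in> extensional {0..}" by simp
next
  fix t :: real assume t: "0 \<le> t"
  have "\<forall>\<^sub>F s in at_right t. ?x s = ?x t"
  proof (cases "n = 0")
    case False
    have "\<lfloor>real n * s\<rfloor> = \<lfloor>real n * t\<rfloor>" if "t < s" "s < (real_of_int \<lfloor>real n * t\<rfloor> + 1) / real n" for s
    proof (rule floor_unique)
      have "real n * t \<le> real n * s" using that by (intro mult_left_mono) auto
      then show "real_of_int \<lfloor>real n * t\<rfloor> \<le> real n * s" by linarith
      show "real n * s < real_of_int \<lfloor>real n * t\<rfloor> + 1" using that False by (simp add: field_simps)
    qed
    moreover have "t < (real_of_int \<lfloor>real n * t\<rfloor> + 1) / real n"
    proof -
      have "real n * t < real_of_int \<lfloor>real n * t\<rfloor> + 1" by linarith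
      then show ?thesis using False by (simp add: field_simps)
    qed
    ultimately show ?thesis
      unfolding eventually_at_right_field using t
      by (intro exI[of _ "(real_of_int \<lfloor>real n * t\<rfloor> + 1) / real n"]) auto
  qed (use t in \<open>auto simp: eventually_at_right_field intro: gt_ex\<close>)
  then show "(?x \<longlongrightarrow> ?x t) (at_right t)" by (rule tendsto_eventually)
next
  fix t :: real assume t: "0 < t"
  show "\<exists>l. (?x \<longlongrightarrow> l) (at_left t)"
  proof
    \<comment> \<open>The index \<open>\<lceil>real n * t\<rceil> - 1\<close> is that of the cell of
      the times just before \<open>t\<close>, whether or not \<open>t\<close> is itself a jump
      time.\<close>
    show "(?x \<longlongrightarrow> z (nat (\<lceil>real n * t\<rceil> - 1))) (at_left t)"
    proof (rule tendsto_eventually, cases "n = 0")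
      case False
      define b where "b = max 0 ((real_of_int \<lceil>real n * t\<rceil> - 1) / real n)"
      have "\<lfloor>real n * s\<rfloor> = \<lceil>real n * t\<rceil> - 1" if "b < s" "s < t" for s
      proof (rule floor_unique)
        have "(real_of_int \<lceil>real n * t\<rceil> - 1) / real n < s" using that by (simp add: b_def)
        then show "real_of_int (\<lceil>real n * t\<rceil> - 1) \<le> real n * s" using False by (simp add: field_simps)
        have "real n * s < real n * t" using that False by simp
        then show "real n * s < real_of_int (\<lceil>real n * t\<rceil> - 1) + 1" by simp linarith
      qed
      moreover have "b < t"
      proof -
        have "real_of_int \<lceil>real n * t\<rceil> - 1 < real n * t" by linarith
        then show ?thesis using False t by (simp add: b_def field_simps)
      qed
      moreover have "b \<ge> 0" by (simp add: b_def)
      ultimately show "\<forall>\<^sub>F s in at_left t. ?x s = z (nat (\<lceil>real n * t\<rceil> - 1))"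
        unfolding eventually_at_left_field by (intro exI[of _ b]) auto
    qed (use t in \<open>auto simp: eventually_at_left_field intro!: exI[of _ 0]\<close>)
  qed
qed

lemma continuous_path_cadlag:
  assumes "continuous_on {0..} f"
  shows "(\<lambda>t\<in>{0..}. f t) \<in> cadlag_paths" (is "?x \<in> _")
  unfolding cadlag_paths_def
proof (safe)
  show "?x \<in> extensional {0..}" by simp
next
  have x: "(?x \<longlongrightarrow> f t) (at t within {0..})" if "t \<ge> 0" for t
  proof (rule Lim_transform_eventually)
    show "(f \<longlongrightarrow> f t) (at t within {0..})" using assms that by (simp add: continuous_on)
    show "\<forall>\<^sub>F s in at t within {0..}. f s = ?x s" by (simp add: eventually_at_filter)
  qed
  fix t :: real
  show "(?x \<longlongrightarrow> ?x t) (at_right t)" if t: "0 \<le> t"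
  proof -
    have "{t<..} \<subseteq> {0..}" using t by auto
    then show ?thesis using tendsto_within_subset[OF x[OF t]] t by simp
  qed
  show "\<exists>l. (?x \<longlongrightarrow> l) (at_left t)" if t: "0 < t"
  proof -
    have "at t within {0..} = at t" by (rule at_within_interior) (use t in simp)
    then have "(?x \<longlongrightarrow> f t) (at_left t)"
      using x[of t] t by (auto intro: tendsto_within_subset)
    then show ?thesis by blast
  qed
qed

section \<open>Borel measurability of path-valued maps\<close>

lemma measurable_borel_of_topologyI:
  assumes "\<And>\<omega>. \<omega> \<in> space M \<Longrightarrow> f \<omega> \<in> topspace T"
    and "\<And>U. openin T U \<Longrightarrow> {\<omega> \<in> space M. f \<omega> \<in> U} \<in> sets M"
  shows "f \<in> M \<rightarrow>\<^sub>M borel_of_topology T"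
  unfolding borel_of_topology_def
proof (rule measurable_measure_of)
  show "{U. openin T U} \<subseteq> Pow (topspace T)" using openin_subset by auto
  show "f \<in> space M \<rightarrow> topspace T" using assms by auto
  fix U assume "U \<in> {U. openin T U}"
  then have "{\<omega> \<in> space M. f \<omega> \<in> U} \<in> sets M" using assms by auto
  also have "{\<omega> \<in> space M. f \<omega> \<in> U} = f -` U \<inter> space M" by auto
  finally show "f -` U \<inter> space M \<in> sets M" .
qed

lemma skorokhod_openD:
  assumes U: "openin skorokhod_topology U" and x: "x \<in> U"
    and X: "\<And>n. X n \<in> cadlag_paths" "\<And>N. uniform_limit {0..N} X x sequentially"
  shows "\<exists>n. X n \<in> U"
proof -
  have "\<forall>\<^sub>F n in sequentially. X n \<in> U"
    using U x X skorokhod_conv_locally_uniform[of X x]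
    unfolding openin_skorokhod_topology skorokhod_open_def by blast
  then show ?thesis by (meson eventually_sequentially order_refl)
qed

text \<open>The preimage of an open set is a countable union of cylinders. If no cylinder around
  \<open>\<omega>\<close> stayed inside, trajectories agreeing with \<open>\<omega>\<close> up to
  time \<open>i\<close> would give paths outside the set that converge locally uniformly to the path
  of \<open>\<omega>\<close>, against openness.\<close>

lemma (in hypercube_walk) step_path_measurable:
  "sample_path (\<lambda>t \<omega>. g (Y (nat \<lfloor>real n * t\<rfloor>) \<omega>)) \<in> M \<rightarrow>\<^sub>M borel_of_topology skorokhod_topology" (is "?X \<in> _")
proof (rule measurable_borel_of_topologyI)
  have cad: "?X \<omega> \<in> cadlag_paths" for \<omega>
    unfolding sample_path_def by (rule step_path_cadlag[of "\<lambda>i. g (Y i \<omega>)"])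
  then show "?X \<omega> \<in> topspace skorokhod_topology" for \<omega> by (simp add: topspace_skorokhod_topology)
  fix U assume U: "openin skorokhod_topology U"
  define A where "A = {\<omega> \<in> space M. ?X \<omega> \<in> U}"
  define I where "I = {(i, p). p \<in> {..i} \<rightarrow>\<^sub>E V \<and> cyl i p \<subseteq> A}"
  have "A \<subseteq> (\<Union>(i, p)\<in>I. cyl i p)"
  proof
    fix \<omega> assume w: "\<omega> \<in> A"
    have "\<exists>i. \<forall>\<omega>'\<in>space M. (\<forall>j\<le>i. Y j \<omega>' = Y j \<omega>) \<longrightarrow> \<omega>' \<in> A"
    proof (rule ccontr)
      assume "\<not> ?thesis"
      then obtain f where f: "\<And>i. f i \<in> space M" "\<And>i j. j \<le> i \<Longrightarrow> Y j (f i) = Y j \<omega>" "\<And>i. f i \<notin> A"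
        by metis
      have "\<exists>i. ?X (f i) \<in> U"
      proof (rule skorokhod_openD[OF U _ cad])
        show "?X \<omega> \<in> U" using w by (simp add: A_def)
        fix N :: real
        have "\<forall>\<^sub>F i in sequentially. \<forall>t\<in>{0..N}. ?X (f i) t = ?X \<omega> t"
        proof (rule eventually_sequentiallyI)
          fix i assume i: "nat \<lfloor>real n * N\<rfloor> \<le> i"
          show "\<forall>t\<in>{0..N}. ?X (f i) t = ?X \<omega> t"
          proof
            fix t assume t: "t \<in> {0..N}"
            have "nat \<lfloor>real n * t\<rfloor> \<le> nat \<lfloor>real n * N\<rfloor>"
              using t by (intro nat_mono floor_mono mult_left_mono) auto
            then show "?X (f i) t = ?X \<omega> t" using f(2)[of "nat \<lfloor>real n * t\<rfloor>" i] i t by (simp add: sample_path_def)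
          qed
        qed
        then show "uniform_limit {0..N} (\<lambda>i. ?X (f i)) (?X \<omega>) sequentially"
          unfolding uniform_limit_iff by (auto elim: eventually_mono)
      qed
      then show False using f by (auto simp: A_def)
    qed
    then obtain i where i: "\<forall>\<omega>'\<in>space M. (\<forall>j\<le>i. Y j \<omega>' = Y j \<omega>) \<longrightarrow> \<omega>' \<in> A" by blast
    define p where "p = restrict (\<lambda>j. Y j \<omega>) {..i}"
    have "\<omega> \<in> space M" using w by (simp add: A_def)
    then have "(i, p) \<in> I" "\<omega> \<in> cyl i p" using i Y_in_V by (auto simp: I_def p_def cyl_def)
    then show "\<omega> \<in> (\<Union>(i, p)\<in>I. cyl i p)" by blast
  qed
  then have "A = (\<Union>(i, p)\<in>I. cyl i p)" by (auto simp: I_def)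
  moreover have "countable I"
  proof (rule countable_subset)
    show "I \<subseteq> (SIGMA i:(UNIV :: nat set). {..i} \<rightarrow>\<^sub>E V)" by (auto simp: I_def)
    show "countable (SIGMA i:(UNIV :: nat set). {..i} \<rightarrow>\<^sub>E V)"
      by (rule countable_SIGMA) (auto intro!: countable_finite finite_PiE finite_hypercube)
  qed
  ultimately have "A \<in> sets M" by (auto intro!: sets.countable_UN' cyl_event)
  then show "{\<omega> \<in> space M. ?X \<omega> \<in> U} \<in> sets M" by (simp add: A_def)
qed

lemma floor_grid:
  fixes t :: real
  assumes "k > 0"
  shows "real_of_int \<lfloor>real k * t\<rfloor> / real k \<le> t" "t - 1 / real k < real_of_int \<lfloor>real k * t\<rfloor> / real k"
proof -
  have "real_of_int \<lfloor>real k * t\<rfloor> \<le> real k * t" "real k * t - 1 < real_of_int \<lfloor>real k * t\<rfloor>" by linarith+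
  moreover have "t = real k * t / real k" "t - 1 / real k = (real k * t - 1) / real k"
    using assms by (simp_all add: diff_divide_distrib)
  ultimately show "real_of_int \<lfloor>real k * t\<rfloor> / real k \<le> t" "t - 1 / real k < real_of_int \<lfloor>real k * t\<rfloor> / real k"
    using assms by (metis divide_right_mono of_nat_0_le_iff, metis divide_strict_right_mono of_nat_0_less_iff)
qed

lemma floor_grid_tendsto: "(\<lambda>k. real_of_int \<lfloor>real k * t\<rfloor> / real k) \<longlonglongrightarrow> t"
proof (rule tendsto_sandwich)
  show "\<forall>\<^sub>F k in sequentially. t - 1 / real k \<le> real_of_int \<lfloor>real k * t\<rfloor> / real k"
    using eventually_gt_at_top[of 0] by eventually_elim (use floor_grid in \<open>auto intro: less_imp_le\<close>)
  show "\<forall>\<^sub>F k in sequentially. real_of_int \<lfloor>real k * t\<rfloor> / real k \<le> t"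
    using eventually_gt_at_top[of 0] by eventually_elim (use floor_grid in auto)
  show "(\<lambda>k. t - 1 / real k) \<longlonglongrightarrow> t"
    using tendsto_diff[OF tendsto_const lim_1_over_n, of t] by simp
qed simp

text \<open>As for step paths, an open preimage contains with each point a tube around its path, by
  the same contradiction. Countably many tubes suffice: by continuity the centres may be rational
  step functions, and membership may be tested at rational times.\<close>

lemma continuous_sample_path_measurable:
  assumes X[measurable]: "\<And>t. t \<ge> 0 \<Longrightarrow> X t \<in> borel_measurable P"
    and cont: "\<And>\<omega>. \<omega> \<in> space P \<Longrightarrow> continuous_on {0..} (\<lambda>t. X t \<omega>)"
  shows "sample_path X \<in> P \<rightarrow>\<^sub>M borel_of_topology skorokhod_topology"
proof (rule measurable_borel_of_topologyI)
  have cad: "sample_path X \<omega> \<in> cadlag_paths" if "\<omega> \<in> space P" for \<omega>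
    unfolding sample_path_def by (rule continuous_path_cadlag[OF cont[OF that]])
  then show "sample_path X \<omega> \<in> topspace skorokhod_topology" if "\<omega> \<in> space P" for \<omega>
    using that by (simp add: topspace_skorokhod_topology)
  fix U assume U: "openin skorokhod_topology U"
  define A where "A = {\<omega> \<in> space P. sample_path X \<omega> \<in> U}"
  \<comment> \<open>\<open>D (j, m, qs)\<close> is the tube of radius \<open>1 / (j + 1)\<close> on
    \<open>[0, j]\<close> around the step function of mesh \<open>1 / m\<close> with values
    \<open>qs\<close>.\<close>
  define D where "D = (\<lambda>(j :: nat, m :: nat, qs :: rat list). {\<omega> \<in> space P. \<forall>t\<in>\<rat> \<inter> {0..real j}.
      \<bar>X t \<omega> - real_of_rat (qs ! nat \<lfloor>real m * t\<rfloor>)\<bar> \<le> 1 / (real j + 1)})"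
  have D_sets: "D i \<in> sets P" for i
  proof -
    obtain j m qs where i: "i = (j, m, qs)" by (cases i) auto
    let ?D = "\<lambda>t. {\<omega> \<in> space P. \<bar>X t \<omega> - real_of_rat (qs ! nat \<lfloor>real m * t\<rfloor>)\<bar> \<le> 1 / (real j + 1)}"
    have "0 \<in> \<rat> \<inter> {0..real j}" by simp
    then have eq: "D i = (\<Inter>t\<in>\<rat> \<inter> {0..real j}. ?D t)" by (auto simp: D_def i)
    have sets: "?D t \<in> sets P" if "t \<in> \<rat> \<inter> {0..real j}" for t
    proof -
      have [measurable]: "X t \<in> borel_measurable P" using that by (intro X) auto
      show ?thesis by measurable
    qed
    show ?thesis
      unfolding eq
    proof (rule sets.countable_INT')
      show "countable (\<rat> \<inter> {0..real j})" using countable_rat by (rule countable_subset[rotated]) auto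
      show "\<rat> \<inter> {0..real j} \<noteq> {}" using \<open>0 \<in> \<rat> \<inter> {0..real j}\<close> by blast
      show "?D ` (\<rat> \<inter> {0..real j}) \<subseteq> sets P" using sets by blast
    qed
  qed
  have "A \<subseteq> (\<Union>i\<in>{i. D i \<subseteq> A}. D i)"
  proof
    fix \<omega> assume w: "\<omega> \<in> A"
    then have wP: "\<omega> \<in> space P" by (simp add: A_def)
    have "\<exists>j. \<forall>\<omega>'\<in>space P. (\<forall>t\<in>{0..real j}. \<bar>X t \<omega>' - X t \<omega>\<bar> \<le> 2 / (real j + 1)) \<longrightarrow> \<omega>' \<in> A"
    proof (rule ccontr)
      assume "\<not> ?thesis"
      then obtain f where f: "\<And>j. f j \<in> space P" "\<And>j t. t \<in> {0..real j} \<Longrightarrow> \<bar>X t (f j) - X t \<omega>\<bar> \<le> 2 / (real j + 1)" "\<And>j. f j \<notin> A"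
        by metis
      have "\<exists>j. sample_path X (f j) \<in> U"
      proof (rule skorokhod_openD[OF U _ cad[OF f(1)]])
        show "sample_path X \<omega> \<in> U" using w by (simp add: A_def)
        fix N :: real
        show "uniform_limit {0..N} (\<lambda>j. sample_path X (f j)) (sample_path X \<omega>) sequentially"
        proof (rule uniform_limitI)
          fix e :: real assume e: "e > 0"
          have "(\<lambda>j. 2 / (real j + 1)) \<longlonglongrightarrow> 0" by real_asymp
          then have "\<forall>\<^sub>F j in sequentially. 2 / (real j + 1) < e" using e by (rule order_tendstoD)
          moreover have "\<forall>\<^sub>F j in sequentially. N \<le> real j" by real_asymp
          ultimately show "\<forall>\<^sub>F j in sequentially. \<forall>t\<in>{0..N}. dist (sample_path X (f j) t) (sample_path X \<omega> t) < e"
          proof eventually_elim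
            case (elim j)
            then show ?case using f(2)[of _ j] by (force simp: sample_path_def dist_real_def)
          qed
        qed
      qed
      then show False using f by (auto simp: A_def)
    qed
    then obtain j where j: "\<And>\<omega>'. \<omega>' \<in> space P \<Longrightarrow> (\<And>t. t \<in> {0..real j} \<Longrightarrow> \<bar>X t \<omega>' - X t \<omega>\<bar> \<le> 2 / (real j + 1)) \<Longrightarrow> \<omega>' \<in> A"
      by blast
    define e where "e = 1 / (2 * (real j + 1))"
    have e: "e > 0" by (simp add: e_def)
    have "uniformly_continuous_on {0..real j} (\<lambda>t. X t \<omega>)"
      by (rule compact_uniformly_continuous) (auto intro: continuous_on_subset[OF cont[OF wP]])
    then obtain d where d: "d > 0" "\<And>s t. s \<in> {0..real j} \<Longrightarrow> t \<in> {0..real j} \<Longrightarrow> dist s t < d \<Longrightarrow> dist (X s \<omega>) (X t \<omega>) < e"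
      unfolding uniformly_continuous_on_def using e by metis
    obtain m where m: "m > 0" "1 / real m < d"
      using reals_Archimedean[OF d(1)] by (auto simp: inverse_eq_divide intro: that[of "Suc _"])
    have "\<exists>q. \<bar>X (real i / real m) \<omega> - real_of_rat q\<bar> < e" for i :: nat
    proof -
      obtain q where "X (real i / real m) \<omega> - e < real_of_rat q" "real_of_rat q < X (real i / real m) \<omega> + e"
        using of_rat_dense[of "X (real i / real m) \<omega> - e" "X (real i / real m) \<omega> + e"] e by auto
      then show ?thesis by (intro exI[of _ q]) auto
    qed
    then obtain q where q: "\<And>i. \<bar>X (real i / real m) \<omega> - real_of_rat (q i)\<bar> < e" by metis
    \<comment> \<open>The last index needed is that of time \<open>j\<close> itself, hence the
      \<open>Suc\<close>.\<close>
    define qs where "qs = map q [0..<Suc (nat \<lfloor>real m * real j\<rfloor>)]"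
    have near: "\<bar>X t \<omega> - real_of_rat (qs ! nat \<lfloor>real m * t\<rfloor>)\<bar> \<le> 1 / (real j + 1)" if t: "t \<in> {0..real j}" for t
    proof -
      define i where "i = nat \<lfloor>real m * t\<rfloor>"
      have i: "real i = real_of_int \<lfloor>real m * t\<rfloor>" using t by (simp add: i_def)
      have "i \<le> nat \<lfloor>real m * real j\<rfloor>" unfolding i_def using t by (intro nat_mono floor_mono mult_left_mono) auto
      then have qi: "qs ! i = q i" by (simp add: qs_def del: upt_Suc)
      have "real i / real m \<le> t" "t - 1 / real m < real i / real m" unfolding i using floor_grid[OF m(1)] by auto
      then have "dist (X t \<omega>) (X (real i / real m) \<omega>) < e"
        using t m by (intro d(2)) (auto simp: dist_real_def)
      then have "\<bar>X t \<omega> - real_of_rat (q i)\<bar> \<le> 2 * e" using q[of i] by (simp add: dist_real_def)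
      moreover have "2 * e = 1 / (real j + 1)" by (simp add: e_def field_simps)
      ultimately show ?thesis unfolding i_def[symmetric] qi by simp
    qed
    have "\<omega> \<in> D (j, m, qs)" using near wP by (auto simp: D_def)
    moreover have "D (j, m, qs) \<subseteq> A"
    proof
      fix \<omega>' assume w': "\<omega>' \<in> D (j, m, qs)"
      then have w'P: "\<omega>' \<in> space P" by (simp add: D_def)
      have rat: "\<bar>X t \<omega>' - X t \<omega>\<bar> \<le> 2 / (real j + 1)" if "t \<in> \<rat> \<inter> {0..real j}" for t
      proof -
        have "\<bar>X t \<omega>' - real_of_rat (qs ! nat \<lfloor>real m * t\<rfloor>)\<bar> \<le> 1 / (real j + 1)" using w' that by (simp add: D_def)
        moreover have "\<bar>X t \<omega> - real_of_rat (qs ! nat \<lfloor>real m * t\<rfloor>)\<bar> \<le> 1 / (real j + 1)" using near that by simp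
        moreover have "1 / (real j + 1) + 1 / (real j + 1) = 2 / (real j + 1)" by simp
        ultimately show ?thesis by linarith
      qed
      show "\<omega>' \<in> A"
      proof (rule j[OF w'P])
        fix t assume t: "t \<in> {0..real j}"
        \<comment> \<open>Rational times approaching \<open>t\<close> from below, so that they stay
          in \<open>[0, j]\<close>; continuity carries the bound over to \<open>t\<close>.\<close>
        let ?s = "\<lambda>k. real_of_int \<lfloor>real k * t\<rfloor> / real k"
        have "continuous_on {0..} (\<lambda>t. \<bar>X t \<omega>' - X t \<omega>\<bar>)"
          using cont[OF wP] cont[OF w'P] by (intro continuous_intros)
        then have "(\<lambda>k. \<bar>X (?s k) \<omega>' - X (?s k) \<omega>\<bar>) \<longlonglongrightarrow> \<bar>X t \<omega>' - X t \<omega>\<bar>"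
          using t floor_grid_tendsto[of t] by (intro continuous_on_tendsto_compose[where f = "\<lambda>t. \<bar>X t \<omega>' - X t \<omega>\<bar>"]) auto
        moreover have "\<forall>\<^sub>F k in sequentially. \<bar>X (?s k) \<omega>' - X (?s k) \<omega>\<bar> \<le> 2 / (real j + 1)"
          using eventually_gt_at_top[of 0]
        proof eventually_elim
          case (elim k)
          have "?s k \<le> t" by (rule floor_grid[OF elim])
          moreover have "?s k \<ge> 0" using t by simp
          ultimately show ?case using t by (intro rat) auto
        qed
        ultimately show "\<bar>X t \<omega>' - X t \<omega>\<bar> \<le> 2 / (real j + 1)"
          by (intro tendsto_upperbound) auto
      qed
    qed
    ultimately show "\<omega> \<in> (\<Union>i\<in>{i. D i \<subseteq> A}. D i)" by blast
  qed
  then have "A = (\<Union>i\<in>{i. D i \<subseteq> A}. D i)" by blast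
  moreover have "(\<Union>i\<in>{i. D i \<subseteq> A}. D i) \<in> sets P"
    by (intro sets.countable_UN'' D_sets) auto
  ultimately show "{\<omega> \<in> space P. sample_path X \<omega> \<in> U} \<in> sets P" by (simp add: A_def)
qed

section \<open>Convergence of expectations by Lipschitz regularization\<close>

text \<open>An abstract one-sided portmanteau argument. \<open>\<Psi>\<close> carries the domain
  \<open>D\<close> of \<open>F\<close> into a space with a bounded pseudometric, in which the
  approximations need not be images of points of \<open>D\<close>.\<close>

locale lipschitz_regularization =
  fixes \<delta> :: "'s \<Rightarrow> 's \<Rightarrow> real" and \<Psi> :: "'x \<Rightarrow> 's" and D :: "'x set" and F :: "'x \<Rightarrow> real" and B :: real
  assumes \<delta>_nonneg: "\<And>a b. 0 \<le> \<delta> a b" and \<delta>_le_1: "\<And>a b. \<delta> a b \<le> 1" and \<delta>_refl: "\<And>a. \<delta> a a = 0"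
    and \<delta>_commute: "\<And>a b. \<delta> a b = \<delta> b a" and \<delta>_triangle: "\<And>a b c. \<delta> a c \<le> \<delta> a b + \<delta> b c"
    and D_nonempty: "D \<noteq> {}" and F_bounded: "\<And>x. x \<in> D \<Longrightarrow> \<bar>F x\<bar> \<le> B"
begin

text \<open>The Moreau-Yosida regularization: Lipschitz approximations of \<open>F\<close> from below, transported along \<open>\<Psi>\<close>.
  Testing against these avoids both uniform continuity of \<open>F\<close> and compactness in the path space.\<close>

definition reg :: "nat \<Rightarrow> 's \<Rightarrow> real" where
  "reg k e = (INF x\<in>D. F x + real k * \<delta> e (\<Psi> x))"

lemma B_nonneg: "B \<ge> 0"
  using D_nonempty F_bounded abs_ge_zero order_trans by blast

lemma reg_bdd_below: "bdd_below ((\<lambda>x. F x + real k * \<delta> e (\<Psi> x)) ` D)"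
proof (rule bdd_belowI2)
  fix x assume "x \<in> D"
  then show "- B \<le> F x + real k * \<delta> e (\<Psi> x)"
    using F_bounded[of x] mult_nonneg_nonneg[OF of_nat_0_le_iff \<delta>_nonneg, of k e "\<Psi> x"] by simp
qed

lemma reg_lower: "x \<in> D \<Longrightarrow> reg k e \<le> F x + real k * \<delta> e (\<Psi> x)"
  unfolding reg_def by (rule cINF_lower[OF reg_bdd_below])

lemma reg_greatest: "(\<And>x. x \<in> D \<Longrightarrow> c \<le> F x + real k * \<delta> e (\<Psi> x)) \<Longrightarrow> c \<le> reg k e"
  unfolding reg_def using D_nonempty by (rule cINF_greatest)

lemma reg_ge: "- B \<le> reg k e"
proof (rule reg_greatest)
  fix x assume "x \<in> D"
  then show "- B \<le> F x + real k * \<delta> e (\<Psi> x)"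
    using F_bounded[of x] mult_nonneg_nonneg[OF of_nat_0_le_iff \<delta>_nonneg, of k e "\<Psi> x"] by simp
qed

lemma reg_le: "reg k e \<le> B + real k"
proof -
  obtain x where x: "x \<in> D" using D_nonempty by blast
  have "real k * \<delta> e (\<Psi> x) \<le> real k * 1" by (intro mult_left_mono \<delta>_le_1) simp
  then show ?thesis using reg_lower[OF x, of k e] F_bounded[OF x] by simp
qed

lemma reg_abs_le: "\<bar>reg k e\<bar> \<le> B + real k"
  using reg_le[of k e] reg_ge[of k e] by simp

lemma reg_le_F: "x \<in> D \<Longrightarrow> reg k (\<Psi> x) \<le> F x"
  using reg_lower[of x k "\<Psi> x"] by (simp add: \<delta>_refl)

lemma reg_shift: "reg k e \<le> reg k e' + real k * \<delta> e e'"
proof -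
  have "reg k e - real k * \<delta> e e' \<le> reg k e'"
  proof (rule reg_greatest)
    fix x assume "x \<in> D"
    then have "reg k e \<le> F x + real k * \<delta> e (\<Psi> x)" by (rule reg_lower)
    also have "\<dots> \<le> F x + real k * (\<delta> e e' + \<delta> e' (\<Psi> x))"
      by (intro add_left_mono mult_left_mono \<delta>_triangle) simp
    finally show "reg k e - real k * \<delta> e e' \<le> F x + real k * \<delta> e' (\<Psi> x)" by (simp add: distrib_left)
  qed
  then show ?thesis by simp
qed

lemma reg_lipschitz: "\<bar>reg k e - reg k e'\<bar> \<le> real k * \<delta> e e'"
  using reg_shift[of k e e'] reg_shift[of k e' e] by (simp add: \<delta>_commute)

text \<open>Near-minimizers \<open>X k\<close> of the infimum have penalty at most
  \<open>2 * B + 1\<close>, so their images approach that of \<open>x\<close> at rate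
  \<open>1 / k\<close>; continuity along this sequence squeezes the infimum against
  \<open>F x\<close>. The slack \<open>1 / Suc k\<close> is positive also for
  \<open>k = 0\<close>.\<close>

lemma reg_tendsto:
  assumes x: "x \<in> D"
    and cont: "\<And>X. (\<And>j. X j \<in> D) \<Longrightarrow> (\<lambda>j. \<delta> (\<Psi> x) (\<Psi> (X j))) \<longlonglongrightarrow> 0 \<Longrightarrow> (\<lambda>j. F (X j)) \<longlonglongrightarrow> F x"
  shows "(\<lambda>k. reg k (\<Psi> x)) \<longlonglongrightarrow> F x"
proof -
  have "\<exists>y\<in>D. F y + real k * \<delta> (\<Psi> x) (\<Psi> y) < reg k (\<Psi> x) + 1 / real (Suc k)" for k
  proof -
    have "(INF y\<in>D. F y + real k * \<delta> (\<Psi> x) (\<Psi> y)) < reg k (\<Psi> x) + 1 / real (Suc k)"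
      by (simp add: reg_def[symmetric])
    then show ?thesis using cINF_less_iff[OF D_nonempty reg_bdd_below, of k "\<Psi> x"] by blast
  qed
  then obtain X where XD: "\<And>k. X k \<in> D"
    and X: "\<And>k. F (X k) + real k * \<delta> (\<Psi> x) (\<Psi> (X k)) < reg k (\<Psi> x) + 1 / real (Suc k)" by metis
  have bound: "real k * \<delta> (\<Psi> x) (\<Psi> (X k)) \<le> 2 * B + 1" for k
  proof -
    have "1 / real (Suc k) \<le> 1" by simp
    then show ?thesis using X[of k] reg_le_F[OF x, of k] F_bounded[OF x] F_bounded[OF XD[of k]] by linarith
  qed
  have "(\<lambda>k. \<delta> (\<Psi> x) (\<Psi> (X k))) \<longlonglongrightarrow> 0"
  proof (rule tendsto_sandwich[where f = "\<lambda>_. 0"])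
    show "\<forall>\<^sub>F k in sequentially. \<delta> (\<Psi> x) (\<Psi> (X k)) \<le> (2 * B + 1) / real k"
      using eventually_gt_at_top[of 0]
      by eventually_elim (use bound in \<open>auto simp: field_simps\<close>)
    show "(\<lambda>k. (2 * B + 1) / real k) \<longlonglongrightarrow> 0" by (rule lim_const_over_n)
  qed (auto simp: \<delta>_nonneg)
  from cont[OF XD this] have FX: "(\<lambda>k. F (X k)) \<longlonglongrightarrow> F x" .
  show ?thesis
  proof (rule tendsto_sandwich)
    show "\<forall>\<^sub>F k in sequentially. F (X k) - 1 / real (Suc k) \<le> reg k (\<Psi> x)"
    proof (intro always_eventually allI)
      fix k
      have "0 \<le> real k * \<delta> (\<Psi> x) (\<Psi> (X k))" by (simp add: \<delta>_nonneg)
      then show "F (X k) - 1 / real (Suc k) \<le> reg k (\<Psi> x)" using X[of k] by linarith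
    qed
    show "\<forall>\<^sub>F k in sequentially. reg k (\<Psi> x) \<le> F x" by (intro always_eventually allI reg_le_F[OF x])
    show "(\<lambda>k. F (X k) - 1 / real (Suc k)) \<longlonglongrightarrow> F x"
      using tendsto_diff[OF FX LIMSEQ_Suc[OF lim_1_over_n]] by simp
  qed simp
qed

text \<open>The regularization index \<open>k\<close> is fixed first, then the discretization
  \<open>m\<close>, and then \<open>n\<close> tends to infinity. The regularization lies below
  \<open>F\<close>, so the bound is one-sided. Continuity of \<open>F\<close> is asked for at the
  points \<open>x\<^sub>0 \<omega>\<close>, where the limit is concentrated.\<close>

lemma expectation_lower_semicontinuous:
  fixes M :: "nat \<Rightarrow> 'a measure" and P :: "'c measure"
    and x :: "nat \<Rightarrow> 'a \<Rightarrow> 'x" and x\<^sub>0 :: "'c \<Rightarrow> 'x"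
    and p :: "nat \<Rightarrow> nat \<Rightarrow> 'a \<Rightarrow> 's" and p\<^sub>0 :: "nat \<Rightarrow> 'c \<Rightarrow> 's"
  assumes M: "\<And>n. prob_space (M n)" and P: "prob_space P"
    and xD: "\<And>n \<omega>. \<omega> \<in> space (M n) \<Longrightarrow> x n \<omega> \<in> D" and x0D: "\<And>\<omega>. \<omega> \<in> space P \<Longrightarrow> x\<^sub>0 \<omega> \<in> D"
    and meas[measurable]: "\<And>n. (\<lambda>\<omega>. F (x n \<omega>)) \<in> borel_measurable (M n)" "(\<lambda>\<omega>. F (x\<^sub>0 \<omega>)) \<in> borel_measurable P"
    and cont: "\<And>\<omega> X. \<omega> \<in> space P \<Longrightarrow> (\<And>j. X j \<in> D) \<Longrightarrow> (\<lambda>j. \<delta> (\<Psi> (x\<^sub>0 \<omega>)) (\<Psi> (X j))) \<longlonglongrightarrow> 0 \<Longrightarrow>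
      (\<lambda>j. F (X j)) \<longlonglongrightarrow> F (x\<^sub>0 \<omega>)"
    and lip: "\<And>m H L C. 0 \<le> L \<Longrightarrow> (\<And>e e'. \<bar>H e - H e'\<bar> \<le> L * \<delta> e e') \<Longrightarrow> (\<And>e. \<bar>H e\<bar> \<le> C) \<Longrightarrow>
      (\<lambda>\<omega>. H (p\<^sub>0 m \<omega>)) \<in> borel_measurable P \<and> (\<forall>n. (\<lambda>\<omega>. H (p m n \<omega>)) \<in> borel_measurable (M n)) \<and>
      (\<lambda>n. \<integral>\<omega>. H (p m n \<omega>) \<partial>M n) \<longlonglongrightarrow> (\<integral>\<omega>. H (p\<^sub>0 m \<omega>) \<partial>P)"
    and close: "\<And>\<epsilon>. \<epsilon> > 0 \<Longrightarrow> \<forall>\<^sub>F m in sequentially. \<forall>\<^sub>F n in sequentially.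
      \<exists>A\<in>sets (M n). measure (M n) A \<le> \<epsilon> \<and> (\<forall>\<omega>\<in>space (M n) - A. \<delta> (\<Psi> (x n \<omega>)) (p m n \<omega>) \<le> \<epsilon>)"
    and limit: "AE \<omega> in P. (\<lambda>m. \<delta> (p\<^sub>0 m \<omega>) (\<Psi> (x\<^sub>0 \<omega>))) \<longlonglongrightarrow> 0"
    and \<epsilon>: "\<epsilon> > 0"
  shows "\<forall>\<^sub>F n in sequentially. (\<integral>\<omega>. F (x\<^sub>0 \<omega>) \<partial>P) - \<epsilon> \<le> (\<integral>\<omega>. F (x n \<omega>) \<partial>M n)"
proof -
  interpret P: prob_space P by fact
  have L: "(\<lambda>\<omega>. reg k (p\<^sub>0 m \<omega>)) \<in> borel_measurable P \<and> (\<forall>n. (\<lambda>\<omega>. reg k (p m n \<omega>)) \<in> borel_measurable (M n)) \<and>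
      (\<lambda>n. \<integral>\<omega>. reg k (p m n \<omega>) \<partial>M n) \<longlonglongrightarrow> (\<integral>\<omega>. reg k (p\<^sub>0 m \<omega>) \<partial>P)" for k m
  proof (rule lip[where H = "reg k" and m = m])
    show "0 \<le> real k" by simp
  qed (rule reg_lipschitz reg_abs_le)+
  have reg_lip: "(\<lambda>\<omega>. reg k (p\<^sub>0 m \<omega>)) \<in> borel_measurable P" "(\<lambda>\<omega>. reg k (p m n \<omega>)) \<in> borel_measurable (M n)"
      "(\<lambda>n. \<integral>\<omega>. reg k (p m n \<omega>) \<partial>M n) \<longlonglongrightarrow> (\<integral>\<omega>. reg k (p\<^sub>0 m \<omega>) \<partial>P)" for k m n
    using L[of k m] by simp_all
  note [measurable] = reg_lip(1,2)
  obtain N where Nlim: "\<forall>\<omega>\<in>space P - N. (\<lambda>m. \<delta> (p\<^sub>0 m \<omega>) (\<Psi> (x\<^sub>0 \<omega>))) \<longlonglongrightarrow> 0"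
    and N: "N \<in> null_sets P"
    by (rule AE_E3[OF limit]) blast
  \<comment> \<open>With the value 0 on the null set \<open>N\<close> this becomes an everywhere
    limit of measurable functions; measurability of the regularization along
    \<open>x\<^sub>0\<close> is obtained in this way.\<close>
  define R where "R k \<omega> = indicator (- N) \<omega> * reg k (\<Psi> (x\<^sub>0 \<omega>))" for k \<omega>
  have Rlim: "(\<lambda>m. indicator (- N) \<omega> * reg k (p\<^sub>0 m \<omega>)) \<longlonglongrightarrow> R k \<omega>" if "\<omega> \<in> space P" for k \<omega>
  proof (cases "\<omega> \<in> N")
    case False
    have "(\<lambda>m. reg k (p\<^sub>0 m \<omega>)) \<longlonglongrightarrow> reg k (\<Psi> (x\<^sub>0 \<omega>))"
    proof (rule LIM_zero_cancel, rule tendsto_rabs_zero_cancel, rule tendsto_sandwich[where f = "\<lambda>_. 0"])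
      show "(\<lambda>m. real k * \<delta> (p\<^sub>0 m \<omega>) (\<Psi> (x\<^sub>0 \<omega>))) \<longlonglongrightarrow> 0"
        using tendsto_mult_left[of "\<lambda>m. \<delta> (p\<^sub>0 m \<omega>) (\<Psi> (x\<^sub>0 \<omega>))" 0 sequentially "real k"] Nlim that False by auto
    qed (auto simp: reg_lipschitz)
    then show ?thesis using False by (simp add: R_def)
  qed (simp add: R_def)
  have [measurable]: "N \<in> sets P" using N by (rule null_setsD2)
  have Rm[measurable]: "R k \<in> borel_measurable P" for k
    by (rule borel_measurable_LIMSEQ_real[OF Rlim]) measurable
  have aeN: "AE \<omega> in P. \<omega> \<notin> N" using N by (rule AE_not_in)
  have R1: "(\<lambda>k. \<integral>\<omega>. R k \<omega> \<partial>P) \<longlonglongrightarrow> (\<integral>\<omega>. F (x\<^sub>0 \<omega>) \<partial>P)"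
  proof (rule integral_dominated_convergence[where w = "\<lambda>_. B"])
    show "AE \<omega> in P. (\<lambda>k. R k \<omega>) \<longlonglongrightarrow> F (x\<^sub>0 \<omega>)"
      using aeN AE_space
    proof eventually_elim
      case (elim \<omega>)
      then show ?case using reg_tendsto[OF x0D cont] by (simp add: R_def)
    qed
    show "AE \<omega> in P. norm (R k \<omega>) \<le> B" for k
      using AE_space
    proof eventually_elim
      case (elim \<omega>)
      have "\<bar>reg k (\<Psi> (x\<^sub>0 \<omega>))\<bar> \<le> B"
        using reg_ge[of k "\<Psi> (x\<^sub>0 \<omega>)"] reg_le_F[OF x0D[OF elim], of k] F_bounded[OF x0D[OF elim]] by linarith
      then show ?case using B_nonneg by (simp add: R_def indicator_def)
    qed
  qed auto
  have "\<forall>\<^sub>F k in sequentially. (\<integral>\<omega>. F (x\<^sub>0 \<omega>) \<partial>P) - \<epsilon> / 2 < (\<integral>\<omega>. R k \<omega> \<partial>P)"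
    using R1 \<epsilon> by (intro order_tendstoD) auto
  then obtain k where k: "(\<integral>\<omega>. F (x\<^sub>0 \<omega>) \<partial>P) - \<epsilon> / 2 < (\<integral>\<omega>. R k \<omega> \<partial>P)"
    by (meson eventually_sequentially order_refl)
  have R2: "(\<lambda>m. \<integral>\<omega>. reg k (p\<^sub>0 m \<omega>) \<partial>P) \<longlonglongrightarrow> (\<integral>\<omega>. R k \<omega> \<partial>P)"
  proof (rule integral_dominated_convergence[where w = "\<lambda>_. B + real k"])
    show "AE \<omega> in P. (\<lambda>m. reg k (p\<^sub>0 m \<omega>)) \<longlonglongrightarrow> R k \<omega>"
      using aeN AE_space by eventually_elim (use Rlim in force)
  qed (auto simp: reg_abs_le)
  \<comment> \<open>The error budget in units of \<open>\<eta>\<close>: \<open>2 * B + k\<close> for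
    the exceptional set, \<open>k\<close> for the Lipschitz comparison, and 1 for each of the limits
    in \<open>m\<close> and in \<open>n\<close>.\<close>
  define d where "d = 2 * B + 2 * real k + 2"
  have d: "d > 0" unfolding d_def using B_nonneg by linarith
  define \<eta> where "\<eta> = \<epsilon> / 2 / d"
  have \<eta>: "\<eta> > 0" using \<epsilon> d by (simp add: \<eta>_def)
  have "d * \<eta> = \<epsilon> / 2" using d by (simp add: \<eta>_def)
  then have \<eta>_eq: "(2 * B + 2 * real k + 2) * \<eta> = \<epsilon> / 2" by (simp add: d_def)
  have "\<forall>\<^sub>F m in sequentially. (\<integral>\<omega>. R k \<omega> \<partial>P) - \<eta> < (\<integral>\<omega>. reg k (p\<^sub>0 m \<omega>) \<partial>P)"
    using R2 \<eta> by (intro order_tendstoD) auto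
  with close[OF \<eta>] have "\<forall>\<^sub>F m in sequentially. (\<forall>\<^sub>F n in sequentially.
      \<exists>A\<in>sets (M n). measure (M n) A \<le> \<eta> \<and> (\<forall>\<omega>\<in>space (M n) - A. \<delta> (\<Psi> (x n \<omega>)) (p m n \<omega>) \<le> \<eta>)) \<and>
      (\<integral>\<omega>. R k \<omega> \<partial>P) - \<eta> < (\<integral>\<omega>. reg k (p\<^sub>0 m \<omega>) \<partial>P)"
    by (rule eventually_conj)
  from eventually_happens'[OF sequentially_bot this] obtain m where m1: "\<forall>\<^sub>F n in sequentially.
      \<exists>A\<in>sets (M n). measure (M n) A \<le> \<eta> \<and> (\<forall>\<omega>\<in>space (M n) - A. \<delta> (\<Psi> (x n \<omega>)) (p m n \<omega>) \<le> \<eta>)"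
    and m2: "(\<integral>\<omega>. R k \<omega> \<partial>P) - \<eta> < (\<integral>\<omega>. reg k (p\<^sub>0 m \<omega>) \<partial>P)"
    by (elim exE conjE)
  have "\<forall>\<^sub>F n in sequentially. (\<integral>\<omega>. reg k (p\<^sub>0 m \<omega>) \<partial>P) - \<eta> < (\<integral>\<omega>. reg k (p m n \<omega>) \<partial>M n)"
    using reg_lip(3) \<eta> by (intro order_tendstoD) auto
  with m1 show ?thesis
  proof eventually_elim
    case (elim n)
    interpret Mn: prob_space "M n" by (rule M)
    obtain A where A[measurable]: "A \<in> sets (M n)" and PA: "measure (M n) A \<le> \<eta>"
      and close_A: "\<And>\<omega>. \<omega> \<in> space (M n) - A \<Longrightarrow> \<delta> (\<Psi> (x n \<omega>)) (p m n \<omega>) \<le> \<eta>"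
      using elim(1) by blast
    have iF: "integrable (M n) (\<lambda>\<omega>. F (x n \<omega>))"
      by (rule Mn.integrable_const_bound[where B = B]) (auto simp: F_bounded xD)
    have ir: "integrable (M n) (\<lambda>\<omega>. reg k (p m n \<omega>))"
      by (rule Mn.integrable_const_bound[where B = "B + real k"]) (auto simp: reg_abs_le)
    have "(\<integral>\<omega>. reg k (p m n \<omega>) - real k * \<eta> - (2 * B + real k) * indicator A \<omega> \<partial>M n) \<le> (\<integral>\<omega>. F (x n \<omega>) \<partial>M n)"
    proof (rule integral_mono)
      show "integrable (M n) (\<lambda>\<omega>. reg k (p m n \<omega>) - real k * \<eta> - (2 * B + real k) * indicator A \<omega>)"
        using ir A by (auto simp: less_top[symmetric])
      fix \<omega> assume w: "\<omega> \<in> space (M n)"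
      note Fb = F_bounded[OF xD[OF w]]
      show "reg k (p m n \<omega>) - real k * \<eta> - (2 * B + real k) * indicator A \<omega> \<le> F (x n \<omega>)"
      proof (cases "\<omega> \<in> A")
        case True
        have "0 \<le> real k * \<eta>" using \<eta> by simp
        then show ?thesis using True reg_le[of k "p m n \<omega>"] Fb by simp
      next
        case False
        have "reg k (p m n \<omega>) \<le> reg k (\<Psi> (x n \<omega>)) + real k * \<delta> (p m n \<omega>) (\<Psi> (x n \<omega>))" by (rule reg_shift)
        also have "\<dots> \<le> F (x n \<omega>) + real k * \<eta>"
          using reg_le_F[OF xD[OF w]] close_A[of \<omega>] w False by (intro add_mono mult_left_mono) (auto simp: \<delta>_commute)
        finally show ?thesis using False by simp
      qed
    qed (rule iF)
    also have "(\<integral>\<omega>. reg k (p m n \<omega>) - real k * \<eta> - (2 * B + real k) * indicator A \<omega> \<partial>M n) =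
        (\<integral>\<omega>. reg k (p m n \<omega>) \<partial>M n) - real k * \<eta> - (2 * B + real k) * measure (M n) A"
      using ir A Mn.prob_space by (simp add: less_top[symmetric])
    finally have *: "(\<integral>\<omega>. reg k (p m n \<omega>) \<partial>M n) - real k * \<eta> - (2 * B + real k) * measure (M n) A \<le> (\<integral>\<omega>. F (x n \<omega>) \<partial>M n)" .
    have "(2 * B + real k) * measure (M n) A \<le> (2 * B + real k) * \<eta>"
      using PA B_nonneg by (intro mult_left_mono) auto
    moreover have "(2 * B + real k) * \<eta> + real k * \<eta> + 2 * \<eta> = \<epsilon> / 2"
      using \<eta>_eq by (simp add: algebra_simps)
    ultimately show ?case using * elim(2) m2 k by linarith
  qed
qed

end

section \<open>The Volterra map and discretized paths\<close>

text \<open>A bounded pseudometric for locally uniform convergence on \<open>[0, \<infinity>)\<close>: the cap \<open>1 / (1 + t)\<close> discounts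
  late times, and makes the supremum finite for arbitrary functions.\<close>

definition ldist :: "(real \<Rightarrow> real) \<Rightarrow> (real \<Rightarrow> real) \<Rightarrow> real" where
  "ldist x y = (SUP t\<in>{0..}. min \<bar>x t - y t\<bar> (1 / (1 + t)))"

lemma ldist_bdd: "bdd_above ((\<lambda>t. min \<bar>x t - y t\<bar> (1 / (1 + t))) ` {0 :: real..})"
  by (rule bdd_aboveI2[where M = 1]) (auto simp: min_le_iff_disj field_simps)

lemma ldist_upper: "t \<ge> 0 \<Longrightarrow> min \<bar>x t - y t\<bar> (1 / (1 + t)) \<le> ldist x y"
  unfolding ldist_def by (rule cSUP_upper[OF _ ldist_bdd]) simp

lemma ldist_least: "(\<And>t. t \<ge> 0 \<Longrightarrow> min \<bar>x t - y t\<bar> (1 / (1 + t)) \<le> r) \<Longrightarrow> ldist x y \<le> r"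
  unfolding ldist_def by (rule cSUP_least) auto

lemma ldist_nonneg: "0 \<le> ldist x y"
  using ldist_upper[of 0 x y] by (meson abs_ge_zero min.boundedI order_trans zero_le_divide_1_iff zero_le_one add_nonneg_nonneg order_refl)

lemma ldist_le_1: "ldist x y \<le> 1"
  by (rule ldist_least) (auto simp: min_le_iff_disj field_simps)

lemma ldist_refl: "ldist x x = 0"
proof (rule antisym)
  show "ldist x x \<le> 0" by (rule ldist_least) simp
qed (rule ldist_nonneg)

lemma ldist_commute: "ldist x y = ldist y x"
  unfolding ldist_def by (simp add: abs_minus_commute)

lemma ldist_triangle: "ldist x z \<le> ldist x y + ldist y z"
proof (rule ldist_least)
  fix t :: real assume t: "t \<ge> 0"
  have "min \<bar>x t - z t\<bar> (1 / (1 + t)) \<le> min \<bar>x t - y t\<bar> (1 / (1 + t)) + min \<bar>y t - z t\<bar> (1 / (1 + t))"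
    using t by (auto simp: min_def)
  then show "min \<bar>x t - z t\<bar> (1 / (1 + t)) \<le> ldist x y + ldist y z"
    using ldist_upper[OF t, of x y] ldist_upper[OF t, of y z] by linarith
qed

text \<open>On \<open>[0, T]\<close> the cap is at least \<open>1 / (1 + T)\<close>, so a smaller
  distance forces the minimum to be the difference of the paths.\<close>

lemma ldist_bound:
  assumes "T \<ge> 0" "ldist x y < 1 / (1 + T)" "t \<in> {0..T}"
  shows "\<bar>x t - y t\<bar> \<le> ldist x y"
proof -
  have "1 / (1 + T) \<le> 1 / (1 + t)" using assms by (intro divide_left_mono) auto
  then show ?thesis using ldist_upper[of t x y] assms by (auto simp: min_def split: if_splits)
qed

definition volterra :: "real \<Rightarrow> (real \<Rightarrow> real) \<Rightarrow> real \<Rightarrow> real" where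
  "volterra a x t = x t + a * integral {0..t} x"

text \<open>The domain on which the Volterra map is inverted. A general cadlag path may have
  infinitely many jumps in a bounded interval; finitely many discontinuities allow the fundamental
  theorem of calculus off a finite set. Rescaled walk paths and continuous paths qualify.\<close>

definition tame_paths :: "(real \<Rightarrow> real) set" where
  "tame_paths = {x \<in> cadlag_paths. \<forall>T. x integrable_on {0..T} \<and>
     (\<exists>C. finite C \<and> (\<forall>t\<in>{0<..<T} - C. isCont x t))}"

text \<open>Writing \<open>I\<close> for the integral of the difference of the paths, \<open>exp (a * t) * I t\<close> is the integral of
  \<open>exp (a * t)\<close> times the difference of the images.\<close>

lemma volterra_inverse_bound:
  assumes x: "x \<in> tame_paths" and y: "y \<in> tame_paths" and a: "a \<ge> 0"
    and r: "\<And>s. s \<in> {0..T} \<Longrightarrow> \<bar>volterra a x s - volterra a y s\<bar> \<le> r" and t: "t \<in> {0..T}"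
  shows "\<bar>x t - y t\<bar> \<le> 2 * r"
proof -
  define z where "z s = x s - y s" for s
  define I where "I s = integral {0..s} z" for s
  have int: "z integrable_on {0..s}" for s
    using x y unfolding z_def tame_paths_def by (intro integrable_diff) auto
  have e: "volterra a x s - volterra a y s = z s + a * I s" for s
    using x y unfolding volterra_def z_def I_def tame_paths_def
    by (subst integral_diff) (auto simp: algebra_simps)
  obtain C where C: "finite C" "\<And>s. s \<in> {0<..<t} - C \<Longrightarrow> isCont z s"
  proof -
    obtain C1 C2 where "finite C1" "finite C2" "\<forall>s\<in>{0<..<t} - C1. isCont x s" "\<forall>s\<in>{0<..<t} - C2. isCont y s"
      using x y unfolding tame_paths_def by blast
    moreover have "z = (\<lambda>s. x s - y s)" by (simp add: z_def fun_eq_iff)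
    ultimately show thesis by (intro that[of "C1 \<union> C2"]) (auto intro!: continuous_intros)
  qed
  have I': "(I has_real_derivative z s) (at s)" if s: "s \<in> {0<..<t} - C" for s
  proof -
    have "((\<lambda>u. integral {0..u} z) has_vector_derivative z s) (at s within ({0..t} - {}))"
      using s C(2)[OF s] by (intro integral_has_vector_derivative_continuous_at[OF int]) (auto intro: continuous_at_imp_continuous_at_within)
    then show ?thesis
      using s by (simp add: I_def[abs_def] has_real_derivative_iff_has_vector_derivative at_within_Icc_at)
  qed
  have contI: "continuous_on {0..t} I" unfolding I_def by (rule indefinite_integral_continuous_1[OF int])
  \<comment> \<open>Both integrals carry the factor \<open>a\<close>, so the comparison bounds
    \<open>a * I t\<close>, the quantity occurring in the Volterra map, without a division by
    \<open>a\<close>.\<close>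
  have int1: "((\<lambda>s. a * exp (a * s) * (z s + a * I s)) has_integral a * exp (a * t) * I t - a * exp (a * 0) * I 0) {0..t}"
  proof (rule fundamental_theorem_of_calculus_interior_strong[OF C(1)])
    fix s assume s: "s \<in> {0<..<t} - C"
    have "((\<lambda>s. a * exp (a * s) * I s) has_real_derivative a * exp (a * s) * (z s + a * I s)) (at s)"
      using I'[OF s] by (auto intro!: derivative_eq_intros simp: algebra_simps)
    then show "((\<lambda>s. a * exp (a * s) * I s) has_vector_derivative a * exp (a * s) * (z s + a * I s)) (at s)"
      by (simp add: has_real_derivative_iff_has_vector_derivative)
  qed (use t contI in \<open>auto intro!: continuous_intros\<close>)
  have int2: "((\<lambda>s. a * exp (a * s) * r) has_integral exp (a * t) * r - exp (a * 0) * r) {0..t}"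
  proof (rule fundamental_theorem_of_calculus)
    fix s
    have "((\<lambda>s. exp (a * s) * r) has_real_derivative a * exp (a * s) * r) (at s within {0..t})"
      by (auto intro!: derivative_eq_intros)
    then show "((\<lambda>s. exp (a * s) * r) has_vector_derivative a * exp (a * s) * r) (at s within {0..t})"
      by (simp add: has_real_derivative_iff_has_vector_derivative)
  qed (use t in auto)
  have I0: "I 0 = 0" by (simp add: I_def)
  have bound: "\<bar>a * exp (a * s) * (z s + a * I s)\<bar> \<le> a * exp (a * s) * r" if "s \<in> {0..t}" for s
    using r[of s] that t a by (simp add: e abs_mult mult_left_mono)
  have "a * exp (a * t) * I t \<le> exp (a * t) * r - r"
    using has_integral_le[OF int1 int2] bound by (force simp: I0)
  moreover have "- (exp (a * t) * r - r) \<le> a * exp (a * t) * I t"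
    using has_integral_le[OF has_integral_neg[OF int2] int1] bound by (force simp: I0)
  moreover have r0: "r \<ge> 0" using r[OF t] by linarith
  moreover have "a * exp (a * t) * I t = exp (a * t) * (a * I t)" by simp
  ultimately have "\<bar>exp (a * t) * (a * I t)\<bar> \<le> exp (a * t) * r" by linarith
  then have "\<bar>a * I t\<bar> \<le> r" by (simp only: abs_mult[of "exp (a * t)"] abs_exp_cancel mult_le_cancel_left_pos[OF exp_gt_zero])
  then show ?thesis using r[OF t] unfolding e by (simp add: z_def)
qed

text \<open>A distance below the cap at \<open>T\<close> bounds the difference of the images
  uniformly on \<open>[0, T]\<close>, and the inverse bound transfers this to the paths. It yields
  the continuity hypothesis of the regularization argument.\<close>

lemma volterra_tendsto_uniform:
  assumes x: "x \<in> tame_paths" and X: "\<And>j. X j \<in> tame_paths" and a: "a \<ge> 0"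
    and lim: "(\<lambda>j. ldist (volterra a x) (volterra a (X j))) \<longlonglongrightarrow> 0"
  shows "uniform_limit {0..T} X x sequentially"
proof (cases "T \<ge> 0")
  case True
  show ?thesis
  proof (rule uniform_limitI)
    fix e :: real assume e: "e > 0"
    have "0 < min (1 / (1 + T)) (e / 2)" using True e by simp
    with lim have "\<forall>\<^sub>F j in sequentially. ldist (volterra a x) (volterra a (X j)) < min (1 / (1 + T)) (e / 2)"
      by (rule order_tendstoD)
    then show "\<forall>\<^sub>F j in sequentially. \<forall>t\<in>{0..T}. dist (X j t) (x t) < e"
    proof eventually_elim
      case (elim j)
      show ?case
      proof
        fix t assume t: "t \<in> {0..T}"
        have "\<bar>x t - X j t\<bar> \<le> 2 * ldist (volterra a x) (volterra a (X j))"
          using elim by (intro volterra_inverse_bound[OF x X a _ t] ldist_bound[OF True]) auto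
        then show "dist (X j t) (x t) < e" using elim by (simp add: dist_real_def abs_minus_commute)
      qed
    qed
  qed
qed simp

section \<open>Step paths and continuous paths under the Volterra map\<close>

lemma step_has_integral:
  assumes n: "n > 0"
  shows "((\<lambda>t\<in>{0..}. z (nat \<lfloor>real n * t\<rfloor>)) has_integral (\<Sum>j<i. z j) / real n) {0..real i / real n}" (is "(?x has_integral _) _")
proof (induction i)
  case (Suc i)
  have "((\<lambda>_. z i) has_integral z i / real n) {real i / real n..real (Suc i) / real n}"
    using has_integral_const_real[of "z i" "real i / real n" "real (Suc i) / real n"] n by (simp add: field_simps)
  then have "(?x has_integral z i / real n) {real i / real n..real (Suc i) / real n}"
  proof (rule has_integral_spike_finite[rotated 2])
    show "finite {real (Suc i) / real n}" by simp
    fix t assume t: "t \<in> {real i / real n..real (Suc i) / real n} - {real (Suc i) / real n}"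
    have "t \<ge> 0" using t by (meson DiffD1 atLeastAtMost_iff divide_nonneg_nonneg of_nat_0_le_iff order_trans)
    have "\<lfloor>real n * t\<rfloor> = int i" using t n by (intro floor_unique) (auto simp: field_simps)
    then show "?x t = z i" using \<open>t \<ge> 0\<close> by simp
  qed
  with Suc have "(?x has_integral (\<Sum>j<i. z j) / real n + z i / real n) {0..real (Suc i) / real n}"
    by (rule has_integral_combine[rotated 2]) (use n in \<open>auto simp: field_simps\<close>)
  moreover have "(\<Sum>j<Suc i. z j) / real n = (\<Sum>j<i. z j) / real n + z i / real n"
    by (simp add: add_divide_distrib)
  ultimately show ?case by (simp only:)
next
  case 0
  have "(?x has_integral 0) {0..0}" by (rule has_integral_null_real) simp
  moreover have "(\<Sum>j<0. z j) / real n = 0" "real 0 / real n = 0" by simp_all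
  ultimately show ?case by (simp only:)
qed

lemma step_tame:
  fixes z :: "nat \<Rightarrow> real"
  shows "(\<lambda>t\<in>{0..}. z (nat \<lfloor>real n * t\<rfloor>)) \<in> tame_paths" (is "?x \<in> _")
  unfolding tame_paths_def
proof (safe)
  show "?x \<in> cadlag_paths" by (rule step_path_cadlag)
next
  fix T
  show "?x integrable_on {0..T}"
  proof (cases "n = 0")
    case True
    have "(\<lambda>_. z 0) integrable_on {0..T}" by (rule integrable_const_ivl)
    then show ?thesis by (rule integrable_eq) (auto simp: True)
  next
    case False
    obtain i where "T \<le> real i / real n"
      using real_arch_simple[of "T * real n"] False by (auto simp: field_simps)
    have "?x integrable_on {0..real i / real n}" using step_has_integral[of n z i] False by blast
    then show ?thesis by (rule integrable_on_subinterval) (use \<open>T \<le> real i / real n\<close> in auto)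
  qed
  show "\<exists>C. finite C \<and> (\<forall>t\<in>{0<..<T} - C. isCont ?x t)"
  proof (intro exI conjI ballI)
    show "finite ((\<lambda>i. real i / real n) ` {..nat \<lfloor>real n * T\<rfloor>})" by simp
    fix t assume t: "t \<in> {0<..<T} - (\<lambda>i. real i / real n) ` {..nat \<lfloor>real n * T\<rfloor>}"
    have "\<forall>\<^sub>F s in nhds t. ?x s = z (nat \<lfloor>real n * t\<rfloor>)"
    proof (cases "n = 0")
      case True
      have "\<forall>\<^sub>F s in nhds t. s \<in> {0<..}" using t by (intro eventually_nhds_in_open) auto
      then show ?thesis by eventually_elim (simp add: True)
    next
      case False
      define i where "i = nat \<lfloor>real n * t\<rfloor>"
      have i: "real i = real_of_int \<lfloor>real n * t\<rfloor>" using t by (simp add: i_def)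
      have "i \<le> nat \<lfloor>real n * T\<rfloor>" unfolding i_def using t by (intro nat_mono floor_mono mult_left_mono) auto
      then have "t \<noteq> real i / real n" using t by auto
      moreover have "real i / real n \<le> t" using floor_grid(1)[of n t] False by (simp add: i)
      moreover have "t < (real i + 1) / real n" using floor_grid(2)[of n t] False by (simp add: i add_divide_distrib)
      ultimately have "t \<in> {real i / real n<..<(real i + 1) / real n} \<inter> {0<..}" using t by auto
      then have "\<forall>\<^sub>F s in nhds t. s \<in> {real i / real n<..<(real i + 1) / real n} \<inter> {0<..}"
        by (intro eventually_nhds_in_open) auto
      then show ?thesis
      proof eventually_elim
        case (elim s)
        have "\<lfloor>real n * s\<rfloor> = int i" using elim False by (intro floor_unique) (auto simp: field_simps)
        then show ?case using elim by (simp add: i_def)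
      qed
    qed
    then have "isCont ?x t \<longleftrightarrow> isCont (\<lambda>_. z (nat \<lfloor>real n * t\<rfloor>)) t" by (rule isCont_cong)
    then show "isCont ?x t" by simp
  qed
qed

lemma continuous_tame:
  assumes "continuous_on {0..} f"
  shows "(\<lambda>t\<in>{0..}. f t) \<in> tame_paths" (is "?x \<in> _")
  unfolding tame_paths_def
proof (safe)
  show "?x \<in> cadlag_paths" by (rule continuous_path_cadlag[OF assms])
next
  fix T
  have "f integrable_on {0..T}"
    by (intro integrable_continuous_real continuous_on_subset[OF assms]) auto
  then show "?x integrable_on {0..T}" by (rule integrable_eq) auto
  show "\<exists>C. finite C \<and> (\<forall>t\<in>{0<..<T} - C. isCont ?x t)"
  proof (intro exI[of _ "{}"] conjI ballI)
    fix t assume t: "t \<in> {0<..<T} - {}"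
    have "\<forall>\<^sub>F s in nhds t. s \<in> {0<..}" using t by (intro eventually_nhds_in_open) auto
    then have "\<forall>\<^sub>F s in nhds t. ?x s = f s" by eventually_elim simp
    then have "isCont ?x t \<longleftrightarrow> isCont f t" by (rule isCont_cong)
    moreover have "isCont f t" using assms t by (intro continuous_on_interior[of "{0..}"]) auto
    ultimately show "isCont ?x t" by simp
  qed simp
qed

lemma volterra_step:
  fixes z :: "nat \<Rightarrow> real"
  assumes n: "n > 0" and t: "t \<ge> 0"
  defines "i \<equiv> nat \<lfloor>real n * t\<rfloor>"
  shows "volterra a (\<lambda>t\<in>{0..}. z (nat \<lfloor>real n * t\<rfloor>)) t =
    z i + a * ((\<Sum>j<i. z j) / real n + (t - real i / real n) * z i)" (is "volterra a ?x t = _")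
proof -
  have i: "real i = real_of_int \<lfloor>real n * t\<rfloor>" using t by (simp add: i_def)
  have it: "real i / real n \<le> t" using floor_grid(1)[of n t] n by (simp add: i)
  have it2: "t < (real i + 1) / real n" using floor_grid(2)[of n t] n by (simp add: i add_divide_distrib)
  have "((\<lambda>_. z i) has_integral (t - real i / real n) * z i) {real i / real n..t}"
    using has_integral_const_real[of "z i" "real i / real n" t] it by simp
  then have "(?x has_integral (t - real i / real n) * z i) {real i / real n..t}"
  proof (rule has_integral_spike_finite[rotated 2])
    show "finite {}" by simp
    fix s assume s: "s \<in> {real i / real n..t} - {}"
    have "s \<ge> 0" using s by (meson DiffD1 atLeastAtMost_iff divide_nonneg_nonneg of_nat_0_le_iff order_trans)
    have "s < (real i + 1) / real n" using s it2 by auto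
    then have "\<lfloor>real n * s\<rfloor> = int i" using s n by (intro floor_unique) (auto simp: field_simps)
    then show "?x s = z i" using \<open>s \<ge> 0\<close> by simp
  qed
  with step_has_integral[OF n, of z i]
  have "(?x has_integral (\<Sum>j<i. z j) / real n + (t - real i / real n) * z i) {0..t}"
    by (rule has_integral_combine[rotated 2]) (use it in auto)
  then have "integral {0..t} ?x = (\<Sum>j<i. z j) / real n + (t - real i / real n) * z i" by (rule integral_unique)
  then show ?thesis using t by (simp add: volterra_def i_def)
qed

text \<open>The walk time of the grid point \<open>b / m\<^sup>2\<close>. With \<open>b\<close>
  running up to \<open>m ^ 3\<close>, the single parameter \<open>m\<close> refines the mesh and
  extends the horizon at once.\<close>

definition grid :: "nat \<Rightarrow> nat \<Rightarrow> nat \<Rightarrow> nat" where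
  "grid n m b = nat \<lfloor>real n * (real b / real (m\<^sup>2))\<rfloor>"

text \<open>\<open>v 0\<close> is the initial value and \<open>v (Suc b)\<close> the increment over
  cell \<open>b\<close>. The cut at \<open>m ^ 3\<close> makes the path depend on finitely many
  coordinates.\<close>

definition step_fun :: "nat \<Rightarrow> (nat \<Rightarrow> real) \<Rightarrow> real \<Rightarrow> real" where
  "step_fun m v t = (\<Sum>j\<le>min (nat \<lfloor>real (m\<^sup>2) * t\<rfloor>) (m ^ 3). v j)"

lemma step_fun_telescope:
  "step_fun m (\<lambda>j. case j of 0 \<Rightarrow> y | Suc b \<Rightarrow> w (Suc b) - w b) t = y + w (min (nat \<lfloor>real (m\<^sup>2) * t\<rfloor>) (m ^ 3)) - w 0"
proof -
  have "(\<Sum>j\<le>i. case j of 0 \<Rightarrow> y | Suc b \<Rightarrow> w (Suc b) - w b) = y + w i - w 0" for i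
    by (induction i) auto
  then show ?thesis by (simp add: step_fun_def)
qed

lemma grid_mono: "b \<le> b' \<Longrightarrow> grid n m b \<le> grid n m b'"
  unfolding grid_def by (intro nat_mono floor_mono mult_left_mono divide_right_mono) auto

text \<open>The drift part \<open>z - w\<close> moves to a convex combination of itself and
  \<open>- w\<close>, so it never exceeds the common bound \<open>R\<close>.\<close>

lemma discrete_path_bound:
  fixes z w :: "nat \<Rightarrow> real"
  assumes rec: "\<And>i. z (Suc i) - z i = - q * z i + (w (Suc i) - w i)" and w0: "w 0 = 0"
    and q: "0 \<le> q" "q \<le> 1" and z0: "\<bar>z 0\<bar> \<le> R" and w: "\<And>i. i \<le> l \<Longrightarrow> \<bar>w i\<bar> \<le> R" and i: "i \<le> l"
  shows "\<bar>z i\<bar> \<le> 2 * R"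
proof -
  have "\<bar>z i - w i\<bar> \<le> R" using i
  proof (induction i)
    case (Suc i)
    have "z (Suc i) - w (Suc i) = (1 - q) * (z i - w i) - q * w i" using rec[of i] by (simp add: algebra_simps)
    then have "\<bar>z (Suc i) - w (Suc i)\<bar> \<le> \<bar>(1 - q) * (z i - w i)\<bar> + \<bar>q * w i\<bar>" by linarith
    also have "\<dots> = (1 - q) * \<bar>z i - w i\<bar> + q * \<bar>w i\<bar>" using q by (simp add: abs_mult)
    also have "\<dots> \<le> (1 - q) * R + q * R" using Suc w[of i] q by (intro add_mono mult_left_mono) auto
    finally show ?case by (simp add: algebra_simps)
  qed (simp add: w0 z0)
  then show ?thesis using w[OF i] by linarith
qed

text \<open>The deterministic comparison. Before time \<open>m\<close> three errors occur: the
  oscillation of \<open>w\<close> in a cell, the mismatch between \<open>2 * lam / n\<close> and the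
  discrete drift rate \<open>q\<close> accumulated up to time \<open>m\<close>, and the unfinished
  walk step in the integral; \<open>err\<close> controls the last two. From time \<open>m\<close> on
  the cap in the distance takes over.\<close>

lemma ldist_step_close:
  fixes z w :: "nat \<Rightarrow> real"
  assumes n: "n > 0" and m: "m > 0" and lam: "lam \<ge> 0" and q: "0 \<le> q" "q \<le> 1"
    and rec: "\<And>i. z (Suc i) - z i = - q * z i + (w (Suc i) - w i)" and w0: "w 0 = 0"
    and z0: "\<bar>z 0\<bar> \<le> R" and w: "\<And>i. i \<le> n * m \<Longrightarrow> \<bar>w i\<bar> \<le> R"
    and osc: "\<And>b i. b < m ^ 3 \<Longrightarrow> grid n m b \<le> i \<Longrightarrow> i \<le> grid n m (Suc b) \<Longrightarrow> \<bar>w i - w (grid n m b)\<bar> \<le> \<eta>"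
    and err: "(\<bar>2 * lam - real n * q\<bar> * real m + 2 * lam / real n) * (2 * R) \<le> \<eta>"
  shows "ldist (volterra (2 * lam) (\<lambda>t\<in>{0..}. z (nat \<lfloor>real n * t\<rfloor>)))
      (step_fun m (\<lambda>j. case j of 0 \<Rightarrow> z 0 | Suc b \<Rightarrow> w (grid n m (Suc b)) - w (grid n m b))) \<le> max (1 / (1 + real m)) (2 * \<eta>)"
    (is "ldist ?x ?p \<le> _")
proof (rule ldist_least)
  fix t :: real assume t: "t \<ge> 0"
  show "min \<bar>?x t - ?p t\<bar> (1 / (1 + t)) \<le> max (1 / (1 + real m)) (2 * \<eta>)"
  proof (cases "t < real m")
    case False
    then have "1 / (1 + t) \<le> 1 / (1 + real m)" by (intro divide_left_mono) auto
    then show ?thesis by linarith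
  next
    case True
    define i where "i = nat \<lfloor>real n * t\<rfloor>"
    define b where "b = nat \<lfloor>real (m\<^sup>2) * t\<rfloor>"
    have i: "real i = real_of_int \<lfloor>real n * t\<rfloor>" using t by (simp add: i_def)
    have b: "real b = real_of_int \<lfloor>real (m\<^sup>2) * t\<rfloor>" using t by (simp add: b_def)
    have m2: "m\<^sup>2 > 0" using m by simp
    have it: "real i / real n \<le> t" "t - real i / real n \<le> 1 / real n"
      using floor_grid[of n t] n by (auto simp: i)
    have bt: "real b / real (m\<^sup>2) \<le> t" "t < real (Suc b) / real (m\<^sup>2)"
      using floor_grid[OF m2, of t] by (auto simp: b add_divide_distrib)
    have bm: "b < m ^ 3"
    proof -
      have "real b / real (m\<^sup>2) < real m" using bt True by linarith
      then have "real b < real m * real (m\<^sup>2)" using m2 by (simp add: pos_divide_less_eq)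
      also have "\<dots> = real (m ^ 3)" by (simp add: numeral_3_eq_3 power2_eq_square)
      finally show ?thesis by simp
    qed
    have g1: "grid n m b \<le> i" unfolding grid_def i_def using bt by (intro nat_mono floor_mono mult_left_mono) auto
    have g2: "i \<le> grid n m (Suc b)" unfolding grid_def i_def using bt by (intro nat_mono floor_mono mult_left_mono) auto
    have inm: "i \<le> n * m"
    proof -
      have "real n * t \<le> real n * real m" using True by (intro mult_left_mono) auto
      then have "real i \<le> real (n * m)" unfolding i by simp linarith
      then show ?thesis unfolding of_nat_le_iff .
    qed
    have zR: "\<bar>z j\<bar> \<le> 2 * R" if "j \<le> i" for j
      using discrete_path_bound[of z q w R "n * m" j, OF rec w0 q z0 w] that inm by auto
    have R0: "R \<ge> 0" using z0 by linarith
    have zsum: "z i = z 0 - q * (\<Sum>j<i. z j) + w i" for i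
    proof (induction i)
      case (Suc i)
      then show ?case using rec[of i] by (simp add: algebra_simps)
    qed (simp add: w0)
    have p: "?p t = z 0 + w (grid n m b)"
    proof -
      have "?p t = z 0 + w (grid n m (min b (m ^ 3))) - w (grid n m 0)"
        unfolding b_def by (rule step_fun_telescope)
      also have "min b (m ^ 3) = b" using bm by simp
      also have "grid n m 0 = 0" by (simp add: grid_def)
      finally show ?thesis by (simp add: w0)
    qed
    \<comment> \<open>Inserting the unrolled recursion for \<open>z i\<close> cancels the drift sums
      up to the factor \<open>2 * lam / n - q\<close>.\<close>
    have xt: "?x t = z 0 + w i + ((2 * lam / real n - q) * (\<Sum>j<i. z j) + 2 * lam * ((t - real i / real n) * z i))"
      unfolding volterra_step[OF n t] i_def[symmetric] by (subst (1) zsum) (simp add: algebra_simps)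
    have "\<bar>\<Sum>j<i. z j\<bar> \<le> (\<Sum>j<i. \<bar>z j\<bar>)" by (rule sum_abs)
    also have "\<dots> \<le> (\<Sum>j<i. 2 * R)" by (intro sum_mono zR) auto
    finally have s: "\<bar>\<Sum>j<i. z j\<bar> \<le> real i * (2 * R)" by simp
    have "\<bar>(2 * lam / real n - q) * (\<Sum>j<i. z j)\<bar> \<le> \<bar>2 * lam / real n - q\<bar> * (real i * (2 * R))"
      unfolding abs_mult using s by (intro mult_left_mono) auto
    also have "\<dots> = \<bar>2 * lam - real n * q\<bar> * (real i / real n) * (2 * R)"
    proof -
      have "2 * lam / real n - q = (2 * lam - real n * q) / real n" using n by (simp add: diff_divide_distrib)
      then show ?thesis using n by (simp add: abs_divide)
    qed
    also have "\<dots> \<le> \<bar>2 * lam - real n * q\<bar> * real m * (2 * R)"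
      using it True R0 by (intro mult_right_mono mult_left_mono) auto
    finally have e1: "\<bar>(2 * lam / real n - q) * (\<Sum>j<i. z j)\<bar> \<le> \<bar>2 * lam - real n * q\<bar> * real m * (2 * R)" .
    have "\<bar>2 * lam * ((t - real i / real n) * z i)\<bar> = 2 * lam * ((t - real i / real n) * \<bar>z i\<bar>)"
      using lam it by (simp add: abs_mult)
    also have "\<dots> \<le> 2 * lam * (1 / real n * (2 * R))"
      using lam it zR[of i] by (intro mult_left_mono mult_mono) auto
    finally have e2: "\<bar>2 * lam * ((t - real i / real n) * z i)\<bar> \<le> 2 * lam / real n * (2 * R)" by simp
    have "\<bar>w i - w (grid n m b)\<bar> \<le> \<eta>" by (rule osc[OF bm g1 g2])
    moreover have "\<bar>y + a + (A + B) - (y + b)\<bar> \<le> 2 * \<eta>"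
      if "\<bar>a - b\<bar> \<le> \<eta>" "\<bar>A\<bar> \<le> s" "\<bar>B\<bar> \<le> s'" "s + s' \<le> \<eta>" for y a b A B s s' :: real
      using that by linarith
    ultimately have "\<bar>?x t - ?p t\<bar> \<le> 2 * \<eta>"
      using e1 e2 err unfolding xt p distrib_right by blast
    then show ?thesis by linarith
  qed
qed

section \<open>Increments of Brownian motion\<close>

text \<open>Vectors are functions on the naturals, and the Lipschitz bound itself forces dependence
  on the coordinates up to \<open>r\<close> only; an induction on \<open>r\<close> then needs no
  change of type.\<close>

definition coord_lipschitz :: "nat \<Rightarrow> real \<Rightarrow> real \<Rightarrow> ((nat \<Rightarrow> real) \<Rightarrow> real) \<Rightarrow> bool" where
  "coord_lipschitz r B L H \<longleftrightarrow> L \<ge> 0 \<and> (\<forall>v. \<bar>H v\<bar> \<le> B) \<and> (\<forall>v v'. \<bar>H v - H v'\<bar> \<le> L * (\<Sum>j\<le>r. \<bar>v j - v' j\<bar>))"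

lemma coord_lipschitz_cong:
  assumes "coord_lipschitz r B L H" "\<And>j. j \<le> r \<Longrightarrow> v j = v' j"
  shows "H v = H v'"
proof -
  have "\<bar>H v - H v'\<bar> \<le> L * (\<Sum>j\<le>r. \<bar>v j - v' j\<bar>)" using assms(1) by (simp add: coord_lipschitz_def)
  also have "(\<Sum>j\<le>r. \<bar>v j - v' j\<bar>) = 0" using assms(2) by simp
  finally show ?thesis by simp
qed

lemma coord_lipschitz_borel:
  assumes "coord_lipschitz r B L H"
  shows "H \<in> borel_measurable borel"
proof (rule borel_measurable_continuous_onI)
  have "(H \<longlongrightarrow> H v) (at v)" for v
  proof (rule LIM_zero_cancel, rule tendsto_rabs_zero_cancel, rule tendsto_sandwich[where f = "\<lambda>_. 0"])
    show "\<forall>\<^sub>F u in at v. \<bar>H u - H v\<bar> \<le> L * (\<Sum>j\<le>r. \<bar>u j - v j\<bar>)"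
      using assms by (simp add: coord_lipschitz_def)
    have "((\<lambda>u. L * (\<Sum>j\<le>r. \<bar>u j - v j\<bar>)) \<longlongrightarrow> L * (\<Sum>j\<le>r. \<bar>v j - v j\<bar>)) (at v)"
    proof (intro tendsto_intros)
      fix j
      have "continuous_on UNIV (\<lambda>u :: nat \<Rightarrow> real. u j)" by (rule continuous_on_product_coordinates)
      then show "((\<lambda>u. u j) \<longlongrightarrow> v j) (at v)" by (simp add: continuous_on)
    qed
    then show "((\<lambda>u. L * (\<Sum>j\<le>r. \<bar>u j - v j\<bar>)) \<longlongrightarrow> 0) (at v)" by simp
  qed auto
  then show "continuous_on UNIV H" by (simp add: continuous_on)
qed

lemma coord_lipschitz_measurable:
  assumes "coord_lipschitz r B L H" "\<And>j. (\<lambda>\<omega>. f \<omega> j) \<in> borel_measurable M"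
  shows "(\<lambda>\<omega>. H (f \<omega>)) \<in> borel_measurable M"
  using measurable_compose[OF measurable_coordinatewise_then_product coord_lipschitz_borel[OF assms(1)], of f M] assms(2)
  by simp

lemma coord_lipschitz_update:
  assumes H: "coord_lipschitz (Suc r) B L H"
  shows "bounded_lipschitz B L (\<lambda>y. H (v(Suc r := y)))"
  unfolding bounded_lipschitz_def
proof (intro conjI allI)
  show "\<bar>H (v(Suc r := x))\<bar> \<le> B" for x using H by (simp add: coord_lipschitz_def)
  fix x y
  have "\<bar>H (v(Suc r := x)) - H (v(Suc r := y))\<bar> \<le> L * (\<Sum>j\<le>Suc r. \<bar>(v(Suc r := x)) j - (v(Suc r := y)) j\<bar>)"
    using H unfolding coord_lipschitz_def by blast
  also have "(\<Sum>j\<le>Suc r. \<bar>(v(Suc r := x)) j - (v(Suc r := y)) j\<bar>) = \<bar>x - y\<bar>" by simp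
  finally show "\<bar>H (v(Suc r := x)) - H (v(Suc r := y))\<bar> \<le> L * \<bar>x - y\<bar>" .
qed

text \<open>Integrating out the last coordinate lowers \<open>r\<close> by one and keeps both
  constants; this drives the induction for the grid vectors.\<close>

lemma coord_lipschitz_gauss_avg:
  assumes H: "coord_lipschitz (Suc r) B L H"
  shows "coord_lipschitz r B L (\<lambda>v. gauss_avg s (\<lambda>y. H (v(Suc r := y))) 0)"
  unfolding coord_lipschitz_def
proof (intro conjI allI)
  show "L \<ge> 0" using H by (simp add: coord_lipschitz_def)
  fix v v' :: "nat \<Rightarrow> real"
  show "\<bar>gauss_avg s (\<lambda>y. H (v(Suc r := y))) 0\<bar> \<le> B"
    using gauss_avg_bounded_lipschitz[OF coord_lipschitz_update[OF H]] by (simp add: bounded_lipschitz_def)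
  note i = gauss_avg_integrable[OF coord_lipschitz_update[OF H], of _ 0 s]
  have "\<bar>\<integral>y. H (v(Suc r := 0 + s * y)) - H (v'(Suc r := 0 + s * y)) \<partial>std_normal_distribution\<bar>
     \<le> (\<integral>y. L * (\<Sum>j\<le>r. \<bar>v j - v' j\<bar>) \<partial>std_normal_distribution)"
  proof (rule abs_gauss_integral_le)
    show "integrable std_normal_distribution (\<lambda>y. H (v(Suc r := 0 + s * y)) - H (v'(Suc r := 0 + s * y)))"
      using i[of v] i[of v'] by (rule Bochner_Integration.integrable_diff)
    show "integrable std_normal_distribution (\<lambda>y. L * (\<Sum>j\<le>r. \<bar>v j - v' j\<bar>))"
      by (rule integrable_std_normal_bounded[OF _ order_refl]) simp
    fix y
    have "\<bar>H (v(Suc r := 0 + s * y)) - H (v'(Suc r := 0 + s * y))\<bar> \<le>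
        L * (\<Sum>j\<le>Suc r. \<bar>(v(Suc r := 0 + s * y)) j - (v'(Suc r := 0 + s * y)) j\<bar>)"
      using H unfolding coord_lipschitz_def by blast
    also have "(\<Sum>j\<le>Suc r. \<bar>(v(Suc r := 0 + s * y)) j - (v'(Suc r := 0 + s * y)) j\<bar>) = (\<Sum>j\<le>r. \<bar>v j - v' j\<bar>)"
      by simp
    finally show "\<bar>H (v(Suc r := 0 + s * y)) - H (v'(Suc r := 0 + s * y))\<bar> \<le> L * (\<Sum>j\<le>r. \<bar>v j - v' j\<bar>)" .
  qed
  then show "\<bar>gauss_avg s (\<lambda>y. H (v(Suc r := y))) 0 - gauss_avg s (\<lambda>y. H (v'(Suc r := y))) 0\<bar> \<le> L * (\<Sum>j\<le>r. \<bar>v j - v' j\<bar>)"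
    using i[of v] i[of v'] by (simp add: gauss_avg_def std_normal_integral_const)
qed

text \<open>The limit counterpart of the vector of initial value and grid increments:
  \<open>q\<close> cells per unit of time, with the factor \<open>a\<close> on the increments but
  not on the initial value.\<close>

definition bm_vec :: "(real \<Rightarrow> 'c \<Rightarrow> real) \<Rightarrow> ('c \<Rightarrow> real) \<Rightarrow> nat \<Rightarrow> real \<Rightarrow> 'c \<Rightarrow> nat \<Rightarrow> real" where
  "bm_vec W X q a \<omega> j = (case j of 0 \<Rightarrow> X \<omega> | Suc b \<Rightarrow> a * (W (real (Suc b) / real q) \<omega> - W (real b / real q) \<omega>))"

text \<open>\<open>X\<close> is independent of the whole path and the increments are independent of
  each other. Events of increments are events of the path, so the two product formulas
  combine.\<close>

lemma brownian_increments_indep: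
  assumes W: "brownian_motion P W"
    and indep: "indep_random_variables P borel X (Pi\<^sub>M {0..} (\<lambda>_. borel)) (sample_path W)"
  shows "prob_space.indep_vars P (\<lambda>_. borel) (\<lambda>j \<omega>. bm_vec W X q 1 \<omega> j) UNIV"
proof -
  interpret prob_space P using W by (simp add: brownian_motion_def)
  let ?U = "\<lambda>j \<omega>. bm_vec W X q 1 \<omega> j"
  let ?\<tau> = "\<lambda>i :: nat. real i / real q"
  have Xm: "X \<in> borel_measurable P" and Wm: "sample_path W \<in> P \<rightarrow>\<^sub>M Pi\<^sub>M {0..} (\<lambda>_. borel)"
    and ind: "indep_set (sets (vimage_algebra (space P) X borel)) (sets (vimage_algebra (space P) (sample_path W) (Pi\<^sub>M {0..} (\<lambda>_. borel))))"
    using indep by (auto simp: indep_random_variables_def)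
  have [measurable]: "W t \<in> borel_measurable P" if "t \<ge> 0" for t using W that by (simp add: brownian_motion_def)
  have "mono ?\<tau>" by (intro monoI divide_right_mono) auto
  then have iW: "indep_vars (\<lambda>_. borel) (\<lambda>i \<omega>. W (?\<tau> (Suc i)) \<omega> - W (?\<tau> i) \<omega>) UNIV"
  proof -
    have "\<forall>\<tau> :: nat \<Rightarrow> real. 0 \<le> \<tau> 0 \<and> mono \<tau> \<longrightarrow>
        indep_vars (\<lambda>_. borel) (\<lambda>i \<omega>. W (\<tau> (Suc i)) \<omega> - W (\<tau> i) \<omega>) UNIV"
      using W unfolding brownian_motion_def by blast
    from this[rule_format, of ?\<tau>] \<open>mono ?\<tau>\<close> show ?thesis by (simp only:) simp
  qed
  have incr_sets: "A \<in> sets (vimage_algebra (space P) (sample_path W) (Pi\<^sub>M {0..} (\<lambda>_. borel)))"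
    if A: "A \<in> {?U (Suc b) -` S \<inter> space P | S. S \<in> sets borel}" for A b
  proof -
    let ?g = "\<lambda>p :: real \<Rightarrow> real. p (?\<tau> (Suc b)) - p (?\<tau> b)"
    obtain S where S: "S \<in> sets borel" "A = ?U (Suc b) -` S \<inter> space P" using A by blast
    have "?g \<in> borel_measurable (Pi\<^sub>M {0..} (\<lambda>_. borel))"
      by (intro borel_measurable_diff measurable_component_singleton) auto
    then have "?g -` S \<inter> space (Pi\<^sub>M {0..} (\<lambda>_. borel)) \<in> sets (Pi\<^sub>M {0..} (\<lambda>_. borel))"
      using S(1) by (rule measurable_sets)
    then have "sample_path W -` (?g -` S \<inter> space (Pi\<^sub>M {0..} (\<lambda>_. borel))) \<inter> space P
        \<in> sets (vimage_algebra (space P) (sample_path W) (Pi\<^sub>M {0..} (\<lambda>_. borel)))"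
      by (rule in_vimage_algebra)
    also have "sample_path W -` (?g -` S \<inter> space (Pi\<^sub>M {0..} (\<lambda>_. borel))) \<inter> space P = A"
      using measurable_space[OF Wm] by (auto simp: S(2) bm_vec_def sample_path_def)
    finally show ?thesis .
  qed
  have U_rv: "?U j \<in> borel_measurable P" for j
  proof (cases j)
    case (Suc b)
    have "(\<lambda>\<omega>. 1 * (W (?\<tau> (Suc b)) \<omega> - W (?\<tau> b) \<omega>)) \<in> borel_measurable P"
      by (intro borel_measurable_times borel_measurable_const borel_measurable_diff) auto
    then show ?thesis by (simp add: Suc bm_vec_def)
  qed (use Xm in \<open>simp add: bm_vec_def\<close>)
  let ?E = "\<lambda>j. {?U j -` S \<inter> space P | S. S \<in> sets borel}"
  have iU: "indep_sets (\<lambda>b. ?E (Suc b)) UNIV"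
    using iW unfolding indep_vars_def2 by (simp add: bm_vec_def)
  have E_ev: "?E j \<subseteq> events" for j using U_rv by (auto intro: measurable_sets)
  have "indep_sets ?E UNIV"
  proof (rule indep_setsI)
    fix A J assume J: "J \<noteq> {}" "J \<subseteq> UNIV" "finite J" and A: "\<forall>j\<in>J. A j \<in> ?E j"
    \<comment> \<open>Index 0 belongs to \<open>X\<close>; the remaining indices, shifted down by
      one, number the increments.\<close>
    define J' where "J' = {b. Suc b \<in> J}"
    have "Suc ` J' \<subseteq> J" by (auto simp: J'_def)
    then have fin: "finite J'" using J by (meson finite_imageD finite_subset inj_Suc)
    have J_eq: "J - {0} = Suc ` J'" by (auto simp: J'_def image_iff) (metis not0_implies_Suc)
    have prodJ': "prob (\<Inter>b\<in>J'. A (Suc b)) = (\<Prod>b\<in>J'. prob (A (Suc b)))" if "J' \<noteq> {}"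
      using that fin A by (intro indep_setsD[OF iU]) (auto simp: J'_def)
    show "prob (\<Inter>j\<in>J. A j) = (\<Prod>j\<in>J. prob (A j))"
    proof (cases "0 \<in> J")
      case False
      then have "J = Suc ` J'" "J' \<noteq> {}" using J_eq J by auto
      then show ?thesis using prodJ' by (simp add: prod.reindex)
    next
      case True
      then have J2: "J = insert 0 (Suc ` J')" using J_eq by auto
      show ?thesis
      proof (cases "J' = {}")
        case True
        then show ?thesis by (simp add: J2)
      next
        case False
        obtain S where S: "S \<in> sets borel" "A 0 = X -` S \<inter> space P" using A True by (auto simp: bm_vec_def)
        have "A 0 \<in> sets (vimage_algebra (space P) X borel)" unfolding S(2) by (rule in_vimage_algebra[OF S(1)])
        moreover have "(\<Inter>b\<in>J'. A (Suc b)) \<in> sets (vimage_algebra (space P) (sample_path W) (Pi\<^sub>M {0..} (\<lambda>_. borel)))"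
          using A fin False by (intro sets.finite_INT incr_sets) (auto simp: J'_def)
        ultimately have "prob (A 0 \<inter> (\<Inter>b\<in>J'. A (Suc b))) = prob (A 0) * prob (\<Inter>b\<in>J'. A (Suc b))"
          by (rule indep_setD[OF ind])
        then show ?thesis using prodJ'[OF False] fin by (simp add: J2 prod.reindex)
      qed
    qed
  qed (rule E_ev)
  then show ?thesis unfolding indep_vars_def2 using U_rv by simp
qed

text \<open>Fubini's theorem for the coordinates up to \<open>r\<close> and the last one, which is
  centred Gaussian with standard deviation \<open>a / sqrt q\<close>.\<close>

lemma brownian_last_increment:
  assumes W: "brownian_motion P W"
    and indep: "indep_random_variables P borel X (Pi\<^sub>M {0..} (\<lambda>_. borel)) (sample_path W)"
    and q: "q > 0" and a: "a \<ge> 0" and H: "coord_lipschitz (Suc r) B L H"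
  shows "(\<integral>\<omega>. H (bm_vec W X q a \<omega>) \<partial>P) =
    (\<integral>\<omega>. gauss_avg (a / sqrt (real q)) (\<lambda>y. H ((bm_vec W X q a \<omega>)(Suc r := y))) 0 \<partial>P)"
proof -
  interpret prob_space P using W by (simp add: brownian_motion_def)
  let ?U = "\<lambda>j \<omega>. bm_vec W X q 1 \<omega> j"
  let ?S = "Pi\<^sub>M {..r} (\<lambda>_. borel :: real measure)" and ?T = "Pi\<^sub>M {Suc r} (\<lambda>_. borel :: real measure)"
  let ?V = "\<lambda>\<omega>. \<lambda>j\<in>{..r}. ?U j \<omega>" and ?Y = "\<lambda>\<omega>. \<lambda>j\<in>{Suc r}. ?U j \<omega>"
  have iv: "indep_vars (\<lambda>_. borel) ?U UNIV" by (rule brownian_increments_indep[OF W indep])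
  have "indep_var ?S ?V ?T ?Y"
    by (rule indep_var_restrict[OF iv]) auto
  then have Vm: "?V \<in> P \<rightarrow>\<^sub>M ?S" and Ym: "?Y \<in> P \<rightarrow>\<^sub>M ?T"
    and dist: "distr P ?S ?V \<Otimes>\<^sub>M distr P ?T ?Y = distr P (?S \<Otimes>\<^sub>M ?T) (\<lambda>\<omega>. (?V \<omega>, ?Y \<omega>))"
    unfolding indep_var_distribution_eq by auto
  \<comment> \<open>Rebuilds the scaled vector from unscaled coordinates, as independence was shown
    for scale 1; index 0 is never scaled.\<close>
  define sc where "sc v y j = (if j = 0 then v 0 else if j \<le> r then a * v j else if j = Suc r then a * y else 0)"
    for v :: "nat \<Rightarrow> real" and y :: real and j :: nat
  have vec: "H (bm_vec W X q a \<omega>) = H (sc (?V \<omega>) (?Y \<omega> (Suc r)))" for \<omega>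
  proof (rule coord_lipschitz_cong[OF H])
    show "bm_vec W X q a \<omega> j = sc (?V \<omega>) (?Y \<omega> (Suc r)) j" if "j \<le> Suc r" for j
      using that by (cases "j = Suc r"; cases j) (auto simp: sc_def bm_vec_def)
  qed
  have scm: "(\<lambda>p. sc (fst p) (snd p (Suc r)) j) \<in> borel_measurable (?S \<Otimes>\<^sub>M ?T)" for j
  proof -
    have f: "(\<lambda>p. fst p i) \<in> borel_measurable (?S \<Otimes>\<^sub>M ?T)" if "i \<le> r" for i
      using that by (intro measurable_compose[OF measurable_fst measurable_component_singleton]) auto
    have s: "(\<lambda>p. snd p (Suc r)) \<in> borel_measurable (?S \<Otimes>\<^sub>M ?T)"
      by (intro measurable_compose[OF measurable_snd measurable_component_singleton]) auto
    show ?thesis unfolding sc_def using f s by (cases "j = 0"; cases "j \<le> r"; cases "j = Suc r") auto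
  qed
  have Hm: "(\<lambda>p. H (sc (fst p) (snd p (Suc r)))) \<in> borel_measurable (?S \<Otimes>\<^sub>M ?T)"
    by (rule coord_lipschitz_measurable[OF H scm])
  interpret D1: prob_space "distr P ?S ?V" by (rule prob_space_distr[OF Vm])
  interpret D2: prob_space "distr P ?T ?Y" by (rule prob_space_distr[OF Ym])
  interpret D: pair_prob_space "distr P ?S ?V" "distr P ?T ?Y" ..
  have bd: "\<bar>H v\<bar> \<le> B" for v using H by (simp add: coord_lipschitz_def)
  have inner: "(\<integral>\<omega>. H (sc v (?Y \<omega> (Suc r))) \<partial>P) = gauss_avg (a / sqrt (real q)) (\<lambda>y. H ((sc v 0)(Suc r := y))) 0" for v
  proof -
    let ?\<phi> = "\<lambda>y. H ((sc v 0)(Suc r := y))"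
    let ?W = "\<lambda>\<omega>. W (real (Suc r) / real q) \<omega> - W (real r / real q) \<omega>"
    have \<phi>: "bounded_lipschitz B L ?\<phi>" by (rule coord_lipschitz_update[OF H])
    \<comment> \<open>The scale is absorbed into the test function, so \<open>a = 0\<close> never
      leads to a normal density of variance zero.\<close>
    have \<psi>: "bounded_lipschitz B (L * a) (\<lambda>x. ?\<phi> (a * x))"
      unfolding bounded_lipschitz_def
    proof (intro conjI allI)
      fix x y
      have "\<bar>?\<phi> (a * x) - ?\<phi> (a * y)\<bar> \<le> L * \<bar>a * x - a * y\<bar>" using \<phi> unfolding bounded_lipschitz_def by blast
      also have "\<bar>a * x - a * y\<bar> = a * \<bar>x - y\<bar>" using a by (simp add: abs_mult right_diff_distrib[symmetric])
      finally show "\<bar>?\<phi> (a * x) - ?\<phi> (a * y)\<bar> \<le> L * a * \<bar>x - y\<bar>" by (simp only: mult.assoc)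
    qed (rule bd)
    have var: "real (Suc r) / real q - real r / real q = 1 / real q" by (simp add: diff_divide_distrib[symmetric])
    have "0 \<le> real r / real q \<and> real r / real q < real (Suc r) / real q" using q by (simp add: divide_strict_right_mono)
    then have "distributed P lborel ?W (normal_density 0 (sqrt (real (Suc r) / real q - real r / real q)))"
      using W unfolding brownian_motion_def by blast
    then have dW: "distr P lborel ?W = density lborel (normal_density 0 (sqrt (1 / real q)))" and Wm: "?W \<in> P \<rightarrow>\<^sub>M lborel"
      unfolding var by (simp_all add: distributed_def)
    have "(\<integral>\<omega>. H (sc v (?Y \<omega> (Suc r))) \<partial>P) = (\<integral>\<omega>. ?\<phi> (a * ?W \<omega>) \<partial>P)"
    proof (intro Bochner_Integration.integral_cong refl arg_cong[where f = H])
      show "sc v (?Y \<omega> (Suc r)) = (sc v 0)(Suc r := a * ?W \<omega>)" for \<omega>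
        by (auto simp: sc_def bm_vec_def fun_eq_iff)
    qed
    also have "\<dots> = (\<integral>x. ?\<phi> (a * (0 + x)) \<partial>distr P lborel ?W)"
      using bounded_lipschitz_measurable[OF \<psi>] by (subst integral_distr[OF Wm]) auto
    also have "\<dots> = gauss_avg (sqrt (1 / real q)) (\<lambda>x. ?\<phi> (a * x)) 0"
      unfolding dW by (rule gauss_avg_conv_density[OF \<psi>, symmetric]) (use q in simp)
    also have "\<dots> = gauss_avg (a / sqrt (real q)) ?\<phi> 0"
      by (simp add: gauss_avg_def real_sqrt_divide)
    finally show ?thesis .
  qed
  have "(\<integral>\<omega>. H (bm_vec W X q a \<omega>) \<partial>P) = (\<integral>\<omega>. H (sc (fst (?V \<omega>, ?Y \<omega>)) (snd (?V \<omega>, ?Y \<omega>) (Suc r))) \<partial>P)"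
    unfolding vec by simp
  also have "\<dots> = (\<integral>p. H (sc (fst p) (snd p (Suc r))) \<partial>distr P (?S \<Otimes>\<^sub>M ?T) (\<lambda>\<omega>. (?V \<omega>, ?Y \<omega>)))"
    by (rule integral_distr[symmetric, OF _ Hm]) (intro measurable_Pair Vm Ym)
  also have "\<dots> = (\<integral>v. (\<integral>u. H (sc v (u (Suc r))) \<partial>distr P ?T ?Y) \<partial>distr P ?S ?V)"
  proof -
    have "integrable (distr P ?S ?V \<Otimes>\<^sub>M distr P ?T ?Y) (\<lambda>p. H (sc (fst p) (snd p (Suc r))))"
      by (rule D.integrable_const_bound[where B = B]) (use Hm bd in \<open>auto cong: measurable_cong_sets\<close>)
    from D.integral_fst'[OF this] show ?thesis unfolding dist by simp
  qed
  also have "\<dots> = (\<integral>v. gauss_avg (a / sqrt (real q)) (\<lambda>y. H ((sc v 0)(Suc r := y))) 0 \<partial>distr P ?S ?V)"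
  proof (intro Bochner_Integration.integral_cong refl)
    fix v assume "v \<in> space (distr P ?S ?V)"
    have "(\<lambda>u. H (sc v (u (Suc r)))) \<in> borel_measurable ?T"
    proof (rule coord_lipschitz_measurable[OF H])
      fix j
      have "(\<lambda>u :: nat \<Rightarrow> real. u (Suc r)) \<in> borel_measurable ?T" by (rule measurable_component_singleton) simp
      then show "(\<lambda>u. sc v (u (Suc r)) j) \<in> borel_measurable ?T"
        unfolding sc_def by (cases "j = 0"; cases "j \<le> r"; cases "j = Suc r") auto
    qed
    then have "(\<integral>u. H (sc v (u (Suc r))) \<partial>distr P ?T ?Y) = (\<integral>\<omega>. H (sc v (?Y \<omega> (Suc r))) \<partial>P)"
      by (rule integral_distr[OF Ym])
    then show "(\<integral>u. H (sc v (u (Suc r))) \<partial>distr P ?T ?Y) = gauss_avg (a / sqrt (real q)) (\<lambda>y. H ((sc v 0)(Suc r := y))) 0"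
      using inner[of v] by simp
  qed
  also have "\<dots> = (\<integral>\<omega>. gauss_avg (a / sqrt (real q)) (\<lambda>y. H ((sc (?V \<omega>) 0)(Suc r := y))) 0 \<partial>P)"
  proof (rule integral_distr[OF Vm])
    have Hb: "coord_lipschitz r B L (\<lambda>v. gauss_avg (a / sqrt (real q)) (\<lambda>y. H (v(Suc r := y))) 0)"
      by (rule coord_lipschitz_gauss_avg[OF H])
    show "(\<lambda>v. gauss_avg (a / sqrt (real q)) (\<lambda>y. H ((sc v 0)(Suc r := y))) 0) \<in> borel_measurable ?S"
    proof (rule coord_lipschitz_measurable[OF Hb])
      fix j
      have "(\<lambda>v :: nat \<Rightarrow> real. v i) \<in> borel_measurable ?S" if "i \<le> r" for i
        using that by (intro measurable_component_singleton) auto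
      then show "(\<lambda>v. sc v 0 j) \<in> borel_measurable ?S"
        unfolding sc_def by (cases "j = 0"; cases "j \<le> r"; cases "j = Suc r") auto
    qed
  qed
  also have "\<dots> = (\<integral>\<omega>. gauss_avg (a / sqrt (real q)) (\<lambda>y. H ((bm_vec W X q a \<omega>)(Suc r := y))) 0 \<partial>P)"
  proof -
    have "H ((sc (?V \<omega>) 0)(Suc r := y)) = H ((bm_vec W X q a \<omega>)(Suc r := y))" for \<omega> y
    proof (rule coord_lipschitz_cong[OF H])
      show "((sc (?V \<omega>) 0)(Suc r := y)) j = ((bm_vec W X q a \<omega>)(Suc r := y)) j" if "j \<le> Suc r" for j
        using that by (cases "j = Suc r"; cases j) (auto simp: sc_def bm_vec_def)
    qed
    then show ?thesis by simp
  qed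
  finally show ?thesis .
qed

section \<open>Convergence on a grid\<close>

lemma grid_real_bounds:
  assumes "m > 0"
  shows "real (grid n m b) \<le> real n * (real b / real (m\<^sup>2))" "real n * (real b / real (m\<^sup>2)) - 1 < real (grid n m b)"
proof -
  have "real n * (real b / real (m\<^sup>2)) \<ge> 0" by simp
  then have "real (grid n m b) = real_of_int \<lfloor>real n * (real b / real (m\<^sup>2))\<rfloor>" unfolding grid_def by simp
  then show "real (grid n m b) \<le> real n * (real b / real (m\<^sup>2))" "real n * (real b / real (m\<^sup>2)) - 1 < real (grid n m b)"
    by linarith+
qed

lemma grid_tendsto:
  assumes "m > 0"
  shows "(\<lambda>n. real (grid n m b) / real n) \<longlonglongrightarrow> real b / real (m\<^sup>2)"
proof (rule tendsto_sandwich)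
  show "\<forall>\<^sub>F n in sequentially. real b / real (m\<^sup>2) - 1 / real n \<le> real (grid n m b) / real n"
    using eventually_gt_at_top[of 0]
  proof eventually_elim
    case (elim n)
    have "(real n * (real b / real (m\<^sup>2)) - 1) / real n \<le> real (grid n m b) / real n"
      using grid_real_bounds(2)[OF assms, of n b] by (intro divide_right_mono) auto
    then show ?case using elim by (simp add: diff_divide_distrib)
  qed
  show "\<forall>\<^sub>F n in sequentially. real (grid n m b) / real n \<le> real b / real (m\<^sup>2)"
    using eventually_gt_at_top[of 0]
  proof eventually_elim
    case (elim n)
    have "real (grid n m b) / real n \<le> real n * (real b / real (m\<^sup>2)) / real n"
      using grid_real_bounds(1)[OF assms, of n b] by (intro divide_right_mono) auto
    then show ?case using elim by simp
  qed
  show "(\<lambda>n. real b / real (m\<^sup>2) - 1 / real n) \<longlonglongrightarrow> real b / real (m\<^sup>2)"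
    using tendsto_diff[OF tendsto_const lim_1_over_n, of "real b / real (m\<^sup>2)"] by simp
qed simp

locale scaled_walks =
  fixes K :: "nat \<Rightarrow> nat" and c :: "nat \<Rightarrow> real" and \<sigma> lam :: real
    and M :: "nat \<Rightarrow> 'a measure" and \<mu> :: "nat \<Rightarrow> (nat \<Rightarrow> int) pmf"
    and Y :: "nat \<Rightarrow> nat \<Rightarrow> 'a \<Rightarrow> nat \<Rightarrow> int"
    and N :: "'b measure" and Z0 :: "'b \<Rightarrow> real"
  assumes walk: "\<And>k. k \<ge> 1 \<Longrightarrow>
      simple_random_walk (hypercube k) (hypercube_adj k) (\<mu> k) (M k) (Y k)"
    and K_pos: "\<And>n. K n \<ge> 1" and K_lim: "filterlim K at_top sequentially"
    and c_pos: "\<And>n. c n > 0"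
    and sigma_nonneg: "\<sigma> \<ge> 0" and lam_nonneg: "lam \<ge> 0"
    and Z0: "prob_space N" "Z0 \<in> borel_measurable N"
    and lim_c: "(\<lambda>n. real n / (c n)\<^sup>2) \<longlonglongrightarrow> \<sigma>\<^sup>2"
    and lim_K: "(\<lambda>n. real n / real (K n)) \<longlonglongrightarrow> lam"
    and lim_Z0: "weak_conv_m (\<lambda>n. distr (M (K n)) borel (\<lambda>\<omega>. coord_sum (K n) (Y (K n) 0 \<omega>) / c n)) (distr N borel Z0)"
begin

definition Z :: "nat \<Rightarrow> nat \<Rightarrow> 'a \<Rightarrow> real" where
  "Z n i \<omega> = coord_sum (K n) (Y (K n) i \<omega>) / c n"

definition w :: "nat \<Rightarrow> nat \<Rightarrow> 'a \<Rightarrow> real" where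
  "w n = hypercube_walk.mart (K n) (Y (K n)) (c n)"

definition vec :: "nat \<Rightarrow> nat \<Rightarrow> 'a \<Rightarrow> nat \<Rightarrow> real" where
  "vec n m \<omega> = (\<lambda>j. case j of 0 \<Rightarrow> Z n 0 \<omega> | Suc b \<Rightarrow> w n (grid n m (Suc b)) \<omega> - w n (grid n m b) \<omega>)"

lemma hypercube_walk: "hypercube_walk (M (K n)) (K n) (\<mu> (K n)) (Y (K n))"
proof -
  have "simple_random_walk (hypercube (K n)) (hypercube_adj (K n)) (\<mu> (K n)) (M (K n)) (Y (K n))"
    by (rule walk[OF K_pos])
  then show ?thesis using K_pos
    by (auto simp: hypercube_walk_def hypercube_walk_axioms_def simple_random_walk_def)
qed

lemma prob_space_M: "prob_space (M (K n))"
  using hypercube_walk by (rule hypercube_walk.axioms)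

lemma Z_measurable [measurable]: "Z n i \<in> borel_measurable (M (K n))"
proof -
  interpret hypercube_walk "M (K n)" "K n" "\<mu> (K n)" "Y (K n)" by (rule hypercube_walk)
  show ?thesis unfolding Z_def[abs_def]
    by (rule past_measurable[of i]) (rule past_compose[where H = "\<lambda>v. coord_sum (K n) v / c n"], rule past_Y, simp)
qed

lemma w_measurable [measurable]: "w n i \<in> borel_measurable (M (K n))"
proof -
  interpret hypercube_walk "M (K n)" "K n" "\<mu> (K n)" "Y (K n)" by (rule hypercube_walk)
  show ?thesis unfolding w_def by (rule past_measurable[OF past_mart[OF order_refl]])
qed

lemma vec_measurable: "(\<lambda>\<omega>. vec n m \<omega> j) \<in> borel_measurable (M (K n))"
  unfolding vec_def by (cases j) auto

section \<open>Tightness of the initial values and the variance deficit\<close>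

lemma weak_limit_Z0:
  assumes "\<And>x. isCont f x" "\<And>x. \<bar>f x\<bar> \<le> (B :: real)"
  shows "(\<lambda>n. \<integral>\<omega>. f (Z n 0 \<omega>) \<partial>M (K n)) \<longlonglongrightarrow> (\<integral>\<omega>. f (Z0 \<omega>) \<partial>N)"
proof -
  have fm: "f \<in> borel_measurable borel"
    using assms by (intro borel_measurable_continuous_onI) (simp add: continuous_on_eq_continuous_at)
  have d: "real_distribution (distr (M (K n)) borel (Z n 0))" for n
    using prob_space.prob_space_distr[OF prob_space_M Z_measurable]
    by (simp add: real_distribution_def real_distribution_axioms_def)
  have d0: "real_distribution (distr N borel Z0)"
    using prob_space.prob_space_distr[OF Z0]
    by (simp add: real_distribution_def real_distribution_axioms_def)
  have "(\<lambda>n. integral\<^sup>L (distr (M (K n)) borel (Z n 0)) f) \<longlonglongrightarrow> integral\<^sup>L (distr N borel Z0) f"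
    using lim_Z0 assms by (intro weak_conv_imp_integral_bdd_continuous_conv[OF d d0]) (auto simp: Z_def[abs_def])
  then show ?thesis using fm Z0 by (simp add: integral_distr)
qed

text \<open>Weak convergence is tested on a continuous ramp that vanishes for
  \<open>\<bar>x\<bar> \<le> R\<close> and dominates the indicator of
  \<open>\<bar>x\<bar> > R + 1\<close>; its mean under the limit law is small for large
  \<open>R\<close>.\<close>

lemma tight_Z0:
  assumes "\<epsilon> > 0"
  shows "\<exists>R>0. \<forall>\<^sub>F n in sequentially. measure (M (K n)) {\<omega> \<in> space (M (K n)). \<bar>Z n 0 \<omega>\<bar> > R} \<le> \<epsilon>"
proof -
  interpret N: prob_space N by (rule Z0)
  note [measurable] = Z0(2)
  define f where "f R x = min 1 (max 0 (\<bar>x\<bar> - R))" for R x :: real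
  have cont: "isCont (f R) x" for R x unfolding f_def[abs_def] by (intro continuous_intros)
  have [measurable]: "f R \<in> borel_measurable borel" for R
    using cont by (intro borel_measurable_continuous_onI) (simp add: continuous_on_eq_continuous_at)
  have bd: "\<bar>f R x\<bar> \<le> 1" for R x by (simp add: f_def)
  have "(\<lambda>R. \<integral>\<omega>. f (real R) (Z0 \<omega>) \<partial>N) \<longlonglongrightarrow> (\<integral>\<omega>. 0 \<partial>N)"
  proof (rule integral_dominated_convergence[where w = "\<lambda>_. 1"])
    show "AE \<omega> in N. (\<lambda>R. f (real R) (Z0 \<omega>)) \<longlonglongrightarrow> 0"
    proof (rule AE_I2, rule tendsto_eventually)
      fix \<omega>
      obtain R where "\<bar>Z0 \<omega>\<bar> \<le> real R" using real_arch_simple by blast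
      then show "\<forall>\<^sub>F R in sequentially. f (real R) (Z0 \<omega>) = 0"
        by (intro eventually_sequentiallyI[of R]) (auto simp: f_def)
    qed
  qed (use bd in auto)
  then have "\<forall>\<^sub>F R in sequentially. (\<integral>\<omega>. f (real R) (Z0 \<omega>) \<partial>N) < \<epsilon>"
    using assms by (intro order_tendstoD) auto
  from eventually_happens'[OF sequentially_bot this]
  obtain R where R: "(\<integral>\<omega>. f (real R) (Z0 \<omega>) \<partial>N) < \<epsilon>" by blast
  have "\<forall>\<^sub>F n in sequentially. (\<integral>\<omega>. f (real R) (Z n 0 \<omega>) \<partial>M (K n)) < \<epsilon>"
    using weak_limit_Z0[OF cont bd] R by (rule order_tendstoD)
  then have "\<forall>\<^sub>F n in sequentially. measure (M (K n)) {\<omega> \<in> space (M (K n)). \<bar>Z n 0 \<omega>\<bar> > real R + 1} \<le> \<epsilon>"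
  proof eventually_elim
    case (elim n)
    interpret Mn: prob_space "M (K n)" by (rule prob_space_M)
    let ?A = "{\<omega> \<in> space (M (K n)). \<bar>Z n 0 \<omega>\<bar> > real R + 1}"
    have A: "?A \<in> sets (M (K n))" by measurable
    have "measure (M (K n)) ?A = (\<integral>\<omega>. indicator ?A \<omega> \<partial>M (K n))" using A by simp
    also have "\<dots> \<le> (\<integral>\<omega>. f (real R) (Z n 0 \<omega>) \<partial>M (K n))"
    proof (rule integral_mono)
      show "integrable (M (K n)) (\<lambda>\<omega>. f (real R) (Z n 0 \<omega>))"
        by (rule Mn.integrable_const_bound[where B = 1]) (use bd in auto)
      show "indicator ?A \<omega> \<le> f (real R) (Z n 0 \<omega>)" for \<omega> by (auto simp: indicator_def f_def)
    qed (use A in \<open>auto simp: less_top[symmetric]\<close>)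
    finally show ?case using elim by simp
  qed
  then show ?thesis by (intro exI[of _ "real R + 1"]) auto
qed

text \<open>The square of \<open>1 / c n\<close> is the convergent ratio
  \<open>n / (c n)\<^sup>2\<close> times \<open>1 / n\<close>.\<close>

lemma inv_c_tendsto: "(\<lambda>n. 1 / c n) \<longlonglongrightarrow> 0"
proof -
  have "(\<lambda>n. (real n / (c n)\<^sup>2) * (1 / real n)) \<longlonglongrightarrow> \<sigma>\<^sup>2 * 0"
    by (intro tendsto_mult lim_c lim_1_over_n)
  then have "(\<lambda>n. sqrt ((real n / (c n)\<^sup>2) * (1 / real n))) \<longlonglongrightarrow> sqrt 0"
    by (intro tendsto_real_sqrt) simp
  moreover have "\<forall>\<^sub>F n in sequentially. sqrt ((real n / (c n)\<^sup>2) * (1 / real n)) = 1 / c n"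
    using eventually_gt_at_top[of 0]
    by eventually_elim (use c_pos in \<open>simp add: real_sqrt_divide less_imp_le\<close>)
  ultimately show ?thesis by (simp add: filterlim_cong)
qed

lemma inv_K_tendsto: "(\<lambda>n. 1 / real (K n)) \<longlonglongrightarrow> 0"
  using filterlim_compose[OF lim_1_over_n K_lim] by simp

lemma n_over_K_sq_tendsto: "(\<lambda>n. real n / (real (K n))\<^sup>2) \<longlonglongrightarrow> 0"
  using tendsto_mult[OF lim_K inv_K_tendsto] by (simp add: power2_eq_square)

definition S2 :: "nat \<Rightarrow> real" where
  "S2 n = (\<integral>\<omega>. (coord_sum (K n) (Y (K n) 0 \<omega>))\<^sup>2 \<partial>M (K n))"

lemma S2_nonneg: "S2 n \<ge> 0"
  unfolding S2_def by simp

text \<open>Tightness alone does not make the initial second moment comparable to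
  \<open>c\<^sup>2\<close>, so the expectation is split. Where
  \<open>\<bar>Z n 0\<bar> \<le> R\<close> the integrand is at most
  \<open>R\<^sup>2 * n / K\<^sup>2\<close>, which tends to 0; on the remaining event, of small
  probability, \<open>\<bar>S\<bar> \<le> K\<close> bounds it by
  \<open>n / c\<^sup>2\<close>.\<close>

lemma S2_tendsto: "(\<lambda>n. real n / (c n)\<^sup>2 * (S2 n / (real (K n))\<^sup>2)) \<longlonglongrightarrow> 0"
proof (rule LIMSEQ_I)
  fix e :: real assume e: "e > 0"
  \<comment> \<open>\<open>\<sigma>\<^sup>2 + 1\<close> eventually bounds
    \<open>n / c\<^sup>2\<close>; the 1 leaves room and covers \<open>\<sigma> = 0\<close>.\<close>
  define \<epsilon> where "\<epsilon> = e / 2 / (\<sigma>\<^sup>2 + 1)"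
  have s1: "\<sigma>\<^sup>2 + 1 > 0" by (simp add: add_nonneg_pos)
  have \<epsilon>: "\<epsilon> > 0" using e s1 by (simp add: \<epsilon>_def)
  obtain R where R: "R > 0" "\<forall>\<^sub>F n in sequentially. measure (M (K n)) {\<omega> \<in> space (M (K n)). \<bar>Z n 0 \<omega>\<bar> > R} \<le> \<epsilon>"
    using tight_Z0[OF \<epsilon>] by blast
  have "(\<lambda>n. R\<^sup>2 * (real n / (real (K n))\<^sup>2)) \<longlonglongrightarrow> R\<^sup>2 * 0" by (intro tendsto_mult tendsto_const n_over_K_sq_tendsto)
  then have "\<forall>\<^sub>F n in sequentially. R\<^sup>2 * (real n / (real (K n))\<^sup>2) < e / 2"
    using e by (intro order_tendstoD) auto
  moreover have "\<forall>\<^sub>F n in sequentially. real n / (c n)\<^sup>2 < \<sigma>\<^sup>2 + 1" using lim_c by (rule order_tendstoD) simp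
  ultimately have "\<forall>\<^sub>F n in sequentially. norm (real n / (c n)\<^sup>2 * (S2 n / (real (K n))\<^sup>2) - 0) < e"
    using R(2)
  proof eventually_elim
    case (elim n)
    interpret hw: hypercube_walk "M (K n)" "K n" "\<mu> (K n)" "Y (K n)" by (rule hypercube_walk)
    let ?A = "{\<omega> \<in> space (M (K n)). \<bar>Z n 0 \<omega>\<bar> > R}"
    let ?u = "real n / (c n)\<^sup>2" and ?v = "R\<^sup>2 * (real n / (real (K n))\<^sup>2)"
    have A: "?A \<in> sets (M (K n))" by measurable
    have K0: "real (K n) > 0" using K_pos[of n] by simp
    have "?u * (S2 n / (real (K n))\<^sup>2) = (\<integral>\<omega>. ?u * ((hw.S 0 \<omega>)\<^sup>2 / (real (K n))\<^sup>2) \<partial>M (K n))"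
      by (simp add: S2_def hw.S_def)
    also have "\<dots> \<le> (\<integral>\<omega>. ?v + ?u * indicator ?A \<omega> \<partial>M (K n))"
    proof (rule integral_mono)
      show "integrable (M (K n)) (\<lambda>\<omega>. ?u * ((hw.S 0 \<omega>)\<^sup>2 / (real (K n))\<^sup>2))"
        by (rule hw.past_integrable[of 0]) (rule hw.past_compose[where H = "\<lambda>s. ?u * (s\<^sup>2 / (real (K n))\<^sup>2)"], rule hw.past_S, simp)
      show "integrable (M (K n)) (\<lambda>\<omega>. ?v + ?u * indicator ?A \<omega>)"
        using A by (auto simp: less_top[symmetric])
      fix \<omega> assume om: "\<omega> \<in> space (M (K n))"
      have S: "hw.S 0 \<omega> = c n * Z n 0 \<omega>" using c_pos[of n] by (simp add: hw.S_def Z_def)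
      show "?u * ((hw.S 0 \<omega>)\<^sup>2 / (real (K n))\<^sup>2) \<le> ?v + ?u * indicator ?A \<omega>"
      proof (cases "\<omega> \<in> ?A")
        case True
        have "\<bar>hw.S 0 \<omega>\<bar> \<le> \<bar>real (K n)\<bar>" using hw.abs_S_le[OF om] by simp
        then have "(hw.S 0 \<omega>)\<^sup>2 \<le> (real (K n))\<^sup>2" by (simp only: abs_le_square_iff)
        then have "(hw.S 0 \<omega>)\<^sup>2 / (real (K n))\<^sup>2 \<le> 1" using K0 by simp
        then have le: "?u * ((hw.S 0 \<omega>)\<^sup>2 / (real (K n))\<^sup>2) \<le> ?u * 1" by (rule mult_left_mono) simp
        have "?v \<ge> 0" by simp
        moreover have "indicator ?A \<omega> = (1 :: real)" using True by simp
        ultimately show ?thesis using le by (simp only: add_increasing)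
      next
        case False
        then have "\<bar>Z n 0 \<omega>\<bar> \<le> \<bar>R\<bar>" using om R(1) by auto
        then have "(Z n 0 \<omega>)\<^sup>2 \<le> R\<^sup>2" by (simp only: abs_le_square_iff)
        moreover have "?u * ((hw.S 0 \<omega>)\<^sup>2 / (real (K n))\<^sup>2) = (Z n 0 \<omega>)\<^sup>2 * (real n / (real (K n))\<^sup>2)"
          using c_pos[of n] by (simp add: S power_mult_distrib)
        ultimately have "?u * ((hw.S 0 \<omega>)\<^sup>2 / (real (K n))\<^sup>2) \<le> ?v" by (simp only:) (intro mult_right_mono, auto)
        then show ?thesis using False by simp
      qed
    qed
    also have "\<dots> = ?v + ?u * measure (M (K n)) ?A" using A hw.prob_space by (simp add: less_top[symmetric])
    also have "?u * measure (M (K n)) ?A \<le> (\<sigma>\<^sup>2 + 1) * \<epsilon>"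
      using elim s1 by (intro mult_mono) auto
    also have "(\<sigma>\<^sup>2 + 1) * \<epsilon> = e / 2"
    proof -
      have "d * (e / 2 / d) = e / 2" if "d > 0" for d :: real using that by simp
      from this[OF s1] show ?thesis by (simp only: \<epsilon>_def)
    qed
    finally have "?u * (S2 n / (real (K n))\<^sup>2) < e" using elim(1) by linarith
    moreover have "0 \<le> ?u * (S2 n / (real (K n))\<^sup>2)" using S2_nonneg by simp
    ultimately show ?case by simp
  qed
  then show "\<exists>no. \<forall>n\<ge>no. norm (real n / (c n)\<^sup>2 * (S2 n / (real (K n))\<^sup>2) - 0) < e"
    by (simp add: eventually_sequentially)
qed

text \<open>The last grid increment is exchanged for its Gaussian limit. The smoothing scale is
  chosen from the target error; then, as \<open>n\<close> grows, the Lindeberg error vanishes and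
  the standard deviation \<open>t n\<close> of the block converges.\<close>

lemma fdd_step:
  assumes m: "m > 0" and H: "coord_lipschitz (Suc r) B L H"
  defines "Hb \<equiv> \<lambda>v. gauss_avg (2 * \<sigma> / sqrt (real (m\<^sup>2))) (\<lambda>y. H (v(Suc r := y))) 0"
  shows "(\<lambda>n. (\<integral>\<omega>. H (vec n m \<omega>) \<partial>M (K n)) - (\<integral>\<omega>. Hb (vec n m \<omega>) \<partial>M (K n))) \<longlonglongrightarrow> 0"
proof -
  have L: "L \<ge> 0" using H by (simp add: coord_lipschitz_def)
  define len where "len n = grid n m (Suc r) - grid n m r" for n
  define t where "t n = 2 / c n * sqrt (real (len n))" for n
  have len_real: "real (len n) = real (grid n m (Suc r)) - real (grid n m r)" for n
    unfolding len_def by (simp add: of_nat_diff grid_mono)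
  have len_lim: "(\<lambda>n. real (len n) / real n) \<longlonglongrightarrow> 1 / real (m\<^sup>2)"
    unfolding len_real diff_divide_distrib
    using tendsto_diff[OF grid_tendsto[OF m, of "Suc r"] grid_tendsto[OF m, of r]]
    by (simp add: diff_divide_distrib[symmetric])
  have len_c: "(\<lambda>n. real (len n) / (c n)\<^sup>2) \<longlonglongrightarrow> \<sigma>\<^sup>2 * (1 / real (m\<^sup>2))"
  proof (rule Lim_transform_eventually[OF tendsto_mult[OF lim_c len_lim]])
    show "\<forall>\<^sub>F n in sequentially. real n / (c n)\<^sup>2 * (real (len n) / real n) = real (len n) / (c n)\<^sup>2"
      using eventually_gt_at_top[of 0] by eventually_elim simp
  qed
  have t_lim: "t \<longlonglongrightarrow> 2 * \<sigma> / sqrt (real (m\<^sup>2))"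
  proof -
    have "(\<lambda>n. 2 * sqrt (real (len n) / (c n)\<^sup>2)) \<longlonglongrightarrow> 2 * sqrt (\<sigma>\<^sup>2 * (1 / real (m\<^sup>2)))"
      by (intro tendsto_mult tendsto_const tendsto_real_sqrt len_c)
    moreover have "2 * sqrt (real (len n) / (c n)\<^sup>2) = t n" for n
      using c_pos[of n] by (simp add: t_def real_sqrt_divide less_imp_le)
    moreover have "2 * sqrt (\<sigma>\<^sup>2 * (1 / real (m\<^sup>2))) = 2 * \<sigma> / sqrt (real (m\<^sup>2))"
      using sigma_nonneg by (simp add: real_sqrt_mult real_sqrt_divide)
    ultimately show ?thesis by simp
  qed
  define g where "g n = real (grid n m (Suc r))" for n
  have g_lim: "(\<lambda>n. g n / real n) \<longlonglongrightarrow> real (Suc r) / real (m\<^sup>2)"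
    unfolding g_def by (rule grid_tendsto[OF m])
  define err where "err n = real (len n) * (80 / c n ^ 3 + 4 * (S2 n + 4 * g n) / ((real (K n))\<^sup>2 * (c n)\<^sup>2))" for n
  have err_lim: "err \<longlonglongrightarrow> 0"
  proof -
    \<comment> \<open>\<open>err\<close> rearranged into products of convergent factors, each
      product containing one factor that tends to 0.\<close>
    have "(\<lambda>n. 80 * ((real (len n) / (c n)\<^sup>2) * (1 / c n)) +
        (4 * ((real (len n) / real n) * (real n / (c n)\<^sup>2 * (S2 n / (real (K n))\<^sup>2))) +
         16 * ((real (len n) / (c n)\<^sup>2) * ((g n / real n) * (real n / (real (K n))\<^sup>2))))) \<longlonglongrightarrow>
        80 * (\<sigma>\<^sup>2 * (1 / real (m\<^sup>2)) * 0) + (4 * (1 / real (m\<^sup>2) * 0) + 16 * (\<sigma>\<^sup>2 * (1 / real (m\<^sup>2)) * (real (Suc r) / real (m\<^sup>2) * 0)))"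
      by (intro tendsto_add tendsto_mult tendsto_const len_c len_lim inv_c_tendsto S2_tendsto g_lim n_over_K_sq_tendsto)
    then have "(\<lambda>n. 80 * ((real (len n) / (c n)\<^sup>2) * (1 / c n)) +
        (4 * ((real (len n) / real n) * (real n / (c n)\<^sup>2 * (S2 n / (real (K n))\<^sup>2))) +
         16 * ((real (len n) / (c n)\<^sup>2) * ((g n / real n) * (real n / (real (K n))\<^sup>2))))) \<longlonglongrightarrow> 0" by simp
    then show ?thesis
    proof (rule Lim_transform_eventually)
      show "\<forall>\<^sub>F n in sequentially. 80 * ((real (len n) / (c n)\<^sup>2) * (1 / c n)) +
        (4 * ((real (len n) / real n) * (real n / (c n)\<^sup>2 * (S2 n / (real (K n))\<^sup>2))) +
         16 * ((real (len n) / (c n)\<^sup>2) * ((g n / real n) * (real n / (real (K n))\<^sup>2)))) = err n"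
        using eventually_gt_at_top[of 0]
      proof eventually_elim
        case (elim n)
        have e1: "80 * ((real (len n) / (c n)\<^sup>2) * (1 / c n)) = real (len n) * (80 / c n ^ 3)"
          by (simp add: power3_eq_cube power2_eq_square mult_ac)
        have e2: "(real (len n) / real n) * (real n / (c n)\<^sup>2 * (S2 n / (real (K n))\<^sup>2)) = real (len n) * (S2 n / ((real (K n))\<^sup>2 * (c n)\<^sup>2))"
          using elim by (simp add: mult.commute)
        have e3: "(real (len n) / (c n)\<^sup>2) * ((g n / real n) * (real n / (real (K n))\<^sup>2)) = real (len n) * (g n / ((real (K n))\<^sup>2 * (c n)\<^sup>2))"
          using elim by (simp add: mult.commute)
        show ?case unfolding e1 e2 e3 err_def by (simp add: distrib_left add_divide_distrib mult_ac)
      qed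
    qed
  qed
  have bound: "\<bar>(\<integral>\<omega>. H (vec n m \<omega>) \<partial>M (K n)) - (\<integral>\<omega>. Hb (vec n m \<omega>) \<partial>M (K n))\<bar>
      \<le> 4 * L * \<epsilon> + (L / \<epsilon> + 2 * L / \<epsilon>\<^sup>2) * err n + L * \<bar>t n - 2 * \<sigma> / sqrt (real (m\<^sup>2))\<bar>" if \<epsilon>: "\<epsilon> > 0" for n \<epsilon>
  proof -
    interpret hw: hypercube_walk "M (K n)" "K n" "\<mu> (K n)" "Y (K n)" by (rule hypercube_walk)
    \<comment> \<open>Zeroing the coordinates beyond \<open>r\<close> makes the vector a function of
      the walk up to the start of the last block.\<close>
    define X where "X \<omega> j = (if j \<le> r then vec n m \<omega> j else 0)" for \<omega> j
    have Xp: "hw.past (grid n m r) X"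
    proof (rule hw.past_fun)
      fix j
      show "hw.past (grid n m r) (\<lambda>\<omega>. X \<omega> j)"
      proof (cases "j \<le> r")
        case True
        show ?thesis
        proof (cases j)
          case 0
          have "hw.past (grid n m r) (\<lambda>\<omega>. (\<lambda>s. s / c n) (hw.S 0 \<omega>))"
            by (rule hw.past_compose) (rule hw.past_S, simp)
          then show ?thesis by (simp add: 0 X_def vec_def Z_def hw.S_def)
        next
          case (Suc b)
          have "hw.past (grid n m r) (\<lambda>\<omega>. (\<lambda>x y. x - y) (w n (grid n m (Suc b)) \<omega>) (w n (grid n m b) \<omega>))"
            unfolding w_def using True Suc by (intro hw.past_compose2[where H = "\<lambda>x y. x - y"] hw.past_mart grid_mono) auto
          then show ?thesis using True by (simp add: Suc X_def vec_def)
        qed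
      qed (simp add: X_def hw.past_const)
    qed
    let ?H = "\<lambda>v y. H (v(Suc r := y))"
    have vec_X: "H (vec n m \<omega>) = ?H (X \<omega>) (hw.mart (c n) (grid n m r + len n) \<omega> - hw.mart (c n) (grid n m r) \<omega>)" for \<omega>
    proof (rule coord_lipschitz_cong[OF H])
      fix j assume "j \<le> Suc r"
      then show "vec n m \<omega> j = ((X \<omega>)(Suc r := hw.mart (c n) (grid n m r + len n) \<omega> - hw.mart (c n) (grid n m r) \<omega>)) j"
        using grid_mono[of r "Suc r" n m] by (cases "j = Suc r") (auto simp: X_def vec_def w_def len_def)
    qed
    have Hb_X: "Hb (vec n m \<omega>) = Hb (X \<omega>)" for \<omega>
      unfolding Hb_def by (rule coord_lipschitz_cong[OF coord_lipschitz_gauss_avg[OF H]]) (simp add: X_def)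
    have s: "(\<integral>\<omega>. (hw.S j \<omega>)\<^sup>2 \<partial>M (K n)) \<le> S2 n + 4 * g n" if "j < grid n m r + len n" for j
    proof -
      have "grid n m r + len n = grid n m (Suc r)" unfolding len_def using grid_mono[of r "Suc r" n m] by simp
      then have "real j \<le> g n" using that by (simp add: g_def)
      then show ?thesis using hw.expectation_S_sq_le[of j] by (simp add: S2_def hw.S_def)
    qed
    have 1: "\<bar>(\<integral>\<omega>. H (vec n m \<omega>) \<partial>M (K n)) - (\<integral>\<omega>. gauss_avg (t n) (?H (X \<omega>)) 0 \<partial>M (K n))\<bar>
        \<le> 4 * L * \<epsilon> + real (len n) * ((L / \<epsilon> + 2 * L / \<epsilon>\<^sup>2) * (80 / c n ^ 3 + 4 * (S2 n + 4 * g n) / ((real (K n))\<^sup>2 * (c n)\<^sup>2)))"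
      unfolding vec_X t_def
      by (rule hw.block_clt[OF Xp c_pos \<epsilon> coord_lipschitz_update[OF H] s])
    have i: "integrable (M (K n)) (\<lambda>\<omega>. f (X \<omega>))" for f :: "(nat \<Rightarrow> real) \<Rightarrow> real"
      by (rule hw.past_integrable) (rule hw.past_compose[OF Xp])
    have "\<bar>(\<integral>\<omega>. gauss_avg (t n) (?H (X \<omega>)) 0 \<partial>M (K n)) - (\<integral>\<omega>. Hb (X \<omega>) \<partial>M (K n))\<bar>
        = \<bar>\<integral>\<omega>. gauss_avg (t n) (?H (X \<omega>)) 0 - Hb (X \<omega>) \<partial>M (K n)\<bar>"
      using i[of "\<lambda>v. gauss_avg (t n) (?H v) 0"] i[of Hb] by simp
    also have "\<dots> \<le> (\<integral>\<omega>. \<bar>gauss_avg (t n) (?H (X \<omega>)) 0 - Hb (X \<omega>)\<bar> \<partial>M (K n))" by (rule integral_abs_bound)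
    also have "\<dots> \<le> (\<integral>\<omega>. L * \<bar>t n - 2 * \<sigma> / sqrt (real (m\<^sup>2))\<bar> \<partial>M (K n))"
    proof (rule integral_mono)
      show "integrable (M (K n)) (\<lambda>\<omega>. \<bar>gauss_avg (t n) (?H (X \<omega>)) 0 - Hb (X \<omega>)\<bar>)"
        by (rule i[of "\<lambda>v. \<bar>gauss_avg (t n) (?H v) 0 - Hb v\<bar>"])
      show "\<bar>gauss_avg (t n) (?H (X \<omega>)) 0 - Hb (X \<omega>)\<bar> \<le> L * \<bar>t n - 2 * \<sigma> / sqrt (real (m\<^sup>2))\<bar>" for \<omega>
        unfolding Hb_def by (rule gauss_avg_scale_diff[OF coord_lipschitz_update[OF H] L])
    qed simp
    also have "\<dots> = L * \<bar>t n - 2 * \<sigma> / sqrt (real (m\<^sup>2))\<bar>" using hw.prob_space by simp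
    finally have 2: "\<bar>(\<integral>\<omega>. gauss_avg (t n) (?H (X \<omega>)) 0 \<partial>M (K n)) - (\<integral>\<omega>. Hb (vec n m \<omega>) \<partial>M (K n))\<bar>
       \<le> L * \<bar>t n - 2 * \<sigma> / sqrt (real (m\<^sup>2))\<bar>" unfolding Hb_X .
    have 3: "real (len n) * ((L / \<epsilon> + 2 * L / \<epsilon>\<^sup>2) * (80 / c n ^ 3 + 4 * (S2 n + 4 * g n) / ((real (K n))\<^sup>2 * (c n)\<^sup>2)))
        = (L / \<epsilon> + 2 * L / \<epsilon>\<^sup>2) * err n" unfolding err_def by (simp only: mult.left_commute)
    show ?thesis using 1[unfolded 3] 2 by linarith
  qed
  show ?thesis
  proof (rule LIMSEQ_I)
    fix e :: real assume e: "e > 0"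
    \<comment> \<open>\<open>L + 1\<close> instead of \<open>L\<close> keeps
      \<open>\<epsilon>\<close> positive when \<open>L = 0\<close>.\<close>
    define \<epsilon> where "\<epsilon> = e / (8 * (L + 1))"
    have \<epsilon>: "\<epsilon> > 0" using e L by (simp add: \<epsilon>_def)
    have le: "4 * L * \<epsilon> \<le> e / 2"
    proof -
      have "4 * L * \<epsilon> \<le> 4 * (L + 1) * \<epsilon>" using \<epsilon> by (intro mult_right_mono) auto
      also have "\<dots> = e / 2"
      proof -
        have "4 * d * (e / (8 * d)) = e / 2" if "d > 0" for d :: real using that by simp
        from this[of "L + 1"] L show ?thesis by (simp only: \<epsilon>_def)
      qed
      finally show ?thesis .
    qed
    have "(\<lambda>n. (L / \<epsilon> + 2 * L / \<epsilon>\<^sup>2) * err n + L * \<bar>t n - 2 * \<sigma> / sqrt (real (m\<^sup>2))\<bar>) \<longlonglongrightarrow>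
        (L / \<epsilon> + 2 * L / \<epsilon>\<^sup>2) * 0 + L * \<bar>2 * \<sigma> / sqrt (real (m\<^sup>2)) - 2 * \<sigma> / sqrt (real (m\<^sup>2))\<bar>"
      by (intro tendsto_add tendsto_mult tendsto_const err_lim tendsto_rabs tendsto_diff t_lim)
    then have "\<forall>\<^sub>F n in sequentially. (L / \<epsilon> + 2 * L / \<epsilon>\<^sup>2) * err n + L * \<bar>t n - 2 * \<sigma> / sqrt (real (m\<^sup>2))\<bar> < e / 2"
      using e by (intro order_tendstoD) auto
    then have "\<forall>\<^sub>F n in sequentially. norm ((\<integral>\<omega>. H (vec n m \<omega>) \<partial>M (K n)) - (\<integral>\<omega>. Hb (vec n m \<omega>) \<partial>M (K n)) - 0) < e"
    proof eventually_elim
      case (elim n)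
      have "norm (D - 0) < e" if "\<bar>D\<bar> \<le> u + x + y" "u \<le> e / 2" "x + y < e / 2" for D u x y :: real
        using that by simp
      from this[OF bound[OF \<epsilon>] le elim] show ?case .
    qed
    then show "\<exists>no. \<forall>n\<ge>no. norm ((\<integral>\<omega>. H (vec n m \<omega>) \<partial>M (K n)) - (\<integral>\<omega>. Hb (vec n m \<omega>) \<partial>M (K n)) - 0) < e"
      by (simp add: eventually_sequentially)
  qed
qed

text \<open>The coordinates are removed from the last one down: integrating out the last Gaussian
  leaves the same function \<open>Hb\<close> of the earlier coordinates, asymptotically for the walk
  and exactly for Brownian motion. With no increment left, the claim is the convergence of the
  initial values.\<close>

lemma fdd_convergence:
  assumes W: "brownian_motion P W"
    and X: "distr P borel X = distr N borel Z0"
    and indep: "indep_random_variables P borel X (Pi\<^sub>M {0..} (\<lambda>_. borel)) (sample_path W)"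
    and m: "m > 0" and H: "coord_lipschitz r B L H"
  shows "(\<lambda>n. \<integral>\<omega>. H (vec n m \<omega>) \<partial>M (K n)) \<longlonglongrightarrow> (\<integral>\<omega>. H (bm_vec W X (m\<^sup>2) (2 * \<sigma>) \<omega>) \<partial>P)"
  using H
proof (induction r arbitrary: H)
  case (0 H)
  define h where "h x = H (\<lambda>_. x)" for x
  have bl: "bounded_lipschitz B L h"
    unfolding bounded_lipschitz_def
  proof (intro conjI allI)
    show "\<bar>h x\<bar> \<le> B" for x using 0 by (simp add: h_def coord_lipschitz_def)
    fix x y
    show "\<bar>h x - h y\<bar> \<le> L * \<bar>x - y\<bar>"
      using 0[unfolded coord_lipschitz_def, THEN conjunct2, THEN conjunct2, rule_format, of "\<lambda>_. x" "\<lambda>_. y"]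
      by (simp add: h_def)
  qed
  have h: "H v = h (v 0)" for v unfolding h_def by (rule coord_lipschitz_cong[OF 0]) simp
  have Xm: "X \<in> borel_measurable P" using indep by (simp add: indep_random_variables_def)
  have hm: "h \<in> borel_measurable borel" by (rule bounded_lipschitz_measurable[OF bl])
  have lim: "(\<lambda>n. \<integral>\<omega>. h (Z n 0 \<omega>) \<partial>M (K n)) \<longlonglongrightarrow> (\<integral>\<omega>. h (Z0 \<omega>) \<partial>N)"
  proof (rule weak_limit_Z0)
    show "isCont h x" for x using bounded_lipschitz_continuous[OF bl] by (simp add: continuous_on_eq_continuous_at)
    show "\<bar>h x\<bar> \<le> B" for x using bl by (simp add: bounded_lipschitz_def)
  qed
  have "(\<integral>\<omega>. h (Z0 \<omega>) \<partial>N) = (\<integral>x. h x \<partial>distr N borel Z0)"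
    by (rule integral_distr[symmetric, OF Z0(2) hm])
  also have "\<dots> = (\<integral>\<omega>. h (X \<omega>) \<partial>P)"
    unfolding X[symmetric] by (rule integral_distr[OF Xm hm])
  finally have "(\<lambda>n. \<integral>\<omega>. h (Z n 0 \<omega>) \<partial>M (K n)) \<longlonglongrightarrow> (\<integral>\<omega>. h (X \<omega>) \<partial>P)" using lim by (simp only:)
  then show ?case unfolding h by (simp add: vec_def bm_vec_def)
next
  case (Suc r H)
  define Hb where "Hb = (\<lambda>v. gauss_avg (2 * \<sigma> / sqrt (real (m\<^sup>2))) (\<lambda>y. H (v(Suc r := y))) 0)"
  have "coord_lipschitz r B L Hb" unfolding Hb_def by (rule coord_lipschitz_gauss_avg[OF Suc.prems])
  then have "(\<lambda>n. \<integral>\<omega>. Hb (vec n m \<omega>) \<partial>M (K n)) \<longlonglongrightarrow> (\<integral>\<omega>. Hb (bm_vec W X (m\<^sup>2) (2 * \<sigma>) \<omega>) \<partial>P)"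
    by (rule Suc.IH)
  moreover have "(\<lambda>n. (\<integral>\<omega>. H (vec n m \<omega>) \<partial>M (K n)) - (\<integral>\<omega>. Hb (vec n m \<omega>) \<partial>M (K n))) \<longlonglongrightarrow> 0"
    unfolding Hb_def by (rule fdd_step[OF m Suc.prems])
  ultimately have "(\<lambda>n. (\<integral>\<omega>. H (vec n m \<omega>) \<partial>M (K n)) - (\<integral>\<omega>. Hb (vec n m \<omega>) \<partial>M (K n)) +
      (\<integral>\<omega>. Hb (vec n m \<omega>) \<partial>M (K n))) \<longlonglongrightarrow> 0 + (\<integral>\<omega>. Hb (bm_vec W X (m\<^sup>2) (2 * \<sigma>) \<omega>) \<partial>P)"
    by (intro tendsto_add)
  then
  have lim: "(\<lambda>n. \<integral>\<omega>. H (vec n m \<omega>) \<partial>M (K n)) \<longlonglongrightarrow> (\<integral>\<omega>. Hb (bm_vec W X (m\<^sup>2) (2 * \<sigma>) \<omega>) \<partial>P)"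
    by (simp only: diff_add_cancel add_0_left)
  have eq: "(\<integral>\<omega>. Hb (bm_vec W X (m\<^sup>2) (2 * \<sigma>) \<omega>) \<partial>P) = (\<integral>\<omega>. H (bm_vec W X (m\<^sup>2) (2 * \<sigma>) \<omega>) \<partial>P)"
    unfolding Hb_def using m sigma_nonneg by (intro brownian_last_increment[OF W indep _ _ Suc.prems, symmetric]) auto
  show ?case using lim unfolding eq .
qed

end

section \<open>Convergence in the Skorokhod space\<close>

lemma continuous_map_borel_of_topology:
  assumes "continuous_map T euclideanreal F"
  shows "F \<in> borel_measurable (borel_of_topology T)"
proof (rule borel_measurableI)
  fix S :: "real set" assume "open S"
  have T: "space (borel_of_topology T) = topspace T" "sets (borel_of_topology T) = sigma_sets (topspace T) {U. openin T U}"
    using openin_subset unfolding borel_of_topology_def by (auto simp: space_measure_of_conv subset_iff intro!: sets_measure_of)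
  have "openin T {x \<in> topspace T. F x \<in> S}"
    using assms \<open>open S\<close> by (intro openin_continuous_map_preimage) auto
  moreover have "F -` S \<inter> space (borel_of_topology T) = {x \<in> topspace T. F x \<in> S}" by (auto simp: T)
  ultimately show "F -` S \<inter> space (borel_of_topology T) \<in> sets (borel_of_topology T)" by (simp add: T)
qed

text \<open>Turns a Lipschitz functional of paths into one of finitely many increments, to which the
  grid convergence applies: at each time the two paths differ by a partial sum of coordinate
  differences.\<close>

lemma step_fun_lipschitz:
  assumes L: "L \<ge> 0" and H: "\<And>e e'. \<bar>H e - H e'\<bar> \<le> L * ldist e e'" "\<And>e. \<bar>H e\<bar> \<le> C"
  shows "coord_lipschitz (m ^ 3) C L (\<lambda>v. H (step_fun m v))"
  unfolding coord_lipschitz_def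
proof (intro conjI allI L H(2))
  fix v v' :: "nat \<Rightarrow> real"
  have "ldist (step_fun m v) (step_fun m v') \<le> (\<Sum>j\<le>m ^ 3. \<bar>v j - v' j\<bar>)"
  proof (rule ldist_least)
    fix t :: real
    let ?b = "min (nat \<lfloor>real (m\<^sup>2) * t\<rfloor>) (m ^ 3)"
    have "\<bar>step_fun m v t - step_fun m v' t\<bar> = \<bar>\<Sum>j\<le>?b. v j - v' j\<bar>" by (simp add: step_fun_def sum_subtractf)
    also have "\<dots> \<le> (\<Sum>j\<le>?b. \<bar>v j - v' j\<bar>)" by (rule sum_abs)
    also have "\<dots> \<le> (\<Sum>j\<le>m ^ 3. \<bar>v j - v' j\<bar>)" by (intro sum_mono2) auto
    finally show "min \<bar>step_fun m v t - step_fun m v' t\<bar> (1 / (1 + t)) \<le> (\<Sum>j\<le>m ^ 3. \<bar>v j - v' j\<bar>)" by linarith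
  qed
  then have "L * ldist (step_fun m v) (step_fun m v') \<le> L * (\<Sum>j\<le>m ^ 3. \<bar>v j - v' j\<bar>)" using L by (rule mult_left_mono)
  then show "\<bar>H (step_fun m v) - H (step_fun m v')\<bar> \<le> L * (\<Sum>j\<le>m ^ 3. \<bar>v j - v' j\<bar>)"
    using H(1)[of "step_fun m v" "step_fun m v'"] by linarith
qed

text \<open>Uniform continuity handles times up to \<open>T\<close>, the cap in the distance the
  later ones. Once \<open>T \<le> m\<close>, the cut at \<open>m ^ 3\<close> in
  \<open>step_fun\<close> has no effect on \<open>[0, T]\<close>.\<close>

lemma step_fun_bm_vec_tendsto:
  assumes cont: "continuous_on {0..} (\<lambda>t. W t \<omega>)" and W0: "W 0 \<omega> = 0"
  shows "(\<lambda>m. ldist (step_fun m (bm_vec W X (m\<^sup>2) a \<omega>)) (\<lambda>t. X \<omega> + a * W t \<omega>)) \<longlonglongrightarrow> 0"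
proof (rule LIMSEQ_I)
  fix e :: real assume e: "e > 0"
  obtain T :: nat where T: "1 / (1 + real T) < e"
    using reals_Archimedean[OF e] by (auto simp: inverse_eq_divide)
  have "continuous_on {0..real T} (\<lambda>t. a * W t \<omega>)"
    by (intro continuous_intros continuous_on_subset[OF cont]) auto
  then have "uniformly_continuous_on {0..real T} (\<lambda>t. a * W t \<omega>)"
    by (rule compact_uniformly_continuous) simp
  then obtain d where d: "d > 0" "\<And>s t. s \<in> {0..real T} \<Longrightarrow> t \<in> {0..real T} \<Longrightarrow> dist s t < d \<Longrightarrow> dist (a * W s \<omega>) (a * W t \<omega>) < e / 2"
    unfolding uniformly_continuous_on_def using e by (metis half_gt_zero)
  have "\<forall>\<^sub>F m in sequentially. 1 / real m < d" using lim_1_over_n d(1) by (rule order_tendstoD)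
  moreover have "\<forall>\<^sub>F m in sequentially. T \<le> m \<and> 0 < m" using eventually_ge_at_top[of T] eventually_gt_at_top[of 0] by eventually_elim simp
  ultimately have "\<forall>\<^sub>F m in sequentially. norm (ldist (step_fun m (bm_vec W X (m\<^sup>2) a \<omega>)) (\<lambda>t. X \<omega> + a * W t \<omega>) - 0) < e"
  proof eventually_elim
    case (elim m)
    have "ldist (step_fun m (bm_vec W X (m\<^sup>2) a \<omega>)) (\<lambda>t. X \<omega> + a * W t \<omega>) \<le> max (1 / (1 + real T)) (e / 2)"
    proof (rule ldist_least)
      fix t :: real assume t: "t \<ge> 0"
      define b where "b = nat \<lfloor>real (m\<^sup>2) * t\<rfloor>"
      show "min \<bar>step_fun m (bm_vec W X (m\<^sup>2) a \<omega>) t - (X \<omega> + a * W t \<omega>)\<bar> (1 / (1 + t)) \<le> max (1 / (1 + real T)) (e / 2)"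
      proof (cases "t \<le> real T")
        case False
        then have "1 / (1 + t) \<le> 1 / (1 + real T)" by (intro divide_left_mono) auto
        then show ?thesis by linarith
      next
        case True
        have b: "real b = real_of_int \<lfloor>real (m\<^sup>2) * t\<rfloor>" using t by (simp add: b_def)
        have m2: "m\<^sup>2 > 0" using elim by simp
        have bt: "real b / real (m\<^sup>2) \<le> t" "t - 1 / real (m\<^sup>2) < real b / real (m\<^sup>2)"
          using floor_grid[OF m2, of t] by (auto simp: b)
        have "real b \<le> real (m\<^sup>2) * t" using t unfolding b by simp
        also have "\<dots> \<le> real (m\<^sup>2) * real m" using True elim by (intro mult_left_mono) auto
        also have "\<dots> = real (m ^ 3)" by (simp add: power2_eq_square power3_eq_cube)
        finally have bm: "b \<le> m ^ 3" unfolding of_nat_le_iff .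
        have "1 / real (m\<^sup>2) \<le> 1 / real m" using elim by (simp add: power2_eq_square field_simps)
        then have "dist (real b / real (m\<^sup>2)) t < d" using bt elim by (simp add: dist_real_def)
        then have "dist (a * W (real b / real (m\<^sup>2)) \<omega>) (a * W t \<omega>) < e / 2"
          using bt True t by (intro d(2)) auto
        moreover have "step_fun m (bm_vec W X (m\<^sup>2) a \<omega>) t = X \<omega> + a * W (real b / real (m\<^sup>2)) \<omega>"
        proof -
          have "bm_vec W X (m\<^sup>2) a \<omega> = (\<lambda>j. case j of 0 \<Rightarrow> X \<omega> | Suc b \<Rightarrow> a * W (real (Suc b) / real (m\<^sup>2)) \<omega> - a * W (real b / real (m\<^sup>2)) \<omega>)"
            by (auto simp: bm_vec_def fun_eq_iff right_diff_distrib split: nat.split)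
          then have "step_fun m (bm_vec W X (m\<^sup>2) a \<omega>) t =
              X \<omega> + a * W (real (min b (m ^ 3)) / real (m\<^sup>2)) \<omega> - a * W (real 0 / real (m\<^sup>2)) \<omega>"
            using step_fun_telescope[of m "X \<omega>" "\<lambda>b. a * W (real b / real (m\<^sup>2)) \<omega>" t] by (simp only: b_def)
          also have "min b (m ^ 3) = b" using bm by simp
          finally show ?thesis using W0 by simp
        qed
        ultimately show ?thesis by (simp add: dist_real_def min_def max_def)
      qed
    qed
    moreover have "max (1 / (1 + real T)) (e / 2) < e" using T e by simp
    ultimately have "ldist (step_fun m (bm_vec W X (m\<^sup>2) a \<omega>)) (\<lambda>t. X \<omega> + a * W t \<omega>) < e" by (rule le_less_trans)
    then show ?case by (simp add: ldist_nonneg)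
  qed
  then show "\<exists>no. \<forall>m\<ge>no. norm (ldist (step_fun m (bm_vec W X (m\<^sup>2) a \<omega>)) (\<lambda>t. X \<omega> + a * W t \<omega>) - 0) < e"
    by (simp add: eventually_sequentially)
qed

section \<open>Comparison of the rescaled paths with their discretizations\<close>

context scaled_walks
begin

definition scaled_path :: "nat \<Rightarrow> 'a \<Rightarrow> real \<Rightarrow> real" where
  "scaled_path n \<omega> = (\<lambda>t\<in>{0..}. Z n (nat \<lfloor>real n * t\<rfloor>) \<omega>)"

lemma Z_recursion: "Z n (Suc i) \<omega> - Z n i \<omega> = - (2 / real (K n)) * Z n i \<omega> + (w n (Suc i) \<omega> - w n i \<omega>)"
proof -
  interpret hw: hypercube_walk "M (K n)" "K n" "\<mu> (K n)" "Y (K n)" by (rule hypercube_walk)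
  show ?thesis
    using c_pos[of n] by (simp add: Z_def w_def hw.mart_Suc hw.\<xi>_def hw.S_def field_simps)
qed

text \<open>Three exceptional events have probability at most \<open>\<epsilon> / 3\<close> each:
  the martingale oscillates by \<open>\<eta>\<close> within some cell, it reaches \<open>R\<close>
  within \<open>n * m\<close> steps, or the start exceeds \<open>R0\<close>. Outside them the
  deterministic comparison applies. \<open>R\<close> may depend on \<open>m\<close>, since both are
  fixed before \<open>n\<close> grows.\<close>

lemma scaled_path_close:
  assumes \<epsilon>: "\<epsilon> > 0"
  shows "\<forall>\<^sub>F m in sequentially. \<forall>\<^sub>F n in sequentially. \<exists>A\<in>sets (M (K n)). measure (M (K n)) A \<le> \<epsilon> \<and>
    (\<forall>\<omega>\<in>space (M (K n)) - A. ldist (volterra (2 * lam) (scaled_path n \<omega>)) (step_fun m (vec n m \<omega>)) \<le> \<epsilon>)"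
proof -
  define \<eta> where "\<eta> = \<epsilon> / 2"
  have \<eta>: "\<eta> > 0" using \<epsilon> by (simp add: \<eta>_def)
  have e3: "\<epsilon> / 3 > 0" using \<epsilon> by simp
  have "(\<lambda>m. (1024 * (\<sigma>\<^sup>2)\<^sup>2 / \<eta> ^ 4) * (1 / real m)) \<longlonglongrightarrow> (1024 * (\<sigma>\<^sup>2)\<^sup>2 / \<eta> ^ 4) * 0"
    by (intro tendsto_mult tendsto_const lim_1_over_n)
  then have m1: "\<forall>\<^sub>F m in sequentially. (1024 * (\<sigma>\<^sup>2)\<^sup>2 / \<eta> ^ 4) * (1 / real m) < \<epsilon> / 3"
    using e3 by (intro order_tendstoD) auto
  have m2: "\<forall>\<^sub>F m in sequentially. 1 / real m < \<epsilon>" using lim_1_over_n \<epsilon> by (rule order_tendstoD)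
  show ?thesis using m1 m2 eventually_gt_at_top[of 0]
  proof eventually_elim
    case (elim m)
    have m: "m > 0" by (rule elim(3))
    obtain R0 where R0: "R0 > 0" "\<forall>\<^sub>F n in sequentially. measure (M (K n)) {\<omega> \<in> space (M (K n)). \<bar>Z n 0 \<omega>\<bar> > R0} \<le> \<epsilon> / 3"
      using tight_Z0[OF e3] by blast
    \<comment> \<open>\<open>q / R ^ 4\<close> is the limit of the maximal bound over the whole
      horizon of \<open>n * m\<close> steps; \<open>R \<ge> 1\<close> and
      \<open>R \<ge> 4 * q / \<epsilon>\<close> make it at most
      \<open>\<epsilon> / 4\<close>.\<close>
    define q where "q = 1024 * (real m * \<sigma>\<^sup>2)\<^sup>2"
    define R where "R = max 1 (max R0 (4 * q / \<epsilon>))"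
    have R: "R \<ge> 1" "R \<ge> R0" "R \<ge> 4 * q / \<epsilon>" by (auto simp: R_def)
    have q_less: "q / R ^ 4 < \<epsilon> / 3"
    proof -
      have "4 * q \<le> R * \<epsilon>" using R(3) \<epsilon> by (simp add: field_simps)
      also have "\<dots> \<le> R ^ 4 * \<epsilon>" using R(1) \<epsilon> by (intro mult_right_mono self_le_power) auto
      finally have "q \<le> R ^ 4 * (\<epsilon> / 4)" by simp
      also have "\<dots> < R ^ 4 * (\<epsilon> / 3)" using R(1) \<epsilon> by (intro mult_strict_left_mono) auto
      finally show ?thesis using R(1) by (simp add: divide_less_eq mult.commute)
    qed
    \<comment> \<open>The union bound over \<open>m ^ 3\<close> cells. A cell has at most
      \<open>n / m\<^sup>2 + 1\<close> walk steps, the extra one giving the term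
      \<open>(1 / c n)\<^sup>2\<close>; in the limit the bound is of order
      \<open>1 / m\<close>.\<close>
    have "(\<lambda>n. real (m ^ 3) * (1024 * ((real n / (c n)\<^sup>2) * (1 / real (m\<^sup>2)) + (1 / c n)\<^sup>2)\<^sup>2 / \<eta> ^ 4)) \<longlonglongrightarrow>
        real (m ^ 3) * (1024 * (\<sigma>\<^sup>2 * (1 / real (m\<^sup>2)) + 0\<^sup>2)\<^sup>2 / \<eta> ^ 4)"
      using \<eta> by (intro tendsto_intros lim_c inv_c_tendsto) auto
    moreover have "real (m ^ 3) * (1024 * (\<sigma>\<^sup>2 * (1 / real (m\<^sup>2)) + 0\<^sup>2)\<^sup>2 / \<eta> ^ 4) = (1024 * (\<sigma>\<^sup>2)\<^sup>2 / \<eta> ^ 4) * (1 / real m)"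
    proof -
      have "real (m ^ 3) * (1 / real (m\<^sup>2))\<^sup>2 = 1 / real m" using m by (simp add: power2_eq_square power3_eq_cube)
      moreover have "x * (1024 * (s * u + 0\<^sup>2)\<^sup>2 / h) = (1024 * s\<^sup>2 / h) * (x * u\<^sup>2)" for x s u h :: real
        by (simp add: power_mult_distrib)
      ultimately show ?thesis by (simp only:)
    qed
    ultimately have n1: "\<forall>\<^sub>F n in sequentially. real (m ^ 3) * (1024 * ((real n / (c n)\<^sup>2) * (1 / real (m\<^sup>2)) + (1 / c n)\<^sup>2)\<^sup>2 / \<eta> ^ 4) < \<epsilon> / 3"
      using elim(1) by (intro order_tendstoD(2)) auto
    have "(\<lambda>n. 1024 * (real m * (real n / (c n)\<^sup>2))\<^sup>2 / R ^ 4) \<longlonglongrightarrow> 1024 * (real m * \<sigma>\<^sup>2)\<^sup>2 / R ^ 4"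
      using R(1) by (intro tendsto_intros lim_c) auto
    then have n2: "\<forall>\<^sub>F n in sequentially. 1024 * (real m * (real n / (c n)\<^sup>2))\<^sup>2 / R ^ 4 < \<epsilon> / 3"
      using q_less by (intro order_tendstoD(2)) (auto simp: q_def)
    have "(\<lambda>n. (\<bar>2 * lam - 2 * (real n / real (K n))\<bar> * real m + 2 * lam * (1 / real n)) * (2 * R)) \<longlonglongrightarrow>
        (\<bar>2 * lam - 2 * lam\<bar> * real m + 2 * lam * 0) * (2 * R)"
      by (intro tendsto_intros lim_K lim_1_over_n)
    then have n3: "\<forall>\<^sub>F n in sequentially. (\<bar>2 * lam - 2 * (real n / real (K n))\<bar> * real m + 2 * lam * (1 / real n)) * (2 * R) < \<eta>"
      using \<eta> by (intro order_tendstoD(2)) auto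
    \<comment> \<open>This makes the drift rate \<open>2 / K n\<close> at most 1, as the discrete
      path bound requires.\<close>
    have n4: "\<forall>\<^sub>F n in sequentially. 2 \<le> K n" using K_lim by (simp add: filterlim_at_top)
    show ?case using n1 n2 n3 n4 R0(2) eventually_gt_at_top[of 0]
    proof eventually_elim
      case (elim n)
      interpret hw: hypercube_walk "M (K n)" "K n" "\<mu> (K n)" "Y (K n)" by (rule hypercube_walk)
      have n: "n > 0" by (rule elim(6))
      define len where "len b = grid n m (Suc b) - grid n m b" for b
      define A1 where "A1 b = {\<omega> \<in> space (M (K n)). \<exists>l\<le>len b. \<bar>hw.mart (c n) (grid n m b + l) \<omega> - hw.mart (c n) (grid n m b) \<omega>\<bar> \<ge> \<eta>}" for b
      define A2 where "A2 = {\<omega> \<in> space (M (K n)). \<exists>l\<le>n * m. \<bar>hw.mart (c n) (0 + l) \<omega> - hw.mart (c n) 0 \<omega>\<bar> \<ge> R}"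
      define A3 where "A3 = {\<omega> \<in> space (M (K n)). \<bar>Z n 0 \<omega>\<bar> > R0}"
      define A where "A = (\<Union>b<m ^ 3. A1 b) \<union> A2 \<union> A3"
      have R_pos: "R > 0" using R(1) by simp
      have A1: "A1 b \<in> sets (M (K n))" "measure (M (K n)) (A1 b) \<le> 1024 * (real (len b) / (c n)\<^sup>2)\<^sup>2 / \<eta> ^ 4" for b
        unfolding A1_def by (rule hw.max_mart_bound[OF c_pos \<eta>])+
      have A2: "A2 \<in> sets (M (K n))" "measure (M (K n)) A2 \<le> 1024 * (real (n * m) / (c n)\<^sup>2)\<^sup>2 / R ^ 4"
        unfolding A2_def by (rule hw.max_mart_bound[OF c_pos R_pos])+
      have A3: "A3 \<in> sets (M (K n))" "measure (M (K n)) A3 \<le> \<epsilon> / 3"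
        unfolding A3_def using elim(5) by auto
      have A: "A \<in> sets (M (K n))" unfolding A_def using A1 A2 A3 by auto
      have len_le: "real (len b) / (c n)\<^sup>2 \<le> (real n / (c n)\<^sup>2) * (1 / real (m\<^sup>2)) + (1 / c n)\<^sup>2" for b
      proof -
        have "real (len b) = real (grid n m (Suc b)) - real (grid n m b)"
          unfolding len_def by (simp add: of_nat_diff grid_mono)
        also have "\<dots> \<le> real n * (real (Suc b) / real (m\<^sup>2)) - (real n * (real b / real (m\<^sup>2)) - 1)"
          using grid_real_bounds(1)[OF m, of n "Suc b"] grid_real_bounds(2)[OF m, of n b] by linarith
        also have "\<dots> = real n * (1 / real (m\<^sup>2)) + 1" by (simp add: add_divide_distrib distrib_left)
        finally have "real (len b) / (c n)\<^sup>2 \<le> (real n * (1 / real (m\<^sup>2)) + 1) / (c n)\<^sup>2" by (rule divide_right_mono) simp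
        then show ?thesis by (simp add: add_divide_distrib power_divide mult.commute)
      qed
      have "measure (M (K n)) (\<Union>b<m ^ 3. A1 b) \<le> (\<Sum>b<m ^ 3. measure (M (K n)) (A1 b))"
        using A1 by (intro hw.finite_measure_subadditive_finite) auto
      also have "\<dots> \<le> (\<Sum>b<m ^ 3. 1024 * ((real n / (c n)\<^sup>2) * (1 / real (m\<^sup>2)) + (1 / c n)\<^sup>2)\<^sup>2 / \<eta> ^ 4)"
        by (intro sum_mono order_trans[OF A1(2)] divide_right_mono mult_left_mono power_mono len_le) (use \<eta> in auto)
      also have "\<dots> = real (m ^ 3) * (1024 * ((real n / (c n)\<^sup>2) * (1 / real (m\<^sup>2)) + (1 / c n)\<^sup>2)\<^sup>2 / \<eta> ^ 4)" by simp
      finally have P1: "measure (M (K n)) (\<Union>b<m ^ 3. A1 b) \<le> \<epsilon> / 3" using elim(1) by linarith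
      have P2: "measure (M (K n)) A2 \<le> \<epsilon> / 3"
      proof -
        have "real (n * m) / (c n)\<^sup>2 = real m * (real n / (c n)\<^sup>2)" by simp
        then show ?thesis using A2(2) elim(2) by (simp only:)
      qed
      have U: "(\<Union>b<m ^ 3. A1 b) \<in> sets (M (K n))" using A1 by auto
      have "measure (M (K n)) A \<le> measure (M (K n)) ((\<Union>b<m ^ 3. A1 b) \<union> A2) + measure (M (K n)) A3"
        unfolding A_def using U A2 A3 by (intro measure_Un_le) auto
      also have "measure (M (K n)) ((\<Union>b<m ^ 3. A1 b) \<union> A2) \<le> measure (M (K n)) (\<Union>b<m ^ 3. A1 b) + measure (M (K n)) A2"
        using U A2 by (intro measure_Un_le) auto
      finally have PA: "measure (M (K n)) A \<le> \<epsilon>" using P1 P2 A3(2) by linarith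
      have "ldist (volterra (2 * lam) (scaled_path n \<omega>)) (step_fun m (vec n m \<omega>)) \<le> \<epsilon>" if om: "\<omega> \<in> space (M (K n)) - A" for \<omega>
      proof -
        have w0: "w n 0 \<omega> = 0" by (simp add: w_def hw.mart_def)
        have "ldist (volterra (2 * lam) (scaled_path n \<omega>)) (step_fun m (vec n m \<omega>)) \<le> max (1 / (1 + real m)) (2 * \<eta>)"
          unfolding scaled_path_def vec_def
        proof (rule ldist_step_close[where z = "\<lambda>i. Z n i \<omega>" and w = "\<lambda>i. w n i \<omega>" and q = "2 / real (K n)" and R = R])
          show "n > 0" "m > 0" by (rule n, rule m)
          show "0 \<le> lam" by (rule lam_nonneg)
          show "0 \<le> 2 / real (K n)" by simp
          show "2 / real (K n) \<le> 1" using elim(4) by simp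
          show "Z n (Suc i) \<omega> - Z n i \<omega> = - (2 / real (K n)) * Z n i \<omega> + (w n (Suc i) \<omega> - w n i \<omega>)" for i by (rule Z_recursion)
          show "w n 0 \<omega> = 0" by (rule w0)
          show "\<bar>Z n 0 \<omega>\<bar> \<le> R" using om R(2) by (auto simp: A_def A3_def)
          show "\<bar>w n i \<omega>\<bar> \<le> R" if "i \<le> n * m" for i
            using om that w0 by (force simp: A_def A2_def w_def)
          show "\<bar>w n i \<omega> - w n (grid n m b) \<omega>\<bar> \<le> \<eta>" if b: "b < m ^ 3" "grid n m b \<le> i" "i \<le> grid n m (Suc b)" for b i
          proof -
            have "\<omega> \<notin> A1 b" using om b by (auto simp: A_def)
            moreover have "i - grid n m b \<le> len b" "grid n m b + (i - grid n m b) = i" using b by (auto simp: len_def)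
            ultimately have "\<not> \<bar>hw.mart (c n) i \<omega> - hw.mart (c n) (grid n m b) \<omega>\<bar> \<ge> \<eta>"
              using om unfolding A1_def by (metis (mono_tags, lifting) DiffD1 mem_Collect_eq)
            then show ?thesis by (simp add: w_def)
          qed
          show "(\<bar>2 * lam - real n * (2 / real (K n))\<bar> * real m + 2 * lam / real n) * (2 * R) \<le> \<eta>"
            using elim(3) by (simp add: mult.commute)
        qed
        also have "\<dots> \<le> \<epsilon>"
        proof -
          have "1 / (1 + real m) \<le> 1 / real m" using m by (intro divide_left_mono) auto
          then show ?thesis using \<open>1 / real m < \<epsilon>\<close> by (simp add: \<eta>_def)
        qed
        finally show ?thesis .
      qed
      then show ?case using A PA by blast
    qed
  qed
qed

lemma scaled_path_tame: "scaled_path n \<omega> \<in> tame_paths"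
  unfolding scaled_path_def by (rule step_tame)

lemma scaled_path_eq_sample_path: "scaled_path n = sample_path (\<lambda>t. Z n (nat \<lfloor>real n * t\<rfloor>))"
  by (simp add: scaled_path_def sample_path_def fun_eq_iff)

lemma scaled_path_measurable: "scaled_path n \<in> M (K n) \<rightarrow>\<^sub>M borel_of_topology skorokhod_topology"
proof -
  interpret hw: hypercube_walk "M (K n)" "K n" "\<mu> (K n)" "Y (K n)" by (rule hypercube_walk)
  have "scaled_path n = sample_path (\<lambda>t \<omega>. (\<lambda>v. coord_sum (K n) v / c n) (Y (K n) (nat \<lfloor>real n * t\<rfloor>) \<omega>))"
    by (simp add: scaled_path_def sample_path_def fun_eq_iff Z_def)
  then show ?thesis using hw.step_path_measurable[of "\<lambda>v. coord_sum (K n) v / c n" n] by simp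
qed

lemma expectation_lower_limit:
  assumes W: "brownian_motion P W"
    and Ou: "solves_linear_sde P W (2 * lam) (2 * \<sigma>) Ou"
    and Ou_0: "distr P borel (Ou 0) = distr N borel Z0"
    and indep: "indep_random_variables P borel (Ou 0) (Pi\<^sub>M {0..} (\<lambda>_. borel)) (sample_path W)"
    and F: "continuous_map skorokhod_topology euclideanreal F" "\<And>x. x \<in> cadlag_paths \<Longrightarrow> \<bar>F x\<bar> \<le> B"
    and \<epsilon>: "\<epsilon> > 0"
  shows "\<forall>\<^sub>F n in sequentially. (\<integral>\<omega>. F (sample_path Ou \<omega>) \<partial>P) - \<epsilon> \<le> (\<integral>\<omega>. F (scaled_path n \<omega>) \<partial>M (K n))"
proof -
  have tame_cad: "x \<in> cadlag_paths" if "x \<in> tame_paths" for x using that by (simp add: tame_paths_def)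
  interpret reg: lipschitz_regularization ldist "volterra (2 * lam)" tame_paths F B
  proof
    show "tame_paths \<noteq> {}" using scaled_path_tame by blast
  qed (auto simp: ldist_nonneg ldist_le_1 ldist_refl ldist_triangle tame_cad F(2) intro: ldist_commute)
  have Ou_m: "\<And>t. t \<ge> 0 \<Longrightarrow> Ou t \<in> borel_measurable P"
    and Ou_c: "\<And>\<omega>. \<omega> \<in> space P \<Longrightarrow> continuous_on {0..} (\<lambda>t. Ou t \<omega>)"
    and Ou_eq: "AE \<omega> in P. \<forall>t\<ge>0. Ou t \<omega> = Ou 0 \<omega> + integral {0..t} (\<lambda>s. - (2 * lam) * Ou s \<omega>) + 2 * \<sigma> * W t \<omega>"
    using Ou by (auto simp: solves_linear_sde_def)
  have Ou_tame: "sample_path Ou \<omega> \<in> tame_paths" if "\<omega> \<in> space P" for \<omega>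
    unfolding sample_path_def by (rule continuous_tame[OF Ou_c[OF that]])
  have Fm: "F \<in> borel_measurable (borel_of_topology skorokhod_topology)" by (rule continuous_map_borel_of_topology[OF F(1)])
  have W_m: "\<And>t. t \<ge> 0 \<Longrightarrow> W t \<in> borel_measurable P" and W_0: "AE \<omega> in P. W 0 \<omega> = 0"
    and W_c: "AE \<omega> in P. continuous_on {0..} (\<lambda>t. W t \<omega>)"
    using W by (auto simp: brownian_motion_def)
  have bm: "(\<lambda>\<omega>. bm_vec W (Ou 0) q a \<omega> j) \<in> borel_measurable P" for q a j
  proof (cases j)
    case 0
    then show ?thesis using Ou_m[of 0] by (simp add: bm_vec_def)
  next
    case (Suc b)
    have "(\<lambda>\<omega>. a * (W (real (Suc b) / real q) \<omega> - W (real b / real q) \<omega>)) \<in> borel_measurable P"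
      by (intro borel_measurable_times borel_measurable_const borel_measurable_diff W_m) auto
    then show ?thesis by (simp add: Suc bm_vec_def)
  qed
  show ?thesis
  \<comment> \<open>The discretization parameter is shifted by one: convergence of the discretized
    expectations is required for every \<open>m\<close>, and the grid needs a positive
    parameter.\<close>
  proof (rule reg.expectation_lower_semicontinuous[where p = "\<lambda>m n \<omega>. step_fun (Suc m) (vec n (Suc m) \<omega>)"
        and p\<^sub>0 = "\<lambda>m \<omega>. step_fun (Suc m) (bm_vec W (Ou 0) ((Suc m)\<^sup>2) (2 * \<sigma>) \<omega>)"])
    show "prob_space (M (K n))" for n by (rule prob_space_M)
    show "prob_space P" using W by (simp add: brownian_motion_def)
    show "scaled_path n \<omega> \<in> tame_paths" for n \<omega> by (rule scaled_path_tame)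
    show "sample_path Ou \<omega> \<in> tame_paths" if "\<omega> \<in> space P" for \<omega> by (rule Ou_tame[OF that])
    show "(\<lambda>\<omega>. F (scaled_path n \<omega>)) \<in> borel_measurable (M (K n))" for n
      by (rule measurable_compose[OF scaled_path_measurable Fm])
    show "(\<lambda>\<omega>. F (sample_path Ou \<omega>)) \<in> borel_measurable P"
      by (rule measurable_compose[OF continuous_sample_path_measurable[OF Ou_m Ou_c] Fm])
    show "(\<lambda>j. F (X j)) \<longlonglongrightarrow> F (sample_path Ou \<omega>)"
      if "\<omega> \<in> space P" "\<And>j. X j \<in> tame_paths" "(\<lambda>j. ldist (volterra (2 * lam) (sample_path Ou \<omega>)) (volterra (2 * lam) (X j))) \<longlonglongrightarrow> 0" for \<omega> X
      using that lam_nonneg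
      by (intro continuous_map_skorokhod_tendsto[OF F(1)] tame_cad Ou_tame volterra_tendsto_uniform[where a = "2 * lam"]) auto
    show "(\<lambda>\<omega>. H (step_fun (Suc m) (bm_vec W (Ou 0) ((Suc m)\<^sup>2) (2 * \<sigma>) \<omega>))) \<in> borel_measurable P \<and>
      (\<forall>n. (\<lambda>\<omega>. H (step_fun (Suc m) (vec n (Suc m) \<omega>))) \<in> borel_measurable (M (K n))) \<and>
      (\<lambda>n. \<integral>\<omega>. H (step_fun (Suc m) (vec n (Suc m) \<omega>)) \<partial>M (K n)) \<longlonglongrightarrow>
        (\<integral>\<omega>. H (step_fun (Suc m) (bm_vec W (Ou 0) ((Suc m)\<^sup>2) (2 * \<sigma>) \<omega>)) \<partial>P)"
      if "0 \<le> L" "\<And>e e'. \<bar>H e - H e'\<bar> \<le> L * ldist e e'" "\<And>e. \<bar>H e\<bar> \<le> C" for m H L C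
    proof -
      have cl: "coord_lipschitz (Suc m ^ 3) C L (\<lambda>v. H (step_fun (Suc m) v))" by (rule step_fun_lipschitz[OF that])
      show ?thesis
        by (intro conjI allI coord_lipschitz_measurable[OF cl bm] coord_lipschitz_measurable[OF cl vec_measurable]
            fdd_convergence[OF W Ou_0 indep _ cl]) simp
    qed
    show "\<forall>\<^sub>F m in sequentially. \<forall>\<^sub>F n in sequentially. \<exists>A\<in>sets (M (K n)). measure (M (K n)) A \<le> e \<and>
      (\<forall>\<omega>\<in>space (M (K n)) - A. ldist (volterra (2 * lam) (scaled_path n \<omega>)) (step_fun (Suc m) (vec n (Suc m) \<omega>)) \<le> e)"
      if "e > 0" for e
      using scaled_path_close[OF that] by (subst eventually_sequentially_Suc)
    show "AE \<omega> in P. (\<lambda>m. ldist (step_fun (Suc m) (bm_vec W (Ou 0) ((Suc m)\<^sup>2) (2 * \<sigma>) \<omega>)) (volterra (2 * lam) (sample_path Ou \<omega>))) \<longlonglongrightarrow> 0"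
      using Ou_eq W_0 W_c
    proof eventually_elim
      case (elim \<omega>)
      \<comment> \<open>The Volterra map cancels the drift integral of the equation, pathwise off a
        null set, and leaves the driving term; nonnegative times suffice because the distance looks
        at no others.\<close>
      have v: "volterra (2 * lam) (sample_path Ou \<omega>) t = Ou 0 \<omega> + 2 * \<sigma> * W t \<omega>" if t: "t \<ge> 0" for t
      proof -
        have i: "integral {0..t} (sample_path Ou \<omega>) = integral {0..t} (\<lambda>s. Ou s \<omega>)"
          by (rule integral_cong) (simp add: sample_path_def)
        have "Ou t \<omega> = Ou 0 \<omega> + - (2 * lam) * integral {0..t} (\<lambda>s. Ou s \<omega>) + 2 * \<sigma> * W t \<omega>"
          using elim(1)[rule_format, OF t] by (simp only: integral_mult_right)
        moreover have "sample_path Ou \<omega> t = Ou t \<omega>" using t by (simp add: sample_path_def)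
        ultimately show ?thesis unfolding volterra_def i by linarith
      qed
      have "ldist x (volterra (2 * lam) (sample_path Ou \<omega>)) = ldist x (\<lambda>t. Ou 0 \<omega> + 2 * \<sigma> * W t \<omega>)" for x
        unfolding ldist_def by (intro SUP_cong) (simp_all add: v)
      then show ?case
        using LIMSEQ_Suc[OF step_fun_bm_vec_tendsto[where W = W and \<omega> = \<omega> and X = "Ou 0" and a = "2 * \<sigma>", OF elim(3,2)]] by (simp only:)
    qed
    show "\<epsilon> > 0" by (rule \<epsilon>)
  qed
qed

lemma convergence_in_distribution:
  assumes W: "brownian_motion P W"
    and Ou: "solves_linear_sde P W (2 * lam) (2 * \<sigma>) Ou"
    and Ou_0: "distr P borel (Ou 0) = distr N borel Z0"
    and indep: "indep_random_variables P borel (Ou 0) (Pi\<^sub>M {0..} (\<lambda>_. borel)) (sample_path W)"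
  shows "converges_in_distribution skorokhod_topology (\<lambda>n. M (K n)) scaled_path P (sample_path Ou)"
  unfolding converges_in_distribution_def
proof (intro conjI allI impI)
  show "scaled_path n \<in> M (K n) \<rightarrow>\<^sub>M borel_of_topology skorokhod_topology" for n by (rule scaled_path_measurable)
  show "sample_path Ou \<in> P \<rightarrow>\<^sub>M borel_of_topology skorokhod_topology"
    using Ou by (intro continuous_sample_path_measurable) (auto simp: solves_linear_sde_def)
  fix F :: "(real \<Rightarrow> real) \<Rightarrow> real"
  assume F: "continuous_map skorokhod_topology euclideanreal F \<and> bounded (F ` topspace skorokhod_topology)"
  then obtain B where B: "\<And>x. x \<in> cadlag_paths \<Longrightarrow> \<bar>F x\<bar> \<le> B"
    unfolding topspace_skorokhod_topology bounded_iff by auto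
  have F': "continuous_map skorokhod_topology euclideanreal (\<lambda>x. - F x)" using F by (intro continuous_map_minus) auto
  note lower = expectation_lower_limit[OF W Ou Ou_0 indep]
  show "(\<lambda>n. \<integral>\<omega>. F (scaled_path n \<omega>) \<partial>M (K n)) \<longlonglongrightarrow> (\<integral>\<omega>. F (sample_path Ou \<omega>) \<partial>P)"
  proof (rule LIMSEQ_I)
    fix e :: real assume "e > 0"
    then have e: "e / 2 > 0" by simp
    have "\<forall>\<^sub>F n in sequentially. (\<integral>\<omega>. F (sample_path Ou \<omega>) \<partial>P) - e / 2 \<le> (\<integral>\<omega>. F (scaled_path n \<omega>) \<partial>M (K n))"
      by (rule lower[OF conjunct1[OF F] B e])
    moreover have "\<forall>\<^sub>F n in sequentially. (\<integral>\<omega>. - F (sample_path Ou \<omega>) \<partial>P) - e / 2 \<le> (\<integral>\<omega>. - F (scaled_path n \<omega>) \<partial>M (K n))"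
      by (rule lower[OF F' _ e, of B]) (simp add: B)
    ultimately have "\<forall>\<^sub>F n in sequentially. norm ((\<integral>\<omega>. F (scaled_path n \<omega>) \<partial>M (K n)) - (\<integral>\<omega>. F (sample_path Ou \<omega>) \<partial>P)) < e"
      by eventually_elim (use \<open>e > 0\<close> in auto)
    then show "\<exists>no. \<forall>n\<ge>no. norm ((\<integral>\<omega>. F (scaled_path n \<omega>) \<partial>M (K n)) - (\<integral>\<omega>. F (sample_path Ou \<omega>) \<partial>P)) < e"
      by (simp add: eventually_sequentially)
  qed
qed

end

theorem theorem1:
  fixes K :: "nat \<Rightarrow> nat" and c :: "nat \<Rightarrow> real" and \<sigma> lam :: real
    and M :: "nat \<Rightarrow> 'a measure" and \<mu> :: "nat \<Rightarrow> (nat \<Rightarrow> int) pmf"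
    and Y :: "nat \<Rightarrow> nat \<Rightarrow> 'a \<Rightarrow> nat \<Rightarrow> int"
    and Z :: "nat \<Rightarrow> nat \<Rightarrow> 'a \<Rightarrow> real"
    and N :: "'b measure" and Z0 :: "'b \<Rightarrow> real"
    and P :: "'c measure" and W Ou :: "real \<Rightarrow> 'c \<Rightarrow> real"
  assumes walk: "\<And>k. k \<ge> 1 \<Longrightarrow>
      simple_random_walk (hypercube k) (hypercube_adj k) (\<mu> k) (M k) (Y k)"
    and K_pos: "\<And>n. K n \<ge> 1" and K_lim: "filterlim K at_top sequentially"
    and c_pos: "\<And>n. c n > 0"
    and Z_def: "\<And>n i \<omega>. Z n i \<omega> = coord_sum (K n) (Y (K n) i \<omega>) / c n"
    and sigma_nonneg: "\<sigma> \<ge> 0" and lam_nonneg: "lam \<ge> 0"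
    and Z0: "prob_space N" "Z0 \<in> borel_measurable N"
    and lim_c: "(\<lambda>n. real n / (c n)\<^sup>2) \<longlonglongrightarrow> \<sigma>\<^sup>2"
    and lim_K: "(\<lambda>n. real n / real (K n)) \<longlonglongrightarrow> lam"
    and lim_Z0: "weak_conv_m (\<lambda>n. distr (M (K n)) borel (Z n 0)) (distr N borel Z0)"
    and W: "brownian_motion P W"
    and Ou: "solves_linear_sde P W (2 * lam) (2 * \<sigma>) Ou"
    and Ou_0: "distr P borel (Ou 0) = distr N borel Z0"
    and indep: "indep_random_variables P borel (Ou 0) (Pi\<^sub>M {0..} (\<lambda>_. borel)) (sample_path W)"
  shows "converges_in_distribution skorokhod_topology
      (\<lambda>n. M (K n)) (\<lambda>n. sample_path (\<lambda>t. Z n (nat \<lfloor>real n * t\<rfloor>))) P (sample_path Ou)"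
proof -
  have Z_eq: "Z n i = (\<lambda>\<omega>. coord_sum (K n) (Y (K n) i \<omega>) / c n)" for n i
    by (rule ext) (rule Z_def)
  have lim: "weak_conv_m (\<lambda>n. distr (M (K n)) borel (\<lambda>\<omega>. coord_sum (K n) (Y (K n) 0 \<omega>) / c n)) (distr N borel Z0)"
    using lim_Z0 unfolding Z_eq .
  interpret sw: scaled_walks K c \<sigma> lam M \<mu> Y N Z0
    by (rule scaled_walks.intro)
      (fact walk K_pos K_lim c_pos sigma_nonneg lam_nonneg Z0 lim_c lim_K lim)+
  have "sw.scaled_path = (\<lambda>n. sample_path (\<lambda>t. Z n (nat \<lfloor>real n * t\<rfloor>)))"
    by (simp add: fun_eq_iff sw.scaled_path_eq_sample_path sample_path_def sw.Z_def Z_def)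
  then show ?thesis using sw.convergence_in_distribution[OF W Ou Ou_0 indep] by simp
qed

end
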